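(* Let $\gamma\in[0,1)$ and suppose $(\sigma_{t,x})_{(t,x)\in\mathbb N\times\mathbb X}$ is normalized, i.e. $\sigma_{t,x}(\delta_0)=0$ for all $(t,x)\in\mathbb N\times\mathbb X$. Assume that for every $t\in\mathbb N$: (i) $(x,a)\mapsto P(t,x,a,\cdot)$ is weakly continuous, i.e. $\int f\,dP(t,x^n,a^n,\cdot)\to\int f\,dP(t,x^0,a^0,\cdot)$ for all $f\in C_b(\mathbb X)$ whenever $x^n\to x^0$ in $\mathbb X$ and $a^n\to a^0$ in $\mathbb A$; (ii) $\bigcup_{x\in\mathbb X}\mathcal A_t(x)$ is compact and $\mathcal A_t$ is upper hemi-continuous (for every $x$ and every open $U_{\mathbb A}\supseteq\mathcal A_t(x)$ there is an open $U_{\mathbb X}\ni x$ with $\mathcal A_t(z)\subseteq U_{\mathbb A}$ for all $z\in U_{\mathbb X}$); (iii) for every compact $K\subset\mathbb R$, every $(\mu^n)_{n\in\mathbb N}\subset\mathcal P(K)$ converging weakly to $\mu^0\in\mathcal P(K)$ and every $x^n\to x^0$ in $\mathbb X$, $\liminf_{n\to\infty}\sigma_{t,x^n}(\mu^n)\ge\sigma_{t,x^0}(\mu^0)$; (iv) $C_t$ is lower semi-continuous and $\|C_t\|_\infty\le b$, where $b>0$ does not depend on $t$. Then: (a) $J^*_{t,\infty}=S_tJ^*_{t+1,\infty}$ for all $t\in\mathbb N$. Moreover, if $(J'_{t,\infty})_{t\in\mathbb N}\in\ell^\infty(\mathbb N;\mathbb X,\mathcal B(\mathbb X))$ satisfies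 $J'_{t,\infty}=S_tJ'_{t+1,\infty}$ for all $t\in\mathbb N$, then $(J'_{t,\infty})_{t\in\mathbb N}=(J^*_{t,\infty})_{t\in\mathbb N}$. (b) For every $t\in\mathbb N$ and $x\in\mathbb X$, $\arg\min_{\lambda\in\varpi_t(x)}G^\lambda_tJ^*_{t+1,\infty}(x)$ is nonempty and closed, and there is a measurable $\pi^*_t:(\mathbb X,\mathcal B(\mathbb X))\to(\Lambda,\mathcal E(\Lambda))$ with $$\pi^*_t(x)\in\arg\min_{\lambda\in\varpi_t(x)}G^\lambda_tJ^*_{t+1,\infty}(x),\qquad x\in\mathbb X.\qquad(\ast)$$ (c) If $\mathfrak p^*=(\pi^*_t)_{t\in\mathbb N}$ consists of measurable maps satisfying $(\ast)$ for all $t\in\mathbb N$, then $J^{\mathfrak p^*}_{t,\infty}=J^*_{t,\infty}=\inf_{\mathfrak p\in\Pi}J^{\mathfrak p}_{t,\infty}$ (pointwise on $\mathbb X$) for all $t\in\mathbb N$, and $$J^{\mathfrak p^*}_{0,\infty}=H_0J^*_{1,\infty}=\inf_{(\mathfrak X^{\mathfrak p},\mathfrak A^{\mathfrak p})\in\Psi}\varsigma^{\mathfrak X^{\mathfrak p}}_{0,\infty}(\mathfrak C^{\mathfrak p}),$$ where the infimum is over all Markovian policies $\mathfrak p\in\Pi$.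
   Context: Spaces. $\mathbb N=\{1,2,\dots\}$, $\mathbb N_0=\{0\}\cup\mathbb N$. $\mathbb X$ (states) and $\mathbb A$ (actions) are complete separable metric spaces with Borel $\sigma$-algebras. $\Lambda$ is the set of Borel probability measures on $\mathbb A$ with the weak topology; its Borel $\sigma$-algebra equals $\mathcal E(\Lambda)$, the $\sigma$-algebra generated by the maps $\lambda\mapsto\lambda(B)$, $B\in\mathcal B(\mathbb A)$. $\ell^\infty(\mathbb X,\mathcal B(\mathbb X))$ is the space of bounded Borel functions with sup norm; $\ell^\infty(\mathbb N;\mathbb X,\mathcal B(\mathbb X))$ is the set of sequences $(v_t)_{t\in\mathbb N}$ in it with $\sup_t\|v_t\|_\infty<\infty$; $O\equiv0$ on $\mathbb X$. For closed $F\subseteq\mathbb R$, $\mathcal P(F)$ is the set of Borel probability measures on $F$ with the weak topology; $\mathcal P_b(\mathbb R)$, $\mathcal P_b(\mathbb R^2)$ are the Borel probability measures with bounded support. $\gamma$ is a fixed discount factor. Probability setting. $(\Omega,\mathscr H,\mathbb P)$ is a complete atomless probability space with filtrations $(\mathscr F_t)_{t\in\mathbb N}$, $(\mathscr G_t)_{t\in\mathbb N}$, $\mathscr F_t\subseteq\mathscr G_t\subseteq\mathscr H$, $\mathscr F_1$ containing all $\mathbb P$-null sets; $\mathscr F_0=\mathscr G_0=\{\emptyset,\Omega\}$ and $\mathscr U_t:=\mathscr G_{t-1}\vee\mathscr F_t$. $L^\infty(\Omega,\mathscr H,\mathbb P)$ carries the essential supremum norm. For bounded real $Y$, $P^{Y|\mathscr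 U}$ denotes a regular conditional distribution of $Y$ given $\mathscr U$, in a version supported in $[-\|Y\|_\infty,\|Y\|_\infty]$ for every $\omega$; $\mathcal L(Y)$ is the law of $Y$. Risk measures. A law-invariant convex risk measure (at the level of distributions) is a map $\sigma:\mathcal P_b(\mathbb R)\to(-\infty,\infty]$, not identically $+\infty$, with: (1) $\sigma(\mu*\delta_c)=\sigma(\mu)+c$ for $c\in\mathbb R$; (2) $\mu((-\infty,r])\ge\mu'((-\infty,r])$ for all $r$ implies $\sigma(\mu)\le\sigma(\mu')$; (3) for $\zeta\in\mathcal P_b(\mathbb R^2)$ with first and second marginals $\zeta_0,\zeta_1$, and $\theta\in[0,1]$, if $\zeta_\theta$ is the image of $\zeta$ under $(r_0,r_1)\mapsto(1-\theta)r_0+\theta r_1$, then $\sigma(\zeta_\theta)\le(1-\theta)\sigma(\zeta_0)+\theta\sigma(\zeta_1)$. Fix such $\sigma_0$ and $(\sigma_{t,x})_{(t,x)\in\mathbb N\times\mathbb X}$; it is assumed that for every $t$ and compact $K\subset\mathbb R$, $(x,\mu)\mapsto\sigma_{t,x}(\mu)$ is Borel measurable on $\mathbb X\times\mathcal P(K)$, and that $|\sigma_{t,x}(\delta_0)|\le b_t$ for all $x$, for some $b_t\ge0$. Dynamic risk measure. For an $\mathbb X$-valued $(\mathscr F_t)$-adapted process $\mathfrak X=(X_t)_{t\in\mathbb N}$ and $\mathfrak Z=(Z_t)_{t\in\mathbb N_0}\subset L^\infty(\Omega,\mathscr H,\mathbb P)$ with $\sup_t\|Z_t\|_\infty<\infty$: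 $\varsigma^{\mathfrak X}_{T,x,T}(\mathfrak Z):=\sigma_{T,x}(P^{Z_T|\mathscr U_T})$; for $0<t<T$, $\varsigma^{\mathfrak X}_{t,x,T}(\mathfrak Z):=\sigma_{t,x}(P^{W_t^T|\mathscr U_t})$ with $W_t^T:=Z_t+\gamma\,\varsigma^{\mathfrak X}_{t+1,X_{t+1},T}(\mathfrak Z)$; $\varsigma^{\mathfrak X}_{0,T}(\mathfrak Z):=\sigma_0(\mathcal L(Z_0+\gamma\,\varsigma^{\mathfrak X}_{1,X_1,T}(\mathfrak Z)))$; and $\varsigma^{\mathfrak X}_{0,\infty}(\mathfrak Z):=\lim_{T\to\infty}\varsigma^{\mathfrak X}_{0,T}(\mathfrak Z)$ (the limit exists when $\gamma<1$ and $(\sigma_{t,x})$ is normalized). Actions and policies. For $t\in\mathbb N$, $\mathcal A_t:\mathbb X\to2^{\mathbb A}$ is nonempty closed-valued and weakly measurable ($\{x:\mathcal A_t(x)\cap U\ne\emptyset\}\in\mathcal B(\mathbb X)$ for open $U$). $\varpi_t(x):=\{\lambda\in\Lambda:\lambda(\mathcal A_t(x))=1\}$; $\Pi_t$ is the set of measurable $\pi_t:\mathbb X\to\Lambda$ with $\pi_t(x)\in\varpi_t(x)$ for all $x$; $\Pi$ is the set of Markovian policies $\mathfrak p=(\pi_t)_{t\in\mathbb N}$, $\pi_t\in\Pi_t$. Controlled processes. $P$ is a transition kernel: $P(t,x,a,\cdot)$ is a Borel probability on $\mathbb X$, and $(x,a)\mapsto P(t,x,a,B)$ is measurable for $B\in\mathcal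 B(\mathbb X)$. $\xi_1$ is a Borel probability on $\mathbb X$. $\Psi$ is a set of pairs $(\mathfrak X,\mathfrak A)$, $\mathfrak X=(X_t)_{t\in\mathbb N}$ $\mathbb X$-valued and $(\mathscr F_t)$-adapted, $\mathfrak A=(A_t)_{t\in\mathbb N}$ $\mathbb A$-valued and $(\mathscr G_t)$-adapted, such that $X_1\sim\xi_1$, $\mathbb P(X_{t+1}\in B|\mathscr G_t)=P(t,X_t,A_t,B)$ a.s., and $\mathbb P(A_t\in\mathcal A_t(X_t),\ t\in\mathbb N)=1$. It is assumed that for each $\mathfrak p=(\pi_t)\in\Pi$ there is a pair in $\Psi$, written $(\mathfrak X^{\mathfrak p},\mathfrak A^{\mathfrak p})$, with $\mathbb P(A_t\in B|\mathscr U_t)=\mathbb P(A_t\in B|\sigma(X_t))=[\pi_t(X_t)](B)$ a.s. for all $t$, $B\in\mathcal B(\mathbb A)$. Costs. $C_t:\mathbb X\times\mathbb A\times\mathbb X\to\mathbb R$ is Borel measurable for $t\in\mathbb N$, $C_0\equiv0$; $\mathfrak C:=(C_t(X_t,A_t,X_{t+1}))_{t\in\mathbb N_0}$ (zero entry at $t=0$), and $\mathfrak C^{\mathfrak p}$ is the same for $(\mathfrak X^{\mathfrak p},\mathfrak A^{\mathfrak p})$. Operators and value functions. For $v\in\ell^\infty(\mathbb X,\mathcal B(\mathbb X))$, $\lambda\in\Lambda$: $\widetilde P^v_{t,x,\lambda}(B):=\int_{\mathbb A}\int_{\mathbb X}1_B(C_t(x,a,y)+\gamma v(y))\,P(t,x,a,dy)\,\lambda(da)$,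 $B\in\mathcal B(\mathbb R)$; $G^\lambda_tv(x):=\sigma_{t,x}(\widetilde P^v_{t,x,\lambda})$; $H^{\mathfrak p}_tv(x):=G^{\pi_t(x)}_tv(x)$; $S_tv(x):=\inf_{\lambda\in\varpi_t(x)}G^\lambda_tv(x)$; $H_0v:=\sigma_0(\text{law of }\gamma v(Y))$ with $Y\sim\xi_1$. For $t,T\in\mathbb N$: $J^{\mathfrak p}_{t,T}:=O$ if $t>T$, $J^{\mathfrak p}_{t,T}:=H^{\mathfrak p}_tJ^{\mathfrak p}_{t+1,T}$ if $t\le T$; $J^*_{t,T}:=O$ if $t>T$, $J^*_{t,T}:=S_tJ^*_{t+1,T}$ if $t\le T$ (bounded, Borel under (i)–(iv)); $J^{\mathfrak p}_{0,T}:=H_0J^{\mathfrak p}_{1,T}$. Under the hypotheses the following limits exist (pointwise): $J^{\mathfrak p}_{0,\infty}:=\lim_TJ^{\mathfrak p}_{0,T}$, $J^{\mathfrak p}_{t,\infty}:=\lim_TJ^{\mathfrak p}_{t,T}$, $J^*_{t,\infty}:=\lim_TJ^*_{t,T}$, $t\in\mathbb N$. *)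

theory Defs
  imports "HOL-Probability.Probability"
begin

section \<open>Spaces of probability measures\<close>

text \<open>
  The set of Borel probability measures on a space is \<open>space (prob_algebra borel)\<close>, and
  \<open>prob_algebra borel\<close> is the sigma-algebra on it generated by the evaluations
  \<open>\<mu> \<mapsto> \<mu> B\<close> with \<open>B\<close> Borel. Measures on a closed set \<open>K\<close> are identified with the measures on
  the whole space that give \<open>K\<close> full mass.
\<close>

definition prob_on :: "'b::topological_space set \<Rightarrow> 'b measure set" where
  "prob_on K = {\<mu> \<in> space (prob_algebra borel). measure \<mu> K = 1}"

definition bounded_laws :: "'b::metric_space measure set" where
  "bounded_laws =
     {\<mu> \<in> space (prob_algebra borel). \<exists>B\<in>sets borel. bounded B \<and> measure \<mu> B = 1}"

definition weak_topology :: "'b::topological_space measure topology" where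
  "weak_topology = topology_generated_by
     {{\<mu> \<in> space (prob_algebra borel). (\<integral>z. f z \<partial>\<mu>) \<in> U} | (f :: 'b \<Rightarrow> real) U.
        continuous_on UNIV f \<and> bounded (range f) \<and> open U}"

definition borel_of :: "'b topology \<Rightarrow> 'b measure" where
  "borel_of T = sigma (topspace T) {U. openin T U}"

definition lower_semicontinuous :: "('b::topological_space \<Rightarrow> real) \<Rightarrow> bool" where
  "lower_semicontinuous f \<longleftrightarrow> (\<forall>x. \<forall>c<f x. \<forall>\<^sub>F z in at x. c < f z)"

section \<open>Law-invariant convex risk measures\<close>

text \<open>A risk measure takes values in \<open>(-\<infinity>, \<infinity>]\<close>; only its values on \<open>bounded_laws\<close> are meaningful.\<close>

definition convex_risk_measure :: "(real measure \<Rightarrow> ereal) \<Rightarrow> bool" where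
  "convex_risk_measure \<sigma> \<longleftrightarrow>
     (\<forall>\<mu>\<in>bounded_laws. \<sigma> \<mu> \<noteq> -\<infinity>) \<and>
     (\<exists>\<mu>\<in>bounded_laws. \<sigma> \<mu> \<noteq> \<infinity>) \<and>
     (\<forall>\<mu>\<in>bounded_laws. \<forall>c. \<sigma> (\<mu> \<star> return borel c) = \<sigma> \<mu> + ereal c) \<and>
     (\<forall>\<mu>\<in>bounded_laws. \<forall>\<mu>'\<in>bounded_laws.
        (\<forall>r. measure \<mu> {..r} \<ge> measure \<mu>' {..r}) \<longrightarrow> \<sigma> \<mu> \<le> \<sigma> \<mu>') \<and>
     (\<forall>\<zeta>\<in>(bounded_laws :: (real \<times> real) measure set). \<forall>\<theta>\<in>{0..1}.
        \<sigma> (distr \<zeta> borel (\<lambda>(r0, r1). (1 - \<theta>) * r0 + \<theta> * r1))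
          \<le> ereal (1 - \<theta>) * \<sigma> (distr \<zeta> borel fst) + ereal \<theta> * \<sigma> (distr \<zeta> borel snd))"

section \<open>Dynamic risk measure\<close>

definition atomless :: "'w measure \<Rightarrow> bool" where
  "atomless M \<longleftrightarrow>
     (\<forall>A\<in>sets M. measure M A > 0 \<longrightarrow> (\<exists>B\<in>sets M. B \<subseteq> A \<and> 0 < measure M B \<and> measure M B < measure M A))"

definition U_alg :: "'w measure \<Rightarrow> (nat \<Rightarrow> 'w measure) \<Rightarrow> (nat \<Rightarrow> 'w measure) \<Rightarrow> nat \<Rightarrow> 'w measure" where
  "U_alg M F G t = sigma (space M) (sets (G (t - 1)) \<union> sets (F t))"

definition ess_norm :: "'w measure \<Rightarrow> ('w \<Rightarrow> real) \<Rightarrow> real" where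
  "ess_norm M Y = real_of_ereal (esssup M (\<lambda>\<omega>. ereal \<bar>Y \<omega>\<bar>))"

definition is_cond_distr ::
  "'w measure \<Rightarrow> 'w measure \<Rightarrow> ('w \<Rightarrow> real) \<Rightarrow> ('w \<Rightarrow> real measure) \<Rightarrow> bool" where
  "is_cond_distr M N Y \<kappa> \<longleftrightarrow>
     \<kappa> \<in> N \<rightarrow>\<^sub>M prob_algebra borel \<and>
     (\<forall>B\<in>sets borel. AE \<omega> in M. real_cond_exp M N (indicator (Y -` B)) \<omega> = measure (\<kappa> \<omega>) B) \<and>
     (\<forall>\<omega>\<in>space M. measure (\<kappa> \<omega>) {- ess_norm M Y .. ess_norm M Y} = 1)"

text \<open>
  A choice of version. Two versions agree almost surely, so the choice affects the conditional
  risks below only on a null set that is independent of the state \<open>x\<close>.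
\<close>

definition cond_distr ::
  "'w measure \<Rightarrow> 'w measure \<Rightarrow> ('w \<Rightarrow> real) \<Rightarrow> 'w \<Rightarrow> real measure" where
  "cond_distr M N Y = (SOME \<kappa>. is_cond_distr M N Y \<kappa>)"

text \<open>
  \<open>dyn_risk M F G \<gamma> \<sigma> X Z T t x\<close> is the random variable \<open>\<omega> \<mapsto> \<sigma>\<^bsub>t,x\<^esub>(P\<^bsup>W\<^esup>(\<omega>))\<close>, for \<open>0 < t \<le> T\<close>.
  The risks of bounded costs are finite (a convex risk measure is finite on all of
  \<open>bounded_laws\<close>), so that \<open>real_of_ereal\<close> loses nothing, here and in the operators further below.
\<close>

function dyn_risk ::
  "'w measure \<Rightarrow> (nat \<Rightarrow> 'w measure) \<Rightarrow> (nat \<Rightarrow> 'w measure) \<Rightarrow> real \<Rightarrow>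
   (nat \<Rightarrow> 'x \<Rightarrow> real measure \<Rightarrow> ereal) \<Rightarrow> (nat \<Rightarrow> 'w \<Rightarrow> 'x) \<Rightarrow> (nat \<Rightarrow> 'w \<Rightarrow> real) \<Rightarrow>
   nat \<Rightarrow> nat \<Rightarrow> 'x \<Rightarrow> 'w \<Rightarrow> ereal" where
  "dyn_risk M F G \<gamma> \<sigma> X Z T t x \<omega> =
     (if t < T
      then \<sigma> t x (cond_distr M (U_alg M F G t)
             (\<lambda>\<omega>'. Z t \<omega>' + \<gamma> * real_of_ereal
                     (dyn_risk M F G \<gamma> \<sigma> X Z T (Suc t) (X (Suc t) \<omega>') \<omega>')) \<omega>)
      else \<sigma> T x (cond_distr M (U_alg M F G T) (Z T) \<omega>))"
  by pat_completeness auto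
termination
  by (relation "Wellfounded.measure (\<lambda>(M, F, G, \<gamma>, \<sigma>, X, Z, T, t, x, \<omega>). T - t)") auto

definition dyn_risk0 ::
  "'w measure \<Rightarrow> (nat \<Rightarrow> 'w measure) \<Rightarrow> (nat \<Rightarrow> 'w measure) \<Rightarrow> real \<Rightarrow> (real measure \<Rightarrow> ereal) \<Rightarrow>
   (nat \<Rightarrow> 'x \<Rightarrow> real measure \<Rightarrow> ereal) \<Rightarrow> (nat \<Rightarrow> 'w \<Rightarrow> 'x) \<Rightarrow> (nat \<Rightarrow> 'w \<Rightarrow> real) \<Rightarrow>
   nat \<Rightarrow> ereal" where
  "dyn_risk0 M F G \<gamma> \<sigma>0 \<sigma> X Z T =
     \<sigma>0 (distr M borel
           (\<lambda>\<omega>. Z 0 \<omega> + \<gamma> * real_of_ereal (dyn_risk M F G \<gamma> \<sigma> X Z T 1 (X 1 \<omega>) \<omega>)))"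

definition dyn_risk0_inf ::
  "'w measure \<Rightarrow> (nat \<Rightarrow> 'w measure) \<Rightarrow> (nat \<Rightarrow> 'w measure) \<Rightarrow> real \<Rightarrow> (real measure \<Rightarrow> ereal) \<Rightarrow>
   (nat \<Rightarrow> 'x \<Rightarrow> real measure \<Rightarrow> ereal) \<Rightarrow> (nat \<Rightarrow> 'w \<Rightarrow> 'x) \<Rightarrow> (nat \<Rightarrow> 'w \<Rightarrow> real) \<Rightarrow> ereal" where
  "dyn_risk0_inf M F G \<gamma> \<sigma>0 \<sigma> X Z = lim (\<lambda>T. dyn_risk0 M F G \<gamma> \<sigma>0 \<sigma> X Z T)"

section \<open>Actions, policies and controlled processes\<close>

definition adm_laws ::
  "(nat \<Rightarrow> 'x \<Rightarrow> 'a::polish_space set) \<Rightarrow> nat \<Rightarrow> 'x \<Rightarrow> 'a measure set" where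
  "adm_laws \<A> t x = prob_on (\<A> t x)"

text \<open>
  Families indexed by times \<open>t = 1, 2, \<dots>\<close> are functions on \<open>nat\<close> whose value at \<open>0\<close> is irrelevant.
\<close>

definition policies ::
  "(nat \<Rightarrow> 'x::polish_space \<Rightarrow> 'a::polish_space set) \<Rightarrow> (nat \<Rightarrow> 'x \<Rightarrow> 'a measure) set" where
  "policies \<A> =
     {p. \<forall>t\<ge>1. p t \<in> borel \<rightarrow>\<^sub>M prob_algebra borel \<and> (\<forall>x. p t x \<in> adm_laws \<A> t x)}"

definition controlled_pair ::
  "'w measure \<Rightarrow> (nat \<Rightarrow> 'w measure) \<Rightarrow> (nat \<Rightarrow> 'w measure) \<Rightarrow>
   (nat \<Rightarrow> 'x::polish_space \<Rightarrow> 'a::polish_space set) \<Rightarrow>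
   (nat \<Rightarrow> 'x \<Rightarrow> 'a \<Rightarrow> 'x measure) \<Rightarrow> 'x measure \<Rightarrow>
   (nat \<Rightarrow> 'w \<Rightarrow> 'x) \<Rightarrow> (nat \<Rightarrow> 'w \<Rightarrow> 'a) \<Rightarrow> bool" where
  "controlled_pair M F G \<A> P \<xi> X A \<longleftrightarrow>
     (\<forall>t\<ge>1. X t \<in> F t \<rightarrow>\<^sub>M borel) \<and>
     (\<forall>t\<ge>1. A t \<in> G t \<rightarrow>\<^sub>M borel) \<and>
     distr M borel (X 1) = \<xi> \<and>
     (\<forall>t\<ge>1. \<forall>B\<in>sets borel. AE \<omega> in M.
        real_cond_exp M (G t) (indicator (X (Suc t) -` B)) \<omega> = measure (P t (X t \<omega>) (A t \<omega>)) B) \<and>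
     (AE \<omega> in M. \<forall>t\<ge>1. A t \<omega> \<in> \<A> t (X t \<omega>))"

definition follows_policy ::
  "'w measure \<Rightarrow> (nat \<Rightarrow> 'w measure) \<Rightarrow> (nat \<Rightarrow> 'w measure) \<Rightarrow>
   (nat \<Rightarrow> 'x::polish_space \<Rightarrow> 'a::polish_space measure) \<Rightarrow>
   (nat \<Rightarrow> 'w \<Rightarrow> 'x) \<Rightarrow> (nat \<Rightarrow> 'w \<Rightarrow> 'a) \<Rightarrow> bool" where
  "follows_policy M F G p X A \<longleftrightarrow>
     (\<forall>t\<ge>1. \<forall>B\<in>sets borel.
        (AE \<omega> in M. real_cond_exp M (U_alg M F G t) (indicator (A t -` B)) \<omega>
                    = measure (p t (X t \<omega>)) B) \<and>
        (AE \<omega> in M. real_cond_exp M (vimage_algebra (space M) (X t) borel) (indicator (A t -` B)) \<omega>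
                    = measure (p t (X t \<omega>)) B))"

definition cost_process ::
  "(nat \<Rightarrow> 'x \<Rightarrow> 'a \<Rightarrow> 'x \<Rightarrow> real) \<Rightarrow> (nat \<Rightarrow> 'w \<Rightarrow> 'x) \<Rightarrow> (nat \<Rightarrow> 'w \<Rightarrow> 'a) \<Rightarrow> nat \<Rightarrow> 'w \<Rightarrow> real" where
  "cost_process C X A t \<omega> = (if t = 0 then 0 else C t (X t \<omega>) (A t \<omega>) (X (Suc t) \<omega>))"

section \<open>Operators and value functions\<close>

definition seq_linf :: "(nat \<Rightarrow> 'x::topological_space \<Rightarrow> real) set" where
  "seq_linf =
     {v. (\<forall>t\<ge>1. v t \<in> borel_measurable borel) \<and> (\<exists>c. \<forall>t\<ge>1. \<forall>x. \<bar>v t x\<bar> \<le> c)}"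

text \<open>
  The mixture \<open>B \<mapsto> \<integral>\<integral> 1\<^sub>B (C t x a y + \<gamma> v y) P(t,x,a,dy) \<nu>(da)\<close>.
\<close>

definition cost_law ::
  "real \<Rightarrow> (nat \<Rightarrow> 'x \<Rightarrow> 'a \<Rightarrow> 'x measure) \<Rightarrow> (nat \<Rightarrow> 'x \<Rightarrow> 'a \<Rightarrow> 'x \<Rightarrow> real) \<Rightarrow>
   ('x \<Rightarrow> real) \<Rightarrow> nat \<Rightarrow> 'x \<Rightarrow> 'a measure \<Rightarrow> real measure" where
  "cost_law \<gamma> P C v t x \<nu> =
     Giry_Monad.bind \<nu> (\<lambda>a. distr (P t x a) borel (\<lambda>y. C t x a y + \<gamma> * v y))"

definition G_op ::
  "real \<Rightarrow> (nat \<Rightarrow> 'x \<Rightarrow> real measure \<Rightarrow> ereal) \<Rightarrow> (nat \<Rightarrow> 'x \<Rightarrow> 'a \<Rightarrow> 'x measure) \<Rightarrow>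
   (nat \<Rightarrow> 'x \<Rightarrow> 'a \<Rightarrow> 'x \<Rightarrow> real) \<Rightarrow> nat \<Rightarrow> 'a measure \<Rightarrow> ('x \<Rightarrow> real) \<Rightarrow> 'x \<Rightarrow> ereal" where
  "G_op \<gamma> \<sigma> P C t \<nu> v x = \<sigma> t x (cost_law \<gamma> P C v t x \<nu>)"

definition H_op ::
  "real \<Rightarrow> (nat \<Rightarrow> 'x \<Rightarrow> real measure \<Rightarrow> ereal) \<Rightarrow> (nat \<Rightarrow> 'x \<Rightarrow> 'a \<Rightarrow> 'x measure) \<Rightarrow>
   (nat \<Rightarrow> 'x \<Rightarrow> 'a \<Rightarrow> 'x \<Rightarrow> real) \<Rightarrow> (nat \<Rightarrow> 'x \<Rightarrow> 'a measure) \<Rightarrow>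
   nat \<Rightarrow> ('x \<Rightarrow> real) \<Rightarrow> 'x \<Rightarrow> real" where
  "H_op \<gamma> \<sigma> P C p t v x = real_of_ereal (G_op \<gamma> \<sigma> P C t (p t x) v x)"

definition S_op ::
  "real \<Rightarrow> (nat \<Rightarrow> 'x \<Rightarrow> real measure \<Rightarrow> ereal) \<Rightarrow> (nat \<Rightarrow> 'x \<Rightarrow> 'a::polish_space set) \<Rightarrow>
   (nat \<Rightarrow> 'x \<Rightarrow> 'a \<Rightarrow> 'x measure) \<Rightarrow> (nat \<Rightarrow> 'x \<Rightarrow> 'a \<Rightarrow> 'x \<Rightarrow> real) \<Rightarrow>
   nat \<Rightarrow> ('x \<Rightarrow> real) \<Rightarrow> 'x \<Rightarrow> real" where
  "S_op \<gamma> \<sigma> \<A> P C t v x = real_of_ereal (INF \<nu>\<in>adm_laws \<A> t x. G_op \<gamma> \<sigma> P C t \<nu> v x)"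

definition H0_op ::
  "real \<Rightarrow> (real measure \<Rightarrow> ereal) \<Rightarrow> 'x measure \<Rightarrow> ('x \<Rightarrow> real) \<Rightarrow> ereal" where
  "H0_op \<gamma> \<sigma>0 \<xi> v = \<sigma>0 (distr \<xi> borel (\<lambda>y. \<gamma> * v y))"

definition argmin_set ::
  "real \<Rightarrow> (nat \<Rightarrow> 'x \<Rightarrow> real measure \<Rightarrow> ereal) \<Rightarrow> (nat \<Rightarrow> 'x \<Rightarrow> 'a::polish_space set) \<Rightarrow>
   (nat \<Rightarrow> 'x \<Rightarrow> 'a \<Rightarrow> 'x measure) \<Rightarrow> (nat \<Rightarrow> 'x \<Rightarrow> 'a \<Rightarrow> 'x \<Rightarrow> real) \<Rightarrow>
   nat \<Rightarrow> ('x \<Rightarrow> real) \<Rightarrow> 'x \<Rightarrow> 'a measure set" where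
  "argmin_set \<gamma> \<sigma> \<A> P C t v x =
     {\<nu>. is_arg_min (\<lambda>\<nu>. G_op \<gamma> \<sigma> P C t \<nu> v x) (\<lambda>\<nu>. \<nu> \<in> adm_laws \<A> t x) \<nu>}"

function J_pol ::
  "real \<Rightarrow> (nat \<Rightarrow> 'x \<Rightarrow> real measure \<Rightarrow> ereal) \<Rightarrow> (nat \<Rightarrow> 'x \<Rightarrow> 'a \<Rightarrow> 'x measure) \<Rightarrow>
   (nat \<Rightarrow> 'x \<Rightarrow> 'a \<Rightarrow> 'x \<Rightarrow> real) \<Rightarrow> (nat \<Rightarrow> 'x \<Rightarrow> 'a measure) \<Rightarrow>
   nat \<Rightarrow> nat \<Rightarrow> 'x \<Rightarrow> real" where
  "J_pol \<gamma> \<sigma> P C p t T =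
     (if t > T then (\<lambda>_. 0) else H_op \<gamma> \<sigma> P C p t (J_pol \<gamma> \<sigma> P C p (Suc t) T))"
  by pat_completeness auto
termination
  by (relation "Wellfounded.measure (\<lambda>(\<gamma>, \<sigma>, P, C, p, t, T). Suc T - t)") auto

function J_opt ::
  "real \<Rightarrow> (nat \<Rightarrow> 'x \<Rightarrow> real measure \<Rightarrow> ereal) \<Rightarrow> (nat \<Rightarrow> 'x \<Rightarrow> 'a::polish_space set) \<Rightarrow>
   (nat \<Rightarrow> 'x \<Rightarrow> 'a \<Rightarrow> 'x measure) \<Rightarrow> (nat \<Rightarrow> 'x \<Rightarrow> 'a \<Rightarrow> 'x \<Rightarrow> real) \<Rightarrow>
   nat \<Rightarrow> nat \<Rightarrow> 'x \<Rightarrow> real" where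
  "J_opt \<gamma> \<sigma> \<A> P C t T =
     (if t > T then (\<lambda>_. 0) else S_op \<gamma> \<sigma> \<A> P C t (J_opt \<gamma> \<sigma> \<A> P C (Suc t) T))"
  by pat_completeness auto
termination
  by (relation "Wellfounded.measure (\<lambda>(\<gamma>, \<sigma>, \<A>, P, C, t, T). Suc T - t)") auto

declare dyn_risk.simps [simp del] J_pol.simps [simp del] J_opt.simps [simp del]

definition J_pol0 ::
  "real \<Rightarrow> (real measure \<Rightarrow> ereal) \<Rightarrow> (nat \<Rightarrow> 'x \<Rightarrow> real measure \<Rightarrow> ereal) \<Rightarrow>
   (nat \<Rightarrow> 'x \<Rightarrow> 'a \<Rightarrow> 'x measure) \<Rightarrow> 'x measure \<Rightarrow> (nat \<Rightarrow> 'x \<Rightarrow> 'a \<Rightarrow> 'x \<Rightarrow> real) \<Rightarrow>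
   (nat \<Rightarrow> 'x \<Rightarrow> 'a measure) \<Rightarrow> nat \<Rightarrow> ereal" where
  "J_pol0 \<gamma> \<sigma>0 \<sigma> P \<xi> C p T = H0_op \<gamma> \<sigma>0 \<xi> (J_pol \<gamma> \<sigma> P C p 1 T)"

definition J_pol_inf ::
  "real \<Rightarrow> (nat \<Rightarrow> 'x \<Rightarrow> real measure \<Rightarrow> ereal) \<Rightarrow> (nat \<Rightarrow> 'x \<Rightarrow> 'a \<Rightarrow> 'x measure) \<Rightarrow>
   (nat \<Rightarrow> 'x \<Rightarrow> 'a \<Rightarrow> 'x \<Rightarrow> real) \<Rightarrow> (nat \<Rightarrow> 'x \<Rightarrow> 'a measure) \<Rightarrow> nat \<Rightarrow> 'x \<Rightarrow> real" where
  "J_pol_inf \<gamma> \<sigma> P C p t x = lim (\<lambda>T. J_pol \<gamma> \<sigma> P C p t T x)"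

definition J_pol0_inf ::
  "real \<Rightarrow> (real measure \<Rightarrow> ereal) \<Rightarrow> (nat \<Rightarrow> 'x \<Rightarrow> real measure \<Rightarrow> ereal) \<Rightarrow>
   (nat \<Rightarrow> 'x \<Rightarrow> 'a \<Rightarrow> 'x measure) \<Rightarrow> 'x measure \<Rightarrow> (nat \<Rightarrow> 'x \<Rightarrow> 'a \<Rightarrow> 'x \<Rightarrow> real) \<Rightarrow>
   (nat \<Rightarrow> 'x \<Rightarrow> 'a measure) \<Rightarrow> ereal" where
  "J_pol0_inf \<gamma> \<sigma>0 \<sigma> P \<xi> C p = lim (\<lambda>T. J_pol0 \<gamma> \<sigma>0 \<sigma> P \<xi> C p T)"

definition J_opt_inf ::
  "real \<Rightarrow> (nat \<Rightarrow> 'x \<Rightarrow> real measure \<Rightarrow> ereal) \<Rightarrow> (nat \<Rightarrow> 'x \<Rightarrow> 'a::polish_space set) \<Rightarrow>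
   (nat \<Rightarrow> 'x \<Rightarrow> 'a \<Rightarrow> 'x measure) \<Rightarrow> (nat \<Rightarrow> 'x \<Rightarrow> 'a \<Rightarrow> 'x \<Rightarrow> real) \<Rightarrow> nat \<Rightarrow> 'x \<Rightarrow> real" where
  "J_opt_inf \<gamma> \<sigma> \<A> P C t x = lim (\<lambda>T. J_opt \<gamma> \<sigma> \<A> P C t T x)"

section \<open>Standing assumptions\<close>

text \<open>
  \<open>Xp p\<close> and \<open>Ap p\<close> are the state and action processes of the pair in \<open>\<Psi>\<close> chosen for the policy \<open>p\<close>.
\<close>

locale risk_averse_mdp =
  fixes M :: "'w measure"
    and F G :: "nat \<Rightarrow> 'w measure"
    and \<sigma>0 :: "real measure \<Rightarrow> ereal"
    and \<sigma> :: "nat \<Rightarrow> 'x::polish_space \<Rightarrow> real measure \<Rightarrow> ereal"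
    and \<A> :: "nat \<Rightarrow> 'x \<Rightarrow> 'a::polish_space set"
    and P :: "nat \<Rightarrow> 'x \<Rightarrow> 'a \<Rightarrow> 'x measure"
    and \<xi> :: "'x measure"
    and C :: "nat \<Rightarrow> 'x \<Rightarrow> 'a \<Rightarrow> 'x \<Rightarrow> real"
    and \<Psi> :: "((nat \<Rightarrow> 'w \<Rightarrow> 'x) \<times> (nat \<Rightarrow> 'w \<Rightarrow> 'a)) set"
    and Xp :: "(nat \<Rightarrow> 'x \<Rightarrow> 'a measure) \<Rightarrow> nat \<Rightarrow> 'w \<Rightarrow> 'x"
    and Ap :: "(nat \<Rightarrow> 'x \<Rightarrow> 'a measure) \<Rightarrow> nat \<Rightarrow> 'w \<Rightarrow> 'a"
  assumes prob_space_M: "prob_space M"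
    and complete_M: "complete_measure M"
    and atomless_M: "atomless M"
    and filtration_F: "filtration (space M) F"
    and filtration_G: "filtration (space M) G"
    and F_0: "sets (F 0) = {{}, space M}"
    and G_0: "sets (G 0) = {{}, space M}"
    and F_le_G: "\<And>t. sets (F t) \<subseteq> sets (G t)"
    and G_le_M: "\<And>t. sets (G t) \<subseteq> sets M"
    and null_sets_F: "null_sets M \<subseteq> sets (F 1)"
    and risk_\<sigma>0: "convex_risk_measure \<sigma>0"
    and risk_\<sigma>: "\<And>t x. t \<ge> 1 \<Longrightarrow> convex_risk_measure (\<sigma> t x)"
    and measurable_\<sigma>: "\<And>t K. t \<ge> 1 \<Longrightarrow> compact K \<Longrightarrow>
          (\<lambda>(x, \<mu>). \<sigma> t x \<mu>) \<in> borel_measurable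
            (borel_of (prod_topology euclidean (subtopology weak_topology (prob_on K))))"
    and bounded_\<sigma>: "\<And>t. t \<ge> 1 \<Longrightarrow> \<exists>b\<ge>0. \<forall>x. \<bar>\<sigma> t x (return borel 0)\<bar> \<le> ereal b"
    and \<A>_nonempty: "\<And>t x. t \<ge> 1 \<Longrightarrow> \<A> t x \<noteq> {}"
    and \<A>_closed: "\<And>t x. t \<ge> 1 \<Longrightarrow> closed (\<A> t x)"
    and \<A>_measurable: "\<And>t U. t \<ge> 1 \<Longrightarrow> open U \<Longrightarrow> {x. \<A> t x \<inter> U \<noteq> {}} \<in> sets borel"
    and P_kernel: "\<And>t. t \<ge> 1 \<Longrightarrow> (\<lambda>(x, a). P t x a) \<in> borel \<rightarrow>\<^sub>M prob_algebra borel"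
    and \<xi>_prob: "\<xi> \<in> space (prob_algebra borel)"
    and C_measurable: "\<And>t. t \<ge> 1 \<Longrightarrow> (\<lambda>(x, a, y). C t x a y) \<in> borel_measurable borel"
    and \<Psi>_controlled: "\<And>X A. (X, A) \<in> \<Psi> \<Longrightarrow> controlled_pair M F G \<A> P \<xi> X A"
    and policy_pair: "\<And>p. p \<in> policies \<A> \<Longrightarrow>
          (Xp p, Ap p) \<in> \<Psi> \<and> follows_policy M F G p (Xp p) (Ap p)"

end

theory Submission
  imports Defs
begin

text \<open>
  Everything rests on two properties of the one-stage risk \<open>G\<^sup>\<nu> v (x)\<close>. First, a risk measure
  that is monotone and translation equivariant is nonexpansive for couplings (\<open>risk_coupling\<close>): if
  \<open>f \<le> g + c\<close> almost surely, then the risk of \<open>f\<close> exceeds that of \<open>g\<close> by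
  at most \<open>c\<close>. Hence raising \<open>v\<close> by \<open>e\<close> raises \<open>G\<^sup>\<nu> v\<close>
  by at most \<open>\<gamma> e\<close>, and the same is true of \<open>H\<^sup>p\<close> and of the infimum
  \<open>S\<close>. With \<open>\<gamma> < 1\<close> the finite-horizon values converge uniformly, their limits
  solve the fixed point equations, and bounded measurable solutions are unique; a one-sided form of uniqueness
  (\<open>discounted_comparison\<close>) yields \<open>J\<^sup>* \<le> J\<^sup>p\<close> for every policy and
  equality for a policy of minimisers. Second, on the laws on a compact set, \<open>(x, \<nu>) \<mapsto>
  G\<^sup>\<nu> v (x)\<close> is lower semicontinuous when \<open>v\<close> is bounded and lower semicontinuous
  (\<open>Gop_lsc\<close>). The one-stage cost is the increasing limit of Lipschitz functions; for these the cost
  laws depend continuously on \<open>(x, \<nu>)\<close>, so that lower semicontinuity of \<open>\<sigma>\<close>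
  applies, and monotonicity of \<open>\<sigma>\<close> passes the bound to the limit. The infimum over the compact,
  upper hemicontinuous sets of admissible laws is then attained and again lower semicontinuous, and this class is
  stable under uniform limits, so that it contains the infinite-horizon values.

  Measurable minimisers come from an embedding. Integrating countably many continuous test functions sends a law
  \<open>\<mu>\<close> to a point \<open>moments \<mu>\<close> of \<open>nat \<Rightarrow> real\<close>. This map is
  injective, continuous for the weak topology, measurable with a measurable inverse, and it sends the laws on a
  compact set to a compact set. Minimisation over laws becomes minimisation over compact sections of a closed subset
  of a Polish space, where the lexicographically smallest minimiser is a measurable selection
  (\<open>lexicographic_selection\<close>). The compactness is Prokhorov's theorem on a compact set: such a set is
  coded by a compact set of reals, to which Helly's selection theorem applies (\<open>prob_on_seq_compact\<close>).

  Finally, the dynamic risk of a Markovian policy is its value function along the state process. Disintegrating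
  first over the next state, given \<open>G\<^sub>t\<close>, and then over the action, given
  \<open>U\<^sub>t\<close>, the conditional law of \<open>C\<^sub>t + \<gamma> v(X\<^sub>t\<^sub>+\<^sub>1)\<close>
  given \<open>U\<^sub>t\<close> is the cost law at \<open>X\<^sub>t\<close> under
  \<open>\<pi>\<^sub>t(X\<^sub>t)\<close> (\<open>conditional_cost_law\<close>), and backward induction on time
  identifies the two recursions almost surely (\<open>dyn_risk_eq_J_pol\<close>).
\<close>

section \<open>Countably many integrals that determine a law\<close>

lemma countable_Int_stable_basis:
  "\<exists>U :: nat \<Rightarrow> 'b::second_countable_topology set. Int_stable (range U) \<and> topological_basis (range U)"
proof -
  obtain B :: "'b set set" where B: "countable B" "topological_basis B"
    using ex_countable_basis by auto
  define D where "D = Inter ` {F. finite F \<and> F \<subseteq> B}"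
  have cD: "countable D"
    unfolding D_def using countable_Collect_finite_subset[OF B(1)] by blast
  have "{} \<in> {F. finite F \<and> F \<subseteq> B}" by simp
  then have ne: "D \<noteq> {}" unfolding D_def by blast
  have BD: "B \<subseteq> D"
  proof
    fix b assume "b \<in> B"
    then have "{b} \<in> {F. finite F \<and> F \<subseteq> B}" by simp
    then have "\<Inter>{b} \<in> D" unfolding D_def by (rule imageI)
    then show "b \<in> D" by simp
  qed
  have op: "open b" if "b \<in> D" for b
    using that topological_basis_open[OF B(2)] unfolding D_def by (auto intro!: open_Inter)
  have "Int_stable D"
  proof (rule Int_stableI)
    fix a b assume "a \<in> D" "b \<in> D"
    then obtain F G where "finite F" "F \<subseteq> B" "a = \<Inter>F" "finite G" "G \<subseteq> B" "b = \<Inter>G"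
      unfolding D_def by auto
    then have "a \<inter> b = \<Inter>(F \<union> G)" "F \<union> G \<in> {F. finite F \<and> F \<subseteq> B}" by auto
    then show "a \<inter> b \<in> D" unfolding D_def by (metis imageI)
  qed
  moreover have "topological_basis D"
    using B(2) BD op unfolding topological_basis_def by (metis subset_trans)
  moreover have "range (from_nat_into D) = D" using ne cD by (rule range_from_nat_into)
  ultimately show ?thesis by metis
qed

text \<open>
  Stability under intersections makes the basis a generator on which equality of measures can be tested.
\<close>

definition basis_set :: "nat \<Rightarrow> 'b::second_countable_topology set" where
  "basis_set = (SOME U. Int_stable (range U) \<and> topological_basis (range U))"

lemma basis_set: "Int_stable (range basis_set)" "topological_basis (range basis_set)"
  using someI_ex[OF countable_Int_stable_basis] unfolding basis_set_def by blast+

lemma open_basis_set [simp]: "open (basis_set i)"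
  using basis_set(2) topological_basis_open by blast

lemma basis_set_measurable [measurable]: "basis_set i \<in> sets borel"
  by (rule borel_open) simp

lemma borel_sigma_basis_set: "sets borel = sigma_sets UNIV (range basis_set)"
  by (subst borel_eq_countable_basis[OF _ basis_set(2)]) auto

text \<open>
  For fixed \<open>i\<close> and growing \<open>n\<close> these Urysohn functions increase to the indicator of
  \<open>basis_set i\<close>. The whole space is treated apart because \<open>infdist x {}\<close> is
  \<open>0\<close>.
\<close>

definition test_fun :: "nat \<Rightarrow> 'b::polish_space \<Rightarrow> real" where
  "test_fun j x = (case prod_decode j of (i, n) \<Rightarrow>
     if basis_set i = (UNIV :: 'b set) then 1 else min 1 (real n * infdist x (- basis_set i)))"

lemma test_fun_continuous: "continuous_on UNIV (test_fun j :: 'b::polish_space \<Rightarrow> real)"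
proof -
  obtain i n where in_def: "prod_decode j = (i, n)" by (cases "prod_decode j")
  show ?thesis
  proof (cases "basis_set i = (UNIV :: 'b set)")
    case True
    then show ?thesis by (simp add: test_fun_def in_def)
  next
    case False
    then show ?thesis by (simp add: test_fun_def in_def continuous_intros)
  qed
qed

lemma test_fun_measurable [measurable]: "test_fun j \<in> borel_measurable borel"
  by (rule borel_measurable_continuous_onI[OF test_fun_continuous])

lemma test_fun_bounds: "0 \<le> test_fun j x" "test_fun j x \<le> 1"
  unfolding test_fun_def by (cases "prod_decode j", auto simp: infdist_nonneg)+

lemma test_fun_tendsto_indicator:
  fixes x :: "'b::polish_space"
  shows "(\<lambda>n. test_fun (prod_encode (i, n)) x) \<longlonglongrightarrow> indicator (basis_set i) x"
proof (cases "basis_set i = (UNIV :: 'b set) \<or> x \<notin> basis_set i")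
  case True
  then show ?thesis by (cases "basis_set i = (UNIV :: 'b set)") (auto simp: test_fun_def indicator_def)
next
  case False
  then have pos: "infdist x (- basis_set i) > 0"
    by (intro infdist_pos_not_in_closed) auto
  have "eventually (\<lambda>n. real n \<ge> 1 / infdist x (- basis_set i)) sequentially"
    by (rule eventually_nat_real) (auto intro: eventually_ge_at_top)
  then have "eventually (\<lambda>n. test_fun (prod_encode (i, n)) x = 1) sequentially"
    using False pos by (auto simp: test_fun_def field_simps elim!: eventually_mono)
  then show ?thesis using False by (auto intro: tendsto_eventually)
qed

definition moments :: "'b::polish_space measure \<Rightarrow> nat \<Rightarrow> real" where
  "moments \<mu> j = (\<integral>x. test_fun j x \<partial>\<mu>)"

abbreviation laws :: "'b::topological_space measure set" where
  "laws \<equiv> space (prob_algebra borel)"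

lemma space_prob_borelD:
  assumes "\<mu> \<in> laws"
  shows "prob_space \<mu>" "sets \<mu> = sets borel" "space \<mu> = UNIV"
  using assms sets_eq_imp_space_eq[of \<mu> borel] by (auto simp: space_prob_algebra)

lemma integrable_bounded_prob:
  fixes f :: "'b::topological_space \<Rightarrow> real"
  assumes "\<mu> \<in> laws" "f \<in> borel_measurable borel" "\<And>x. \<bar>f x\<bar> \<le> c"
  shows "integrable \<mu> f"
proof -
  interpret prob_space \<mu> using space_prob_borelD(1)[OF assms(1)] .
  show ?thesis using assms(2,3) space_prob_borelD(2)[OF assms(1)]
    by (intro integrable_const_bound[of _ c]) (auto cong: measurable_cong_sets)
qed

text \<open>
  The replacement for dominated convergence when the measures move together with the integrands.
\<close>

lemma integral_tendsto_uniformly_close: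
  fixes f :: "nat \<Rightarrow> 'b::topological_space \<Rightarrow> real"
  assumes \<mu>s: "\<And>n. \<mu>s n \<in> laws" and f: "\<And>n. integrable (\<mu>s n) (f n)" and g: "\<And>n. integrable (\<mu>s n) g"
    and close: "\<And>e. e > 0 \<Longrightarrow> eventually (\<lambda>n. AE z in \<mu>s n. \<bar>f n z - g z\<bar> \<le> e) sequentially"
    and lim: "(\<lambda>n. \<integral>z. g z \<partial>\<mu>s n) \<longlonglongrightarrow> L"
  shows "(\<lambda>n. \<integral>z. f n z \<partial>\<mu>s n) \<longlonglongrightarrow> L"
proof -
  have "(\<lambda>n. (\<integral>z. f n z \<partial>\<mu>s n) - (\<integral>z. g z \<partial>\<mu>s n)) \<longlonglongrightarrow> 0"
  proof (rule tendstoI)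
    fix e :: real assume e: "0 < e"
    then have "e / 2 > 0" by simp
    from close[OF this]
    show "eventually (\<lambda>n. dist ((\<integral>z. f n z \<partial>\<mu>s n) - (\<integral>z. g z \<partial>\<mu>s n)) 0 < e) sequentially"
    proof eventually_elim
      case (elim n)
      interpret prob_space "\<mu>s n" using space_prob_borelD(1)[OF \<mu>s] .
      have "\<bar>(\<integral>z. f n z \<partial>\<mu>s n) - (\<integral>z. g z \<partial>\<mu>s n)\<bar> = \<bar>\<integral>z. f n z - g z \<partial>\<mu>s n\<bar>"
        by (simp add: Bochner_Integration.integral_diff[OF f g])
      also have "\<dots> \<le> (\<integral>z. \<bar>f n z - g z\<bar> \<partial>\<mu>s n)" by (rule integral_abs_bound)
      also have "\<dots> \<le> (\<integral>z. e/2 \<partial>\<mu>s n)" by (rule integral_mono_AE) (use f g elim in auto)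
      also have "\<dots> < e" using e by (simp add: prob_space)
      finally show ?case by (simp add: dist_real_def)
    qed
  qed
  from tendsto_add[OF this lim] show ?thesis by simp
qed

lemma moments_tendsto_measure:
  assumes "\<mu> \<in> laws"
  shows "(\<lambda>n. moments \<mu> (prod_encode (i, n))) \<longlonglongrightarrow> measure \<mu> (basis_set i)"
proof -
  interpret prob_space \<mu> using space_prob_borelD(1)[OF assms] .
  note [measurable_cong] = space_prob_borelD(2)[OF assms]
  have "(\<lambda>n. \<integral>x. test_fun (prod_encode (i, n)) x \<partial>\<mu>) \<longlonglongrightarrow> (\<integral>x. indicator (basis_set i) x \<partial>\<mu>)"
    by (rule integral_dominated_convergence[where w="\<lambda>_. 1"])
       (auto simp: test_fun_tendsto_indicator test_fun_bounds)
  then show ?thesis unfolding moments_def by (simp add: space_prob_borelD[OF assms])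
qed

lemma prob_eq_on_basis:
  fixes \<mu> \<nu> :: "'b::polish_space measure"
  assumes \<mu>: "\<mu> \<in> laws" and \<nu>: "\<nu> \<in> laws"
    and eq: "\<And>i. measure \<mu> (basis_set i) = measure \<nu> (basis_set i)"
  shows "\<mu> = \<nu>"
proof (rule measure_eqI_generator_eq_countable[where E="range basis_set" and A="range basis_set" and \<Omega>=UNIV])
  interpret \<mu>: prob_space \<mu> using space_prob_borelD(1)[OF \<mu>] .
  interpret \<nu>: prob_space \<nu> using space_prob_borelD(1)[OF \<nu>] .
  show "emeasure \<mu> X = emeasure \<nu> X" if X: "X \<in> range basis_set" for X
  proof -
    obtain i where i: "X = basis_set i" using X by blast
    then show ?thesis using eq[of i] by (simp add: \<mu>.emeasure_eq_measure \<nu>.emeasure_eq_measure)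
  qed
  show "\<Union> (range basis_set) = (UNIV :: 'b set)"
  proof (intro equalityI subsetI UNIV_I)
    fix x :: "'b"
    obtain B where "B \<in> range basis_set" "x \<in> B"
      by (rule topological_basisE[OF basis_set(2) open_UNIV UNIV_I])
    then show "x \<in> \<Union> (range basis_set)" by (rule UnionI)
  qed
  show "Int_stable (range basis_set :: 'b set set)" by (rule basis_set)
  show "sets \<mu> = sigma_sets UNIV (range basis_set)" "sets \<nu> = sigma_sets UNIV (range basis_set)"
    using \<mu> \<nu> by (simp_all add: space_prob_algebra borel_sigma_basis_set)
  show "emeasure \<mu> a \<noteq> \<infinity>" for a by simp
qed auto

lemma moments_inject:
  fixes \<mu> \<nu> :: "'b::polish_space measure"
  assumes "\<mu> \<in> laws" "\<nu> \<in> laws" "moments \<mu> = moments \<nu>"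
  shows "\<mu> = \<nu>"
proof (rule prob_eq_on_basis[OF assms(1,2)])
  fix i
  show "measure \<mu> (basis_set i) = measure \<nu> (basis_set i)"
    by (rule LIMSEQ_unique[OF moments_tendsto_measure[OF assms(1)]])
       (unfold assms(3), rule moments_tendsto_measure[OF assms(2)])
qed

definition law_of_moments :: "(nat \<Rightarrow> real) \<Rightarrow> 'b::polish_space measure" where
  "law_of_moments m = (SOME \<mu>. \<mu> \<in> laws \<and> moments \<mu> = m)"

lemma law_of_moments [simp]:
  assumes "\<mu> \<in> laws"
  shows "law_of_moments (moments \<mu>) = \<mu>"
proof -
  have "law_of_moments (moments \<mu>) \<in> space (prob_algebra (borel :: 'a measure)) \<and>
      moments (law_of_moments (moments \<mu>) :: 'a measure) = moments \<mu>"
    unfolding law_of_moments_def by (rule someI[of _ \<mu>]) (use assms in simp)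
  then show ?thesis using moments_inject assms by blast
qed

lemma measurable_moments [measurable]:
  "(moments :: 'b::polish_space measure \<Rightarrow> _) \<in> borel_measurable (prob_algebra borel)"
proof (rule measurable_coordinatewise_then_product)
  fix j
  have "(\<lambda>\<mu>. \<integral>x. test_fun j x \<partial>\<mu>) \<in> borel_measurable (subprob_algebra (borel :: 'b measure))"
    by measurable
  then show "(\<lambda>\<mu>::'b measure. moments \<mu> j) \<in> borel_measurable (prob_algebra borel)"
    unfolding moments_def prob_algebra_def by (rule measurable_restrict_space1)
qed

text \<open>
  The inverse of \<open>moments\<close> is measurable: the mass of a basis set is the limit of the integrals of its
  test functions, and the basis sets generate the Borel sets.
\<close>

lemma measurable_prob_algebra_moments:
  fixes \<pi> :: "'c \<Rightarrow> 'b::polish_space measure"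
  assumes "\<And>x. x \<in> space N \<Longrightarrow> \<pi> x \<in> laws"
    and [measurable]: "(\<lambda>x. moments (\<pi> x)) \<in> borel_measurable N"
  shows "\<pi> \<in> N \<rightarrow>\<^sub>M prob_algebra borel"
proof (rule measurable_prob_algebra_generated[OF borel_sigma_basis_set basis_set(1)])
  fix A :: "'b set" assume "A \<in> range basis_set"
  then obtain i where A: "A = basis_set i" by auto
  have [measurable]: "(\<lambda>x. moments (\<pi> x) j) \<in> borel_measurable N" for j
    by (rule measurable_compose[OF assms(2)]) simp
  have "(\<lambda>x. measure (\<pi> x) A) \<in> borel_measurable N"
    by (rule borel_measurable_LIMSEQ_real[where u="\<lambda>n x. moments (\<pi> x) (prod_encode (i, n))"])
       (auto simp: A intro: moments_tendsto_measure assms(1))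
  then have "(\<lambda>x. ennreal (measure (\<pi> x) A)) \<in> borel_measurable N" by simp
  then show "(\<lambda>x. emeasure (\<pi> x) A) \<in> borel_measurable N"
    by (rule measurable_cong[THEN iffD1, rotated])
       (metis assms(1) space_prob_borelD(1) prob_space.finite_measure finite_measure.emeasure_eq_measure)
qed (use assms(1) in \<open>auto dest: space_prob_borelD\<close>)

lemma topspace_weak [simp]: "topspace weak_topology = space (prob_algebra (borel :: 'b::topological_space measure))"
proof -
  have "topspace (weak_topology :: 'b measure topology) =
     \<Union>{{\<mu> \<in> laws. (\<integral>z. f z \<partial>\<mu>) \<in> U} | (f :: 'b \<Rightarrow> real) U.
        continuous_on UNIV f \<and> bounded (range f) \<and> open U}"
    unfolding weak_topology_def by (rule topology_generated_by_topspace)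
  also have "\<dots> = laws"
  proof (intro equalityI subsetI)
    fix \<mu> :: "'b measure" assume "\<mu> \<in> laws"
    then have "\<mu> \<in> {\<mu> \<in> laws. (\<integral>z. (0::real) \<partial>\<mu>) \<in> UNIV}" by simp
    then show "\<mu> \<in> \<Union>{{\<mu> \<in> laws. (\<integral>z. f z \<partial>\<mu>) \<in> U} | (f :: 'b \<Rightarrow> real) U.
        continuous_on UNIV f \<and> bounded (range f) \<and> open U}"
      by (intro UnionI[rotated]) (auto intro!: exI[of _ "\<lambda>_. 0"] exI[of _ UNIV])
  qed auto
  finally show ?thesis .
qed

lemma continuous_map_weak_integral:
  fixes f :: "'b::topological_space \<Rightarrow> real"
  assumes "continuous_on UNIV f" "bounded (range f)"
  shows "continuous_map weak_topology euclideanreal (\<lambda>\<mu>. \<integral>z. f z \<partial>\<mu>)"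
  unfolding continuous_map
proof (intro conjI allI impI)
  fix U :: "real set" assume "openin euclideanreal U"
  then have "openin weak_topology {\<mu> \<in> laws. (\<integral>z. f z \<partial>\<mu>) \<in> U}"
    using assms unfolding weak_topology_def openin_topology_generated_by_iff
    by (intro generate_topology_on.Basis) auto
  then show "openin weak_topology {x \<in> topspace weak_topology. (\<integral>z. f z \<partial>x) \<in> U}" by simp
qed auto

text \<open>
  The weak topology is generated by the integrals, so convergence needs checking only on the generating sets; the
  induction is over the construction of an open set from these.
\<close>

lemma limitin_weak_topologyI:
  fixes \<mu> :: "'b::topological_space measure"
  assumes mu: "\<mu> \<in> laws" and mus: "\<And>n. \<mu>s n \<in> laws"
    and conv: "\<And>f::'b \<Rightarrow> real. continuous_on UNIV f \<Longrightarrow> bounded (range f) \<Longrightarrow>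
        ((\<lambda>n. \<integral>z. f z \<partial>(\<mu>s n)) \<longlongrightarrow> (\<integral>z. f z \<partial>\<mu>)) F"
  shows "limitin weak_topology \<mu>s \<mu> F"
  unfolding limitin_def
proof (intro conjI allI impI)
  fix U :: "'b measure set" assume "openin weak_topology U \<and> \<mu> \<in> U"
  then have "generate_topology_on {{\<mu> \<in> laws. (\<integral>z. f z \<partial>\<mu>) \<in> U} | (f :: 'b \<Rightarrow> real) U.
        continuous_on UNIV f \<and> bounded (range f) \<and> open U} U" "\<mu> \<in> U"
    unfolding weak_topology_def openin_topology_generated_by_iff by auto
  then show "eventually (\<lambda>n. \<mu>s n \<in> U) F"
  proof (induction rule: generate_topology_on.induct)
    case (Int a b)
    then show ?case by (auto elim: eventually_elim2)
  next
    case (UN K)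
    then obtain k where "k \<in> K" "\<mu> \<in> k" by auto
    then have "eventually (\<lambda>n. \<mu>s n \<in> k) F" using UN by auto
    then show ?case using \<open>k \<in> K\<close> by (auto elim: eventually_mono)
  next
    case (Basis s)
    then obtain f :: "'b \<Rightarrow> real" and V where *: "s = {\<mu> \<in> laws. (\<integral>z. f z \<partial>\<mu>) \<in> V}"
      "continuous_on UNIV f" "bounded (range f)" "open V" by auto
    have "eventually (\<lambda>n. (\<integral>z. f z \<partial>(\<mu>s n)) \<in> V) F"
      using topological_tendstoD[OF conv[OF *(2,3)] *(4)] Basis * by auto
    then show ?case using mus * by auto
  qed simp
qed (use mu in simp)

lemma limitin_weak_topologyD:
  fixes f :: "'b::topological_space \<Rightarrow> real"
  assumes "limitin weak_topology \<mu>s \<mu> F" "continuous_on UNIV f" "bounded (range f)"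
  shows "((\<lambda>n. \<integral>z. f z \<partial>(\<mu>s n)) \<longlongrightarrow> (\<integral>z. f z \<partial>\<mu>)) F"
  using continuous_map_limit[OF continuous_map_weak_integral[OF assms(2,3)] assms(1)]
  by (simp add: comp_def)

lemma continuous_map_moments:
  "continuous_map weak_topology euclidean (moments :: 'b::polish_space measure \<Rightarrow> _)"
proof -
  have "bounded (range (test_fun j :: 'b \<Rightarrow> real))" for j
    unfolding bounded_iff
    by (intro exI[of _ 1]) (auto simp: abs_le_iff intro: test_fun_bounds order_trans[OF _ test_fun_bounds(1)])
  then have "continuous_map weak_topology (euclidean :: real topology) (\<lambda>\<mu>::'b measure. moments \<mu> j)" for j
    unfolding moments_def by (intro continuous_map_weak_integral test_fun_continuous)
  then show ?thesis
    by (simp flip: euclidean_product_topology add: continuous_map_componentwise_UNIV)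
qed

lemma limitin_weak_imp_moments:
  assumes "limitin weak_topology \<mu>s \<mu> F"
  shows "((\<lambda>n. moments (\<mu>s n)) \<longlongrightarrow> moments \<mu>) F"
  using continuous_map_limit[OF continuous_map_moments assms] by (simp add: comp_def)

section \<open>Weak compactness of the laws on a compact set\<close>

text \<open>
  The inner selection \<open>s\<close> need not be increasing, which spares its users a proof of monotonicity.
\<close>

lemma LIMSEQ_subsubseqI:
  fixes X :: "nat \<Rightarrow> 'b::topological_space"
  assumes "\<And>r :: nat \<Rightarrow> nat. strict_mono r \<Longrightarrow> \<exists>s :: nat \<Rightarrow> nat. (\<lambda>n. X (r (s n))) \<longlonglongrightarrow> L"
  shows "X \<longlonglongrightarrow> L"
proof (rule topological_tendstoI, rule ccontr)
  fix S assume S: "open S" "L \<in> S" "\<not> eventually (\<lambda>n. X n \<in> S) sequentially"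
  from not_eventually_sequentiallyD[OF S(3)] obtain r :: "nat \<Rightarrow> nat" where
    r: "strict_mono r" "\<And>n. X (r n) \<notin> S" by auto
  from assms[OF r(1)] obtain s where "(\<lambda>n. X (r (s n))) \<longlonglongrightarrow> L" by blast
  then have "eventually (\<lambda>n. X (r (s n)) \<in> S) sequentially"
    using S by (auto dest: topological_tendstoD)
  then show False using r(2) by simp
qed

text \<open>
  A point is coded by the base-3 expansion with digits \<open>0\<close> and \<open>2\<close> that records to which
  basis sets it belongs. The missing digit \<open>1\<close> keeps expansions with different digits apart, which
  makes the decoding uniformly continuous on a compact set although the coding itself is only measurable.
\<close>

definition ternary_code :: "'b::second_countable_topology \<Rightarrow> real" where
  "ternary_code x = (\<Sum>j. 2/3 * (1/3)^j * indicator (basis_set j) x)"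

lemma geometric_third: "(\<lambda>j. 2/3 * (1/3::real)^j) sums 1"
  using sums_mult[OF geometric_sums[of "1/3::real"], of "2/3"] by simp

lemma ternary_summable: "summable (\<lambda>j. 2/3 * (1/3::real)^j * indicator (basis_set j) x)"
  by (rule summable_comparison_test'[OF sums_summable[OF geometric_third], of 0])
     (auto simp: indicator_def)

lemma ternary_code_measurable [measurable]: "ternary_code \<in> borel_measurable borel"
  unfolding ternary_code_def by measurable

lemma ternary_code_bounds: "0 \<le> ternary_code x" "ternary_code x \<le> 1"
proof -
  show "0 \<le> ternary_code x" unfolding ternary_code_def
    by (intro suminf_nonneg ternary_summable) (auto simp: indicator_def)
  have "ternary_code x \<le> (\<Sum>j. 2/3 * (1/3::real)^j)" unfolding ternary_code_def
    by (intro suminf_le ternary_summable sums_summable[OF geometric_third]) (auto simp: indicator_def)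
  then show "ternary_code x \<le> 1" using sums_unique[OF geometric_third] by simp
qed

text \<open>
  At the first differing digit \<open>j\<close> the codes differ by \<open>2/3\<^sup>j\<^sup>+\<^sup>1\<close>, and
  the remaining digits compensate at most \<open>1/3\<^sup>j\<^sup>+\<^sup>1\<close> of it.
\<close>

lemma ternary_code_close:
  fixes x y :: "'b::second_countable_topology"
  assumes close: "\<bar>ternary_code x - ternary_code y\<bar> < (1/3)^m" and "j < m"
  shows "x \<in> basis_set j \<longleftrightarrow> y \<in> basis_set j"
  using \<open>j < m\<close>
proof (induction j rule: less_induct)
  case (less j)
  define d :: "nat \<Rightarrow> real" where "d i = 2/3 * (1/3)^i * indicator (basis_set i) x
     - 2/3 * (1/3)^i * indicator (basis_set i) y" for i
  have sd: "summable d" unfolding d_def by (intro summable_diff ternary_summable)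
  have "ternary_code x - ternary_code y = (\<Sum>i. d i)"
    unfolding ternary_code_def d_def by (rule suminf_diff[OF ternary_summable ternary_summable])
  also have "\<dots> = (\<Sum>i. d (i + Suc j)) + (\<Sum>i<Suc j. d i)"
    by (rule suminf_split_initial_segment[OF sd])
  also have "(\<Sum>i<j. d i) = 0"
    using less by (intro sum.neutral) (auto simp: d_def indicator_def)
  then have "(\<Sum>i<Suc j. d i) = d j" by simp
  finally have eq: "ternary_code x - ternary_code y = (\<Sum>i. d (i + Suc j)) + d j" .
  have db: "norm (d i) \<le> 2/3 * (1/3)^i" for i by (auto simp: d_def indicator_def)
  have "(\<lambda>i. (1/3)^Suc j * (2/3 * (1/3::real)^i)) sums ((1/3)^Suc j * 1)"
    by (rule sums_mult[OF geometric_third])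
  then have tail: "(\<lambda>i. 2/3 * (1/3::real)^(i + Suc j)) sums ((1/3)^Suc j)"
    by (simp add: power_add mult_ac)
  have "norm (\<Sum>i. d (i + Suc j)) \<le> (\<Sum>i. 2/3 * (1/3::real)^(i + Suc j))"
    using db[of "_ + Suc j"] by (intro norm_suminf_le sums_summable[OF tail]) auto
  then have tb: "\<bar>\<Sum>i. d (i + Suc j)\<bar> \<le> (1/3)^Suc j"
    using sums_unique[OF tail] by simp
  have "(1/3::real)^m \<le> (1/3)^Suc j" using less(2) by (intro power_decreasing) auto
  then have "\<bar>d j\<bar> < 2 * (1/3)^Suc j" using close tb unfolding eq by linarith
  then have "d j \<noteq> 2/3 * (1/3)^j \<and> d j \<noteq> - (2/3 * (1/3)^j)" by auto
  then show ?case by (auto simp: d_def indicator_def split: if_splits)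
qed

text \<open>
  Every compact set is the continuous image of a compact set of reals. Finitely many basis sets of diameter below
  \<open>\<epsilon>\<close> cover \<open>K\<close>; points with sufficiently close codes lie in a common one. So
  decoding is uniformly continuous and extends to the closure of the set of codes.
\<close>

lemma compact_ternary_code_inverse:
  fixes K :: "'b::polish_space set"
  assumes K: "compact K"
  obtains f where "continuous_on (closure (ternary_code ` K)) f" "f ` closure (ternary_code ` K) \<subseteq> K"
    "\<And>k. k \<in> K \<Longrightarrow> f (ternary_code k) = k"
proof -
  have close: "\<exists>\<delta>>0. \<forall>x\<in>K. \<forall>y\<in>K. \<bar>ternary_code x - ternary_code y\<bar> < \<delta> \<longrightarrow> dist x y < \<epsilon>" if "\<epsilon> > 0" for \<epsilon>
  proof -
    let ?I = "{i. \<forall>x\<in>basis_set i. \<forall>y\<in>basis_set i. dist x y < \<epsilon> \<and> (x::'b) = x}"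
    have "K \<subseteq> (\<Union>i\<in>?I. basis_set i)"
    proof
      fix x assume "x \<in> K"
      obtain B where B: "B \<in> range basis_set" "x \<in> B" "B \<subseteq> ball x (\<epsilon>/2)"
        by (rule topological_basisE[OF basis_set(2) open_ball, of x x "\<epsilon>/2"]) (use \<open>\<epsilon> > 0\<close> in auto)
      from B(1) obtain i where i: "B = basis_set i" by (rule rangeE)
      have "dist y z < \<epsilon>" if "y \<in> B" "z \<in> B" for y z
        using that B(3) dist_triangle_half_r[of x y \<epsilon> z] by (auto simp: subset_iff)
      then have "i \<in> ?I" using i by auto
      then show "x \<in> (\<Union>i\<in>?I. basis_set i)" using B(2) i by auto
    qed
    then obtain J where J: "J \<subseteq> ?I" "finite J" "K \<subseteq> (\<Union>i\<in>J. basis_set i)"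
      by (rule compactE_image[OF K, of ?I basis_set, rotated]) simp_all
    obtain m where m: "\<forall>i\<in>J. i < m" using J(2) finite_nat_set_iff_bounded by auto
    show ?thesis
    proof (intro exI[of _ "(1/3)^m"] conjI ballI impI)
      fix x y assume xy: "x \<in> K" "y \<in> K" "\<bar>ternary_code x - ternary_code y\<bar> < (1/3)^m"
      then obtain i where i: "i \<in> J" "x \<in> basis_set i" using J(3) by auto
      then have "y \<in> basis_set i" using ternary_code_close[OF xy(3), of i] m by auto
      then show "dist x y < \<epsilon>" using i J(1) by blast
    qed simp
  qed
  have inj: "inj_on ternary_code K"
  proof (rule inj_onI)
    fix x y assume xy: "x \<in> K" "y \<in> K" "ternary_code x = ternary_code y"
    have "dist x y < \<epsilon>" if "\<epsilon> > 0" for \<epsilon>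
      using close[OF that] xy by auto
    then show "x = y" using zero_less_dist_iff by blast
  qed
  have "uniformly_continuous_on (ternary_code ` K) (inv_into K ternary_code)"
    unfolding uniformly_continuous_on_def
  proof (intro allI impI)
    fix e :: real assume "0 < e"
    from close[OF this] obtain d where d: "d > 0"
      "\<And>x y. x \<in> K \<Longrightarrow> y \<in> K \<Longrightarrow> \<bar>ternary_code x - ternary_code y\<bar> < d \<Longrightarrow> dist x y < e" by blast
    then show "\<exists>d>0. \<forall>x\<in>ternary_code ` K. \<forall>x'\<in>ternary_code ` K. dist x' x < d \<longrightarrow>
        dist (inv_into K ternary_code x') (inv_into K ternary_code x) < e"
      by (intro exI[of _ d]) (auto simp: inv_into_f_f[OF inj] dist_real_def)
  qed
  from uniformly_continuous_on_extension_on_closure[OF this] obtain f where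
    f: "uniformly_continuous_on (closure (ternary_code ` K)) f"
       "\<And>x. x \<in> ternary_code ` K \<Longrightarrow> inv_into K ternary_code x = f x" by metis
  have fK: "f (ternary_code k) = k" if "k \<in> K" for k
    using f(2)[of "ternary_code k"] that inv_into_f_f[OF inj that] by auto
  have cf: "continuous_on (closure (ternary_code ` K)) f"
    using f(1) by (rule uniformly_continuous_imp_continuous)
  moreover have "f ` closure (ternary_code ` K) \<subseteq> K"
    by (rule image_closure_subset[OF cf compact_imp_closed[OF K]]) (auto simp: fK)
  ultimately show ?thesis using fK by (rule that)
qed

lemma prob_onD:
  assumes "\<mu> \<in> prob_on K"
  shows "\<mu> \<in> laws" "measure \<mu> K = 1"
  using assms by (auto simp: prob_on_def)

lemma prob_on_iff_AE:
  assumes "\<mu> \<in> laws" "K \<in> sets borel"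
  shows "\<mu> \<in> prob_on K \<longleftrightarrow> (AE x in \<mu>. x \<in> K)"
proof -
  interpret prob_space \<mu> using space_prob_borelD(1)[OF assms(1)] .
  show ?thesis using assms prob_eq_1[of K]
    by (simp add: prob_on_def space_prob_borelD[OF assms(1)])
qed

text \<open>
  Mass on a closed set becomes the vanishing of the integral of one bounded continuous function, a condition that
  can be followed through weak limits.
\<close>

lemma prob_on_closed_iff_infdist:
  fixes K :: "'b::polish_space set"
  assumes mu: "\<mu> \<in> laws" and K: "closed K" "K \<noteq> {}"
  shows "\<mu> \<in> prob_on K \<longleftrightarrow> (\<integral>x. min 1 (infdist x K) \<partial>\<mu>) = 0"
proof -
  have [measurable]: "(\<lambda>x. min 1 (infdist x K)) \<in> borel_measurable borel"
    by (intro borel_measurable_continuous_onI continuous_intros)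
  have int: "integrable \<mu> (\<lambda>x. min 1 (infdist x K))"
    by (rule integrable_bounded_prob[OF mu, of _ 1]) (auto simp: infdist_nonneg)
  have "(\<integral>x. min 1 (infdist x K) \<partial>\<mu>) = 0 \<longleftrightarrow> (AE x in \<mu>. min 1 (infdist x K) = 0)"
    by (rule integral_nonneg_eq_0_iff_AE[OF int]) (simp add: infdist_nonneg)
  also have "\<dots> \<longleftrightarrow> (AE x in \<mu>. x \<in> K)"
    by (intro AE_cong) (auto simp: in_closed_iff_infdist_zero[OF K] min_def infdist_nonneg)
  finally show ?thesis using prob_on_iff_AE[OF mu] K by auto
qed

text \<open>
  Code the laws as laws on the reals, extract a weak limit by Helly's theorem, check that it lives on the closed set
  \<open>D\<close> of codes, and decode it. Weak convergence survives decoding because a continuous function of a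
  decoded point is continuous on \<open>D\<close> and extends to the line by Tietze's theorem.
\<close>

lemma prob_on_seq_compact:
  fixes K :: "'b::polish_space set" and \<mu>s :: "nat \<Rightarrow> 'b measure"
  assumes K: "compact K" and mus: "\<And>n. \<mu>s n \<in> prob_on K"
  obtains \<mu> r where "\<mu> \<in> prob_on K" "strict_mono r" "limitin weak_topology (\<mu>s \<circ> r) \<mu> sequentially"
proof -
  have mus': "\<mu>s n \<in> laws" for n using mus prob_onD by blast
  note sets_mus [measurable_cong] = space_prob_borelD(2)[OF mus']
  interpret mus: prob_space "\<mu>s n" for n using space_prob_borelD(1)[OF mus'] .
  have Kb: "K \<in> sets borel" using K by (simp add: compact_imp_closed)
  obtain k0 where k0: "k0 \<in> K" using prob_onD(2)[OF mus, of 0] by fastforce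
  define D where "D = closure (ternary_code ` K)"
  have D: "closed D" "D \<noteq> {}" using k0 by (auto simp: D_def)
  have cD: "ternary_code k \<in> D" if "k \<in> K" for k
    using that closure_subset[of "ternary_code ` K"] by (auto simp: D_def)
  from compact_ternary_code_inverse[OF K] obtain f where
    f: "continuous_on D f" "f ` D \<subseteq> K" "\<And>k. k \<in> K \<Longrightarrow> f (ternary_code k) = k"
    unfolding D_def by blast
  define ms where "ms n = distr (\<mu>s n) borel ternary_code" for n
  have ms_meas: "ternary_code \<in> \<mu>s n \<rightarrow>\<^sub>M borel" for n by measurable
  have dist_ms: "real_distribution (ms n)" for n
    unfolding ms_def by (intro mus.real_distribution_distr) measurable
  have "tight ms" unfolding tight_def
  proof (intro conjI allI impI)
    fix e :: real assume "e > 0"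
    have "measure (ms n) {-1<..1} = 1" for n
    proof -
      have "measure (ms n) {-1<..1} = measure (\<mu>s n) (ternary_code -` {-1<..1} \<inter> space (\<mu>s n))"
        unfolding ms_def by (rule measure_distr) simp_all
      also have "ternary_code -` {-1<..1} \<inter> space (\<mu>s n) = space (\<mu>s n)"
        using ternary_code_bounds(2) order.strict_trans2[OF _ ternary_code_bounds(1), of "-1"] by auto
      finally show ?thesis by (simp add: mus.prob_space)
    qed
    then show "\<exists>a b. a < b \<and> (\<forall>n. 1 - e < measure (ms n) {a<..b})"
      using \<open>e > 0\<close> by (intro exI[of _ "-1"] exI[of _ 1]) auto
  qed (rule dist_ms)
  from tight_imp_convergent_subsubsequence[OF this strict_mono_id] obtain r m where
    r: "strict_mono r" and m: "real_distribution m" and conv: "weak_conv_m (ms \<circ> id \<circ> r) m" by blast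
  interpret m: real_distribution m by fact
  have m': "m \<in> laws"
    using m.prob_space_axioms by (simp add: space_prob_algebra)
  have conv': "(\<lambda>n. \<integral>z. h z \<partial>(ms (r n))) \<longlonglongrightarrow> (\<integral>z. h z \<partial>m)"
    if "continuous_on UNIV h" "\<And>z. \<bar>h z\<bar> \<le> c" for h :: "real \<Rightarrow> real" and c
    using weak_conv_imp_integral_bdd_continuous_conv[OF _ m conv, of h c] that dist_ms
    by (auto simp: comp_def continuous_on_eq_continuous_at)
  have int_ms: "(\<integral>z. h z \<partial>(ms n)) = (\<integral>x. h (ternary_code x) \<partial>(\<mu>s n))"
    if "h \<in> borel_measurable borel" for h :: "real \<Rightarrow> real" and n
    unfolding ms_def by (rule integral_distr[OF ms_meas that])
  have AE_K: "AE x in \<mu>s n. x \<in> K" for n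
    using mus prob_on_iff_AE[OF mus' Kb] by blast
  have "(\<integral>z. min 1 (infdist z D) \<partial>m) = 0"
  proof (rule LIMSEQ_unique)
    show "(\<lambda>n. \<integral>z. min 1 (infdist z D) \<partial>(ms (r n))) \<longlonglongrightarrow> (\<integral>z. min 1 (infdist z D) \<partial>m)"
      by (rule conv'[of _ 1]) (auto intro!: continuous_intros simp: infdist_nonneg)
    have "(\<integral>z. min 1 (infdist z D) \<partial>(ms n)) = 0" for n
    proof -
      have "(\<integral>z. min 1 (infdist z D) \<partial>(ms n)) = (\<integral>x. min 1 (infdist (ternary_code x) D) \<partial>(\<mu>s n))"
        by (intro int_ms borel_measurable_continuous_onI continuous_intros)
      also have "\<dots> = (\<integral>x. 0 \<partial>(\<mu>s n))"
      proof (rule integral_cong_AE)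
        have [measurable]: "(\<lambda>z. min 1 (infdist z D)) \<in> borel_measurable borel"
          by (intro borel_measurable_continuous_onI continuous_intros)
        show "(\<lambda>x. min 1 (infdist (ternary_code x) D)) \<in> borel_measurable (\<mu>s n)"
          by (rule measurable_compose[OF ms_meas]) measurable
        show "AE x in \<mu>s n. min 1 (infdist (ternary_code x) D) = 0"
          using AE_K by eventually_elim (simp add: cD)
      qed simp
      finally show ?thesis by simp
    qed
    then show "(\<lambda>n. \<integral>z. min 1 (infdist z D) \<partial>(ms (r n))) \<longlonglongrightarrow> 0" by simp
  qed
  then have mD: "AE z in m. z \<in> D"
    using prob_on_closed_iff_infdist[OF m' D] prob_on_iff_AE[OF m', of D] D by auto
  \<comment> \<open>The law m is carried by D; the value k0 elsewhere keeps the decoded law on K.\<close>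
  define f' where "f' z = (if z \<in> D then f z else k0)" for z
  have f'K: "f' z \<in> K" for z using f(2) k0 by (auto simp: f'_def)
  have "f' \<in> borel \<rightarrow>\<^sub>M borel" unfolding f'_def
    using D(1) borel_measurable_continuous_on_restrict[OF f(1)]
    by (subst measurable_If_restrict_space_iff) (auto simp: closed_def)
  then have f'_meas: "f' \<in> m \<rightarrow>\<^sub>M borel" by simp
  define \<mu> where "\<mu> = distr m borel f'"
  have mu_prob: "\<mu> \<in> laws"
    using m.prob_space_distr[OF f'_meas] by (simp add: \<mu>_def space_prob_algebra)
  have "AE x in \<mu>. x \<in> K" unfolding \<mu>_def
    using Kb f'K by (subst AE_distr_iff[OF f'_meas]) auto
  then have muK: "\<mu> \<in> prob_on K" using prob_on_iff_AE[OF mu_prob Kb] by blast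
  moreover have "limitin weak_topology (\<mu>s \<circ> r) \<mu> sequentially"
  proof (rule limitin_weak_topologyI[OF mu_prob])
    fix \<phi> :: "'b \<Rightarrow> real" assume \<phi>: "continuous_on UNIV \<phi>" "bounded (range \<phi>)"
    then obtain c where c: "\<And>x. \<bar>\<phi> x\<bar> \<le> c" by (auto simp: bounded_iff)
    then have c0: "0 \<le> c" using abs_ge_zero order_trans by blast
    have \<phi>_meas: "\<phi> \<in> borel_measurable borel" using borel_measurable_continuous_onI[OF \<phi>(1)] .
    have "continuous_on D (\<phi> \<circ> f)"
      by (rule continuous_on_compose[OF f(1)]) (rule continuous_on_subset[OF \<phi>(1)], simp)
    then obtain h where h: "continuous_on UNIV h" "\<And>z. z \<in> D \<Longrightarrow> h z = \<phi> (f z)" "\<And>z. norm (h z) \<le> c"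
      using Tietze[of D "\<phi> \<circ> f" UNIV c] D(1) c0 c by auto
    have h_meas: "h \<in> borel_measurable borel" using borel_measurable_continuous_onI[OF h(1)] .
    have 1: "(\<integral>x. \<phi> x \<partial>(\<mu>s n)) = (\<integral>z. h z \<partial>(ms n))" for n
    proof -
      have "(\<integral>x. \<phi> x \<partial>(\<mu>s n)) = (\<integral>x. h (ternary_code x) \<partial>(\<mu>s n))"
      proof (rule integral_cong_AE)
        show "AE x in \<mu>s n. \<phi> x = h (ternary_code x)"
          using AE_K by eventually_elim (simp add: h(2) cD f(3))
        show "\<phi> \<in> borel_measurable (\<mu>s n)" using \<phi>_meas by measurable
        show "(\<lambda>x. h (ternary_code x)) \<in> borel_measurable (\<mu>s n)"
          by (rule measurable_compose[OF ms_meas h_meas])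
      qed
      then show ?thesis using int_ms[OF h_meas] by simp
    qed
    have "(\<integral>x. \<phi> x \<partial>\<mu>) = (\<integral>z. \<phi> (f' z) \<partial>m)"
      unfolding \<mu>_def by (rule integral_distr[OF f'_meas \<phi>_meas])
    also have "\<dots> = (\<integral>z. h z \<partial>m)"
    proof (rule integral_cong_AE)
      show "AE z in m. \<phi> (f' z) = h z" using mD by eventually_elim (simp add: f'_def h(2))
    qed (use h_meas measurable_compose[OF f'_meas \<phi>_meas] in auto)
    finally have 2: "(\<integral>x. \<phi> x \<partial>\<mu>) = (\<integral>z. h z \<partial>m)" .
    show "(\<lambda>n. \<integral>z. \<phi> z \<partial>((\<mu>s \<circ> r) n)) \<longlonglongrightarrow> (\<integral>z. \<phi> z \<partial>\<mu>)"
      unfolding 1 2 comp_def using conv'[OF h(1), of c] h(3) by simp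
  qed (use mus' in simp)
  ultimately show ?thesis using r that by blast
qed

lemma compact_moments_prob_on:
  fixes K :: "'b::polish_space set"
  assumes K: "compact K"
  shows "compact (moments ` prob_on K)"
  unfolding compact_def
proof (intro allI impI)
  fix ms :: "nat \<Rightarrow> nat \<Rightarrow> real" assume "\<forall>n. ms n \<in> moments ` prob_on K"
  then have "\<forall>n. \<exists>\<mu>. \<mu> \<in> prob_on K \<and> ms n = moments \<mu>" by blast
  then obtain \<mu>s where \<mu>s: "\<And>n. \<mu>s n \<in> prob_on K" "\<And>n. ms n = moments (\<mu>s n)" by metis
  obtain \<mu> r where "\<mu> \<in> prob_on K" "strict_mono r" "limitin weak_topology (\<mu>s \<circ> r) \<mu> sequentially"
    using prob_on_seq_compact[OF K \<mu>s(1)] .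
  then show "\<exists>l\<in>moments ` prob_on K. \<exists>r. strict_mono r \<and> (ms \<circ> r) \<longlonglongrightarrow> l"
    using limitin_weak_imp_moments[of "\<mu>s \<circ> r" \<mu> sequentially] by (auto simp: comp_def \<mu>s(2))
qed

text \<open>
  Every subsequence has a weakly convergent further one, whose limit has the moments of \<open>\<mu>\<close> and so
  equals \<open>\<mu>\<close>. Hence \<open>moments\<close> is a homeomorphism from the laws on a compact set onto
  its image.
\<close>

lemma limitin_weak_of_moments:
  fixes K :: "'b::polish_space set"
  assumes K: "compact K" and \<mu>s: "\<And>n. \<mu>s n \<in> prob_on K" and \<mu>: "\<mu> \<in> prob_on K"
    and lim: "(\<lambda>n. moments (\<mu>s n)) \<longlonglongrightarrow> moments \<mu>"
  shows "limitin weak_topology \<mu>s \<mu> sequentially"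
proof (rule limitin_weak_topologyI)
  show "\<mu> \<in> laws" "\<mu>s n \<in> laws" for n
    using \<mu> \<mu>s prob_onD by blast+
  fix f :: "'b \<Rightarrow> real" assume f: "continuous_on UNIV f" "bounded (range f)"
  have "\<exists>s :: nat \<Rightarrow> nat. (\<lambda>n. \<integral>z. f z \<partial>(\<mu>s (r (s n)))) \<longlonglongrightarrow> (\<integral>z. f z \<partial>\<mu>)" if "strict_mono r" for r :: "nat \<Rightarrow> nat"
  proof -
    obtain \<nu> s where \<nu>: "\<nu> \<in> prob_on K" "strict_mono s" "limitin weak_topology ((\<mu>s \<circ> r) \<circ> s) \<nu> sequentially"
      using prob_on_seq_compact[OF K, of "\<mu>s \<circ> r"] \<mu>s by auto
    have "(\<lambda>n. moments (\<mu>s (r (s n)))) \<longlonglongrightarrow> moments \<mu>"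
      using LIMSEQ_subseq_LIMSEQ[OF lim strict_mono_o[OF that \<nu>(2)]] by (simp add: comp_def)
    then have "moments \<nu> = moments \<mu>"
      using LIMSEQ_unique limitin_weak_imp_moments[OF \<nu>(3)] by (fastforce simp: comp_def)
    then have "\<nu> = \<mu>" using \<nu>(1) \<mu> prob_onD by (blast intro: moments_inject)
    then show ?thesis using limitin_weak_topologyD[OF \<nu>(3) f] by (auto simp: comp_def)
  qed
  then show "(\<lambda>n. \<integral>z. f z \<partial>(\<mu>s n)) \<longlonglongrightarrow> (\<integral>z. f z \<partial>\<mu>)"
    by (rule LIMSEQ_subsubseqI)
qed

section \<open>Lower semicontinuous minimisation and measurable selection\<close>

definition slice_min :: "('x \<times> 'm) set \<Rightarrow> ('x \<Rightarrow> 'm \<Rightarrow> ereal) \<Rightarrow> 'x \<Rightarrow> ereal" where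
  "slice_min \<Gamma> g x = (INF m\<in>{m. (x, m) \<in> \<Gamma>}. g x m)"

text \<open>
  Only sequences inside \<open>\<Gamma>\<close> count: in the applications a point outside \<open>\<Gamma>\<close>
  is not the image of an admissible law, and \<open>g\<close> has no meaning there.
\<close>

definition seq_lsc_on :: "('x::topological_space \<times> 'm::topological_space) set \<Rightarrow> ('x \<Rightarrow> 'm \<Rightarrow> ereal) \<Rightarrow> bool" where
  "seq_lsc_on \<Gamma> g \<longleftrightarrow> (\<forall>xs ms x m. (\<forall>n. (xs n, ms n) \<in> \<Gamma>) \<longrightarrow> (x, m) \<in> \<Gamma> \<longrightarrow> xs \<longlonglongrightarrow> x \<longrightarrow> ms \<longlonglongrightarrow> m \<longrightarrow>
     g x m \<le> liminf (\<lambda>n. g (xs n) (ms n)))"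

lemma seq_lsc_onD:
  assumes "seq_lsc_on \<Gamma> g" "\<And>n. (xs n, ms n) \<in> \<Gamma>" "(x, m) \<in> \<Gamma>" "xs \<longlonglongrightarrow> x" "ms \<longlonglongrightarrow> m"
  shows "g x m \<le> liminf (\<lambda>n. g (xs n) (ms n))"
  using assms unfolding seq_lsc_on_def by blast

lemma liminf_le_const:
  fixes u :: "nat \<Rightarrow> ereal"
  assumes "\<And>n. u n \<le> c" shows "liminf u \<le> c"
proof -
  have "liminf u \<le> liminf (\<lambda>n. c)" using assms by (intro Liminf_mono) auto
  then show ?thesis by (simp add: Liminf_const)
qed

lemma le_liminfI_subseq:
  fixes u :: "nat \<Rightarrow> ereal"
  assumes "\<And>c r :: nat \<Rightarrow> nat. c < L \<Longrightarrow> strict_mono r \<Longrightarrow> (\<And>n. u (r n) < c) \<Longrightarrow> False"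
  shows "L \<le> liminf u"
proof (rule ccontr)
  assume "\<not> L \<le> liminf u"
  then obtain c where c: "liminf u < c" "c < L" using dense[of "liminf u" L] by (auto simp: not_le)
  have "\<not> eventually (\<lambda>n. c \<le> u n) sequentially"
    using c(1) Liminf_bounded[of c u sequentially] by auto
  from not_eventually_sequentiallyD[OF this] obtain r :: "nat \<Rightarrow> nat" where
    "strict_mono r" "\<And>n. u (r n) < c" by (auto simp: not_le)
  with assms c(2) show False by blast
qed

lemma seq_lsc_measurable:
  fixes f :: "'x::metric_space \<Rightarrow> ereal"
  assumes "\<And>xs x. xs \<longlonglongrightarrow> x \<Longrightarrow> f x \<le> liminf (\<lambda>n. f (xs n))"
  shows "f \<in> borel_measurable borel"
proof (rule borel_measurableI_le)
  fix c
  have "closed {x. f x \<le> c}"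
    unfolding closed_sequential_limits
    using assms liminf_le_const order_trans by (smt (verit, best) mem_Collect_eq)
  then show "{x \<in> space borel. f x \<le> c} \<in> sets borel" by simp
qed

text \<open>
  The common core of attainment and lower semicontinuity of the minimum: near-minimisers over converging base points
  accumulate, in the compact set \<open>Q\<close>, at a point that does at least as well.
\<close>

lemma slice_subseq:
  fixes \<Gamma> :: "('x::metric_space \<times> 'm::metric_space) set" and ms :: "nat \<Rightarrow> 'm"
  assumes \<Gamma>: "closed \<Gamma>" "\<Gamma> \<subseteq> UNIV \<times> Q" "compact Q" and lsc: "seq_lsc_on \<Gamma> g"
    and xs: "xs \<longlonglongrightarrow> x" and ms: "\<And>n. (xs n, ms n) \<in> \<Gamma>" and lim: "\<And>n. g (xs n) (ms n) \<le> c n" "c \<longlonglongrightarrow> d"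
  shows "\<exists>m. (x, m) \<in> \<Gamma> \<and> g x m \<le> d"
proof -
  have "\<forall>n. ms n \<in> Q" using \<Gamma>(2) ms by blast
  then obtain m s where s: "strict_mono s" "(ms \<circ> s) \<longlonglongrightarrow> m"
    using \<Gamma>(3) unfolding compact_def by blast
  have xs': "(\<lambda>n. xs (s n)) \<longlonglongrightarrow> x" using LIMSEQ_subseq_LIMSEQ[OF xs s(1)] by (simp add: comp_def)
  have ms': "(\<lambda>n. ms (s n)) \<longlonglongrightarrow> m" using s(2) by (simp add: comp_def)
  have mem: "(x, m) \<in> \<Gamma>"
    using closed_sequentially[OF \<Gamma>(1), of "\<lambda>n. (xs (s n), ms (s n))"] ms tendsto_Pair[OF xs' ms'] by blast
  have "g x m \<le> liminf (\<lambda>n. g (xs (s n)) (ms (s n)))"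
    by (rule seq_lsc_onD[OF lsc _ mem xs' ms']) (rule ms)
  also have "\<dots> \<le> liminf (\<lambda>n. c (s n))" using lim(1) by (intro Liminf_mono) auto
  also have "\<dots> = d"
    using LIMSEQ_subseq_LIMSEQ[OF lim(2) s(1)] by (intro lim_imp_Liminf) (auto simp: comp_def)
  finally show ?thesis using mem by blast
qed

lemma slice_min_attained:
  fixes \<Gamma> :: "('x::metric_space \<times> 'm::metric_space) set"
  assumes "closed \<Gamma>" "\<Gamma> \<subseteq> UNIV \<times> Q" "compact Q" "seq_lsc_on \<Gamma> g" and ne: "(x, m0) \<in> \<Gamma>"
  shows "\<exists>m. (x, m) \<in> \<Gamma> \<and> g x m = slice_min \<Gamma> g x"
proof -
  have "g x ` {m. (x, m) \<in> \<Gamma>} \<noteq> {}" using ne by blast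
  from Inf_as_limit[OF this] obtain u where
    u: "\<And>n. u n \<in> g x ` {m. (x, m) \<in> \<Gamma>}" "u \<longlonglongrightarrow> slice_min \<Gamma> g x"
    unfolding slice_min_def by blast
  have "\<forall>n. \<exists>m. (x, m) \<in> \<Gamma> \<and> u n = g x m" using u(1) by blast
  then obtain ms where ms: "\<And>n. (x, ms n) \<in> \<Gamma>" "\<And>n. u n = g x (ms n)" by metis
  have "\<exists>m. (x, m) \<in> \<Gamma> \<and> g x m \<le> slice_min \<Gamma> g x"
    by (rule slice_subseq[OF assms(1-4), of "\<lambda>_. x" x ms u]) (use ms u in auto)
  then obtain m where m: "(x, m) \<in> \<Gamma>" "g x m \<le> slice_min \<Gamma> g x" by blast
  have "slice_min \<Gamma> g x \<le> g x m" unfolding slice_min_def using m(1) by (intro INF_lower) simp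
  with m show ?thesis by (blast intro: antisym)
qed

lemma slice_min_lsc:
  fixes \<Gamma> :: "('x::metric_space \<times> 'm::metric_space) set"
  assumes "closed \<Gamma>" "\<Gamma> \<subseteq> UNIV \<times> Q" "compact Q" "seq_lsc_on \<Gamma> g" and xs: "xs \<longlonglongrightarrow> x"
  shows "slice_min \<Gamma> g x \<le> liminf (\<lambda>n. slice_min \<Gamma> g (xs n))"
proof (rule le_liminfI_subseq)
  fix c and r :: "nat \<Rightarrow> nat"
  assume c: "c < slice_min \<Gamma> g x" and r: "strict_mono r" "\<And>n. slice_min \<Gamma> g (xs (r n)) < c"
  have "\<forall>n. \<exists>m. (xs (r n), m) \<in> \<Gamma> \<and> g (xs (r n)) m < c"
    using r(2) unfolding slice_min_def INF_less_iff by blast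
  then obtain ms where ms: "\<And>n. (xs (r n), ms n) \<in> \<Gamma>" "\<And>n. g (xs (r n)) (ms n) < c" by metis
  have "\<exists>m. (x, m) \<in> \<Gamma> \<and> g x m \<le> c"
    by (rule slice_subseq[OF assms(1-4), of "\<lambda>n. xs (r n)" x ms "\<lambda>_. c"])
       (use ms LIMSEQ_subseq_LIMSEQ[OF xs r(1)] in \<open>auto simp: comp_def less_imp_le\<close>)
  then obtain m where "(x, m) \<in> \<Gamma>" "g x m \<le> c" by blast
  then have "slice_min \<Gamma> g x \<le> c" unfolding slice_min_def by (auto intro: INF_lower2)
  with c show False by simp
qed

lemma slice_min_measurable:
  fixes \<Gamma> :: "('x::metric_space \<times> 'm::metric_space) set"
  assumes "closed \<Gamma>" "\<Gamma> \<subseteq> UNIV \<times> Q" "compact Q" "seq_lsc_on \<Gamma> g"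
  shows "slice_min \<Gamma> g \<in> borel_measurable borel"
  by (rule seq_lsc_measurable) (rule slice_min_lsc[OF assms])

lemma seq_lsc_on_graph_measurable:
  fixes \<Gamma> :: "('x::metric_space \<times> 'm::metric_space) set"
  assumes \<Gamma>: "closed \<Gamma>" and lsc: "seq_lsc_on \<Gamma> g"
  shows "(\<lambda>z. if z \<in> \<Gamma> then g (fst z) (snd z) else \<infinity>) \<in> borel_measurable borel"
proof (rule seq_lsc_measurable, rule le_liminfI_subseq)
  fix zs and z and c and r :: "nat \<Rightarrow> nat"
  assume zs: "zs \<longlonglongrightarrow> z" and c: "c < (if z \<in> \<Gamma> then g (fst z) (snd z) else \<infinity>)" and r: "strict_mono r"
    and less: "\<And>n. (if zs (r n) \<in> \<Gamma> then g (fst (zs (r n))) (snd (zs (r n))) else \<infinity>) < c"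
  have z': "(\<lambda>n. zs (r n)) \<longlonglongrightarrow> z" using LIMSEQ_subseq_LIMSEQ[OF zs r] by (simp add: comp_def)
  have mem: "zs (r n) \<in> \<Gamma>" for n using less[of n] by (auto split: if_splits)
  have z: "z \<in> \<Gamma>" by (rule closed_sequentially[OF \<Gamma> _ z']) (rule mem)
  have "g (fst z) (snd z) \<le> liminf (\<lambda>n. g (fst (zs (r n))) (snd (zs (r n))))"
    by (rule seq_lsc_onD[OF lsc]) (use mem z tendsto_fst[OF z'] tendsto_snd[OF z'] in auto)
  also have "\<dots> \<le> c" using less mem by (intro liminf_le_const) (auto simp: less_imp_le)
  finally show False using c z by simp
qed

text \<open>
  Measurability of a compact-valued map \<open>D\<close> in its strong form: preimages of closed sets are
  measurable.
\<close>

definition hit_measurable :: "'x measure \<Rightarrow> ('x \<Rightarrow> 'm::topological_space set) \<Rightarrow> bool" where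
  "hit_measurable N D \<longleftrightarrow> (\<forall>x. compact (D x) \<and> D x \<noteq> {}) \<and>
     (\<forall>F. closed F \<longrightarrow> {x \<in> space N. D x \<inter> F \<noteq> {}} \<in> sets N)"

text \<open>
  Minimising a continuous function over \<open>D x\<close> gives a measurable minimum and a map of minimisers of the
  same kind, so that the step can be repeated. That a minimiser lies in \<open>F\<close> is expressed by countably
  many hitting conditions: by compactness it suffices that \<open>D x \<inter> F\<close> meets all rational sublevel
  sets above the minimum.
\<close>

lemma hit_measurable_min:
  fixes D :: "'x \<Rightarrow> 'm::metric_space set" and f :: "'m \<Rightarrow> real"
  assumes D: "hit_measurable N D" and f: "continuous_on UNIV f"
  shows "(\<lambda>x. Inf (f ` D x)) \<in> borel_measurable N"
    and "hit_measurable N (\<lambda>x. {m \<in> D x. f m = Inf (f ` D x)})"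
proof -
  have cpt: "compact (D x)" "D x \<noteq> {}" for x using D by (auto simp: hit_measurable_def)
  have hit: "{x \<in> space N. D x \<inter> F \<noteq> {}} \<in> sets N" if "closed F" for F
    using D that by (simp add: hit_measurable_def)
  have cl: "closed {m. f m \<le> c}" for c
    by (rule closed_Collect_le[OF f]) simp
  have att: "\<exists>m\<in>B. f m = Inf (f ` B) \<and> (\<forall>m'\<in>B. f m \<le> f m')" if B: "compact B" "B \<noteq> {}" for B
  proof -
    obtain m where m: "m \<in> B" "\<And>m'. m' \<in> B \<Longrightarrow> f m \<le> f m'"
      using continuous_attains_inf[OF B continuous_on_subset[OF f subset_UNIV]] by auto
    then have "Inf (f ` B) = f m" by (intro cInf_eq_minimum) auto
    with m show ?thesis by auto
  qed
  have inf_le: "Inf (f ` D x) \<le> f m" if "m \<in> D x" for x m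
    using att[OF cpt, of x] that by auto
  have iff: "Inf (f ` D x) \<le> c \<longleftrightarrow> D x \<inter> {m. f m \<le> c} \<noteq> {}" for x c
  proof
    assume "Inf (f ` D x) \<le> c"
    moreover obtain m where "m \<in> D x" "f m = Inf (f ` D x)" using att[OF cpt, of x] by blast
    ultimately have "m \<in> D x \<inter> {m. f m \<le> c}" by simp
    then show "D x \<inter> {m. f m \<le> c} \<noteq> {}" by blast
  next
    assume "D x \<inter> {m. f m \<le> c} \<noteq> {}"
    then obtain m where "m \<in> D x" "f m \<le> c" by blast
    then show "Inf (f ` D x) \<le> c" using inf_le[of m x] by simp
  qed
  show meas: "(\<lambda>x. Inf (f ` D x)) \<in> borel_measurable N"
    by (rule borel_measurableI_le) (simp add: iff hit[OF cl])
  show "hit_measurable N (\<lambda>x. {m \<in> D x. f m = Inf (f ` D x)})"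
    unfolding hit_measurable_def
  proof (intro conjI allI impI)
    fix x
    have eq: "{m \<in> D x. f m = Inf (f ` D x)} = D x \<inter> {m. f m \<le> Inf (f ` D x)}"
      using inf_le[of _ x] by (auto intro: antisym)
    show "compact {m \<in> D x. f m = Inf (f ` D x)}" unfolding eq
      by (rule compact_Int_closed[OF cpt(1) cl])
    show "{m \<in> D x. f m = Inf (f ` D x)} \<noteq> {}" using att[OF cpt, of x] by auto
  next
    fix F :: "'m set" assume F: "closed F"
    have "{m \<in> D x. f m = Inf (f ` D x)} \<inter> F \<noteq> {} \<longleftrightarrow>
       (\<forall>q\<in>\<rat>. Inf (f ` D x) < q \<longrightarrow> D x \<inter> (F \<inter> {m. f m \<le> q}) \<noteq> {})" (is "?L \<longleftrightarrow> ?R") for x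
    proof
      assume ?L
      then obtain m where m: "m \<in> D x" "f m = Inf (f ` D x)" "m \<in> F" by blast
      show ?R
      proof (intro ballI impI)
        fix q assume "Inf (f ` D x) < q"
        then have "m \<in> D x \<inter> (F \<inter> {m. f m \<le> q})" using m by simp
        then show "D x \<inter> (F \<inter> {m. f m \<le> q}) \<noteq> {}" by blast
      qed
    next
      assume R: ?R
      obtain q where q: "q \<in> \<rat>" "Inf (f ` D x) < q"
        using Rats_dense_in_real[of "Inf (f ` D x)" "Inf (f ` D x) + 1"] by auto
      then have "D x \<inter> F \<noteq> {}" using R by auto
      with att[OF compact_Int_closed[OF cpt(1) F]] obtain m where
        m: "m \<in> D x" "m \<in> F" "\<And>m'. m' \<in> D x \<inter> F \<Longrightarrow> f m \<le> f m'" by blast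
      have "f m \<le> Inf (f ` D x)"
      proof (rule ccontr)
        assume "\<not> f m \<le> Inf (f ` D x)"
        then obtain q where q: "q \<in> \<rat>" "Inf (f ` D x) < q" "q < f m"
          using Rats_dense_in_real[of "Inf (f ` D x)" "f m"] by auto
        then obtain m' where "m' \<in> D x \<inter> F" "f m' \<le> q" using R by blast
        then show False using q(3) m(3)[of m'] by simp
      qed
      then have "f m = Inf (f ` D x)" using inf_le[OF m(1)] by simp
      with m show ?L by blast
    qed
    then have "{x \<in> space N. {m \<in> D x. f m = Inf (f ` D x)} \<inter> F \<noteq> {}} =
      {x \<in> space N. \<forall>q\<in>\<rat>. q \<le> Inf (f ` D x) \<or> x \<in> {x \<in> space N. D x \<inter> (F \<inter> {m. f m \<le> q}) \<noteq> {}}}"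
      by (intro Collect_cong) (auto simp: not_le[symmetric])
    also have "\<dots> \<in> sets N"
    proof -
      have "{x \<in> space N. D x \<inter> (F \<inter> {m. f m \<le> q}) \<noteq> {}} \<in> sets N" for q
        by (intro hit closed_Int F cl)
      then have "{x \<in> space N. q \<le> Inf (f ` D x) \<or> x \<in> {x \<in> space N. D x \<inter> (F \<inter> {m. f m \<le> q}) \<noteq> {}}} \<in> sets N" for q
        using meas by measurable
      then show ?thesis by (intro sets.sets_Collect_countable_All' countable_rat)
    qed
    finally show "{x \<in> space N. {m \<in> D x. f m = Inf (f ` D x)} \<inter> F \<noteq> {}} \<in> sets N" .
  qed
qed

text \<open>
  Minimise the coordinates one after the other. The sets of minimisers decrease and are compact, so they have a
  common point; its \<open>j\<close>-th coordinate is the \<open>j\<close>-th minimum and hence measurable.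
\<close>

lemma lexicographic_selection:
  fixes D :: "'x \<Rightarrow> (nat \<Rightarrow> real) set"
  assumes D: "hit_measurable N D"
  obtains s where "s \<in> borel_measurable N" "\<And>x. s x \<in> D x"
proof -
  define E where "E = rec_nat D (\<lambda>j E x. {m \<in> E x. m j = Inf ((\<lambda>m. m j) ` E x)})"
  have E0: "E 0 = D" and ES: "E (Suc j) = (\<lambda>x. {m \<in> E j x. m j = Inf ((\<lambda>m. m j) ` E j x)})" for j
    by (simp_all add: E_def)
  have cont: "continuous_on UNIV (\<lambda>m :: nat \<Rightarrow> real. m j)" for j
    by (rule continuous_on_product_coordinates)
  have hit: "hit_measurable N (E j)" for j
    by (induction j) (auto simp: E0 ES D intro: hit_measurable_min(2)[OF _ cont])
  have mono: "E n x \<subseteq> E m x" if "m \<le> n" for m n x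
    using that by (rule lift_Suc_antimono_le[rotated]) (auto simp: ES)
  have "\<exists>m. \<forall>j. m \<in> E j x" for x
  proof -
    have cpt: "compact (E j x)" "E j x \<noteq> {}" for j using hit[of j] by (auto simp: hit_measurable_def)
    define ms where "ms j = (SOME m. m \<in> E j x)" for j
    have ms: "ms j \<in> E j x" for j unfolding ms_def using cpt(2) by (rule some_in_eq[THEN iffD2])
    then have "\<forall>j. ms j \<in> E 0 x" using mono[of 0] by blast
    then obtain m r where r: "strict_mono r" "(ms \<circ> r) \<longlonglongrightarrow> m"
      using cpt(1)[of 0] unfolding compact_def by blast
    have "m \<in> E j x" for j
    proof (rule Lim_in_closed_set[OF compact_imp_closed[OF cpt(1)] _ _ r(2)])
      show "eventually (\<lambda>n. (ms \<circ> r) n \<in> E j x) sequentially"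
        using eventually_ge_at_top[of j]
      proof eventually_elim
        case (elim n)
        then have "j \<le> r n" using seq_suble[OF r(1), of n] by simp
        then show ?case using ms[of "r n"] mono[of j "r n"] by auto
      qed
    qed simp
    then show ?thesis by blast
  qed
  then obtain s where s: "\<And>x j. s x \<in> E j x" by metis
  have "s \<in> borel_measurable N"
  proof (rule measurable_coordinatewise_then_product)
    fix j
    have "s x j = Inf ((\<lambda>m. m j) ` E j x)" for x using s[of x "Suc j"] by (simp add: ES)
    then show "(\<lambda>x. s x j) \<in> borel_measurable N"
      using hit_measurable_min(1)[OF hit cont] by simp
  qed
  moreover have "s x \<in> D x" for x using s[of x 0] by (simp add: E0)
  ultimately show ?thesis by (rule that)
qed

text \<open>
  The map of minimisers hits a closed set \<open>F\<close> exactly where the minimum over the part of the slice in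
  \<open>F\<close> is not above the minimum over the slice. Both minima are lower semicontinuous, hence measurable.
  Finiteness of \<open>g\<close> makes the comparison fail where the slice misses \<open>F\<close>.
\<close>

lemma slice_argmin_selection:
  fixes \<Gamma> :: "('x::metric_space \<times> (nat \<Rightarrow> real)) set"
  assumes \<Gamma>: "closed \<Gamma>" "\<Gamma> \<subseteq> UNIV \<times> Q" "compact Q" "seq_lsc_on \<Gamma> g"
    and fin: "\<And>x m. (x, m) \<in> \<Gamma> \<Longrightarrow> g x m < \<infinity>" and ne: "\<And>x. \<exists>m. (x, m) \<in> \<Gamma>"
  shows "compact {m. (x, m) \<in> \<Gamma> \<and> g x m = slice_min \<Gamma> g x}"
    and "\<exists>s\<in>borel_measurable borel. \<forall>x. (x, s x) \<in> \<Gamma> \<and> g x (s x) = slice_min \<Gamma> g x"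
proof -
  define D where "D x = {m. (x, m) \<in> \<Gamma> \<and> g x m = slice_min \<Gamma> g x}" for x
  have min_le: "slice_min \<Gamma> g x \<le> g x m" if "(x, m) \<in> \<Gamma>" for x m
    unfolding slice_min_def using that by (intro INF_lower) simp
  have fin_min: "slice_min \<Gamma> g x < \<infinity>" for x
    using ne[of x] min_le fin by (meson le_less_trans)
  have cD: "compact (D x)" for x
  proof -
    have "closed (D x)" unfolding closed_sequential_limits
    proof (intro allI impI)
      fix ms m assume ms: "(\<forall>n. ms n \<in> D x) \<and> ms \<longlonglongrightarrow> m"
      have mem: "(x, m) \<in> \<Gamma>"
        using closed_sequentially[OF \<Gamma>(1), of "\<lambda>n. (x, ms n)" "(x, m)"] ms
          tendsto_Pair[OF tendsto_const[of x] conjunct2[OF ms]]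
        by (auto simp: D_def)
      have "g x m \<le> liminf (\<lambda>n. g x (ms n))"
        by (rule seq_lsc_onD[OF \<Gamma>(4)]) (use ms mem in \<open>auto simp: D_def\<close>)
      also have "\<dots> \<le> slice_min \<Gamma> g x" using ms by (intro liminf_le_const) (auto simp: D_def)
      finally show "m \<in> D x" using mem min_le by (auto simp: D_def intro: antisym)
    qed
    moreover have "D x \<subseteq> Q" using \<Gamma>(2) by (auto simp: D_def)
    ultimately show ?thesis using \<Gamma>(3) by (metis compact_Int_closed inf.absorb_iff2)
  qed
  then show "compact {m. (x, m) \<in> \<Gamma> \<and> g x m = slice_min \<Gamma> g x}" by (simp add: D_def)
  have "hit_measurable borel D" unfolding hit_measurable_def
  proof (intro conjI allI impI cD)
    show "D x \<noteq> {}" for x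
      using slice_min_attained[OF \<Gamma>(1-4)] ne[of x] by (auto simp: D_def)
    fix F :: "(nat \<Rightarrow> real) set" assume F: "closed F"
    define \<Gamma>' where "\<Gamma>' = \<Gamma> \<inter> (UNIV \<times> F)"
    have \<Gamma>': "closed \<Gamma>'" "\<Gamma>' \<subseteq> UNIV \<times> Q" "seq_lsc_on \<Gamma>' g"
      using \<Gamma> F by (auto simp: \<Gamma>'_def seq_lsc_on_def intro!: closed_Int closed_Times)
    have "D x \<inter> F \<noteq> {} \<longleftrightarrow> slice_min \<Gamma>' g x \<le> slice_min \<Gamma> g x" for x
    proof
      assume "D x \<inter> F \<noteq> {}"
      then obtain m where "m \<in> D x" "m \<in> F" by blast
      then show "slice_min \<Gamma>' g x \<le> slice_min \<Gamma> g x"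
        unfolding slice_min_def[of \<Gamma>'] by (auto intro!: INF_lower2[of m] simp: D_def \<Gamma>'_def)
    next
      assume le: "slice_min \<Gamma>' g x \<le> slice_min \<Gamma> g x"
      have "\<exists>m. (x, m) \<in> \<Gamma>'"
      proof (rule ccontr)
        assume "\<nexists>m. (x, m) \<in> \<Gamma>'"
        then have "slice_min \<Gamma>' g x = \<infinity>" by (simp add: slice_min_def top_ereal_def)
        with le fin_min[of x] show False by simp
      qed
      then obtain m where m: "(x, m) \<in> \<Gamma>'" "g x m = slice_min \<Gamma>' g x"
        using slice_min_attained[OF \<Gamma>'(1,2) \<Gamma>(3) \<Gamma>'(3)] by blast
      then have "(x, m) \<in> \<Gamma>" "m \<in> F" by (auto simp: \<Gamma>'_def)
      then have "m \<in> D x \<inter> F" using le m(2) min_le[of x m] by (simp add: D_def)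
      then show "D x \<inter> F \<noteq> {}" by blast
    qed
    moreover have "{x. slice_min \<Gamma>' g x \<le> slice_min \<Gamma> g x} \<in> sets borel"
      using slice_min_measurable[OF \<Gamma>'(1,2) \<Gamma>(3) \<Gamma>'(3)] slice_min_measurable[OF \<Gamma>]
      by measurable
    ultimately show "{x \<in> space borel. D x \<inter> F \<noteq> {}} \<in> sets borel" by simp
  qed
  from lexicographic_selection[OF this] show
    "\<exists>s\<in>borel_measurable borel. \<forall>x. (x, s x) \<in> \<Gamma> \<and> g x (s x) = slice_min \<Gamma> g x"
    by (auto simp: D_def)
qed

section \<open>Risk measures are nonexpansive under couplings\<close>

lemma prob_on_bounded_law:
  fixes \<mu> :: "real measure"
  assumes "\<mu> \<in> prob_on {-c..c}"
  shows "\<mu> \<in> bounded_laws"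
  using assms by (auto simp: prob_on_def bounded_laws_def intro!: bexI[of _ "{-c..c}"])

lemma bounded_law_prob_on:
  fixes \<mu> :: "real measure"
  assumes "\<mu> \<in> bounded_laws"
  obtains c where "0 \<le> c" "\<mu> \<in> prob_on {-c..c}"
proof -
  from assms obtain B where B: "\<mu> \<in> laws" "B \<in> sets borel" "bounded B" "measure \<mu> B = 1"
    by (auto simp: bounded_laws_def)
  interpret prob_space \<mu> using space_prob_borelD(1)[OF B(1)] .
  obtain c where c: "0 < c" "\<And>x. x \<in> B \<Longrightarrow> \<bar>x\<bar> \<le> c" using B(3) by (auto simp: bounded_pos)
  have "AE x in \<mu>. x \<in> B" using B prob_on_iff_AE[OF B(1,2)] by (simp add: prob_on_def)
  then have "AE x in \<mu>. x \<in> {-c..c}" by eventually_elim (use c(2) in force)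
  then have "\<mu> \<in> prob_on {-c..c}" using prob_on_iff_AE[OF B(1)] by simp
  with c(1) show ?thesis by (intro that[of c]) auto
qed

lemma convolution_return:
  fixes \<mu> :: "real measure"
  assumes "\<mu> \<in> laws"
  shows "\<mu> \<star> return borel c = distr \<mu> borel (\<lambda>x. x + c)"
proof (rule measure_eqI)
  interpret prob_space \<mu> using space_prob_borelD(1)[OF assms] .
  note sets [measurable_cong] = space_prob_borelD(2)[OF assms]
  interpret r: prob_space "return borel c" by (rule prob_space_return) simp
  fix A assume "A \<in> sets (\<mu> \<star> return borel c)"
  then have A [measurable]: "A \<in> sets borel" by simp
  have "emeasure (\<mu> \<star> return borel c) A = (\<integral>\<^sup>+x. emeasure (return borel c) {a. a + x \<in> A} \<partial>\<mu>)"
    using space_prob_borelD[OF assms]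
    by (intro convolution_emeasure) (auto intro: finite_measure_axioms r.finite_measure_axioms)
  also have "\<dots> = (\<integral>\<^sup>+x. indicator ((\<lambda>x. x + c) -` A \<inter> space \<mu>) x \<partial>\<mu>)"
    by (intro nn_integral_cong) (auto simp: indicator_def ac_simps)
  also have "\<dots> = emeasure \<mu> ((\<lambda>x. x + c) -` A \<inter> space \<mu>)"
    by (rule nn_integral_indicator) measurable
  also have "\<dots> = emeasure (distr \<mu> borel (\<lambda>x. x + c)) A"
    by (rule emeasure_distr[symmetric]) measurable
  finally show "emeasure (\<mu> \<star> return borel c) A = emeasure (distr \<mu> borel (\<lambda>x. x + c)) A" .
qed simp

lemma return_prob_on:
  assumes "c \<in> K" "K \<in> sets borel" shows "return borel c \<in> prob_on K"
  using assms prob_space_return[of c borel]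
  by (auto simp: prob_on_def space_prob_algebra measure_return)

lemma distr_prob_on:
  assumes N: "prob_space N" and f: "f \<in> N \<rightarrow>\<^sub>M borel" and K: "K \<in> sets borel" "AE x in N. f x \<in> K"
  shows "distr N borel f \<in> prob_on K"
proof -
  have *: "distr N borel f \<in> laws"
    using prob_space.prob_space_distr[OF N f] by (simp add: space_prob_algebra)
  have "AE x in distr N borel f. x \<in> K" using K by (subst AE_distr_iff[OF f]) auto
  then show ?thesis using prob_on_iff_AE[OF * K(1)] by blast
qed

text \<open>
  Translation by \<open>c\<close> turns the hypothesis into first-order stochastic dominance.
\<close>

lemma risk_shift_mono:
  assumes \<sigma>: "convex_risk_measure \<sigma>" and \<mu>: "\<mu> \<in> bounded_laws" and \<mu>': "\<mu>' \<in> bounded_laws"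
    and le: "\<And>r. measure \<mu>' {..r - c} \<le> measure \<mu> {..r}"
  shows "\<sigma> \<mu> \<le> \<sigma> \<mu>' + ereal c"
proof -
  obtain d where d: "0 \<le> d" "\<mu>' \<in> prob_on {-d..d}" using bounded_law_prob_on[OF \<mu>'] .
  have \<mu>'_prob: "\<mu>' \<in> laws" using d(2) by (rule prob_onD)
  interpret prob_space \<mu>' using space_prob_borelD(1)[OF \<mu>'_prob] .
  note sets [measurable_cong] = space_prob_borelD(2)[OF \<mu>'_prob]
  have "AE x in \<mu>'. x \<in> {-d..d}" using d(2) prob_on_iff_AE[OF \<mu>'_prob] by auto
  then have "AE x in \<mu>'. x + c \<in> {-(d + \<bar>c\<bar>)..d + \<bar>c\<bar>}" by eventually_elim auto
  then have "distr \<mu>' borel (\<lambda>x. x + c) \<in> prob_on {-(d + \<bar>c\<bar>)..d + \<bar>c\<bar>}"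
    by (intro distr_prob_on prob_space_axioms) simp_all
  then have mem: "(\<mu>' \<star> return borel c) \<in> bounded_laws"
    unfolding convolution_return[OF \<mu>'_prob] by (rule prob_on_bounded_law)
  have "measure (\<mu>' \<star> return borel c) {..r} = measure \<mu>' {..r - c}" for r
  proof -
    have "measure (distr \<mu>' borel (\<lambda>x. x + c)) {..r} = measure \<mu>' ((\<lambda>x. x + c) -` {..r} \<inter> space \<mu>')"
      by (rule measure_distr) simp_all
    also have "(\<lambda>x. x + c) -` {..r} \<inter> space \<mu>' = {..r - c}"
      using space_prob_borelD(3)[OF \<mu>'_prob] by auto
    finally show ?thesis by (simp add: convolution_return[OF \<mu>'_prob])
  qed
  then have "\<sigma> \<mu> \<le> \<sigma> (\<mu>' \<star> return borel c)"
    using \<sigma> \<mu> mem le unfolding convex_risk_measure_def by auto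
  also have "\<dots> = \<sigma> \<mu>' + ereal c" using \<sigma> \<mu>' unfolding convex_risk_measure_def by auto
  finally show ?thesis .
qed

lemma risk_coupling:
  assumes \<sigma>: "convex_risk_measure \<sigma>" and N: "prob_space N"
    and f: "f \<in> borel_measurable N" "AE x in N. \<bar>f x\<bar> \<le> d"
    and g: "g \<in> borel_measurable N" "AE x in N. \<bar>g x\<bar> \<le> d'"
    and le: "AE x in N. f x \<le> g x + c"
  shows "\<sigma> (distr N borel f) \<le> \<sigma> (distr N borel g) + ereal c"
proof (rule risk_shift_mono[OF \<sigma>])
  interpret prob_space N by (rule N)
  have "AE x in N. f x \<in> {-d..d}" using f(2) by eventually_elim auto
  then show "distr N borel f \<in> bounded_laws"
    by (intro prob_on_bounded_law[OF distr_prob_on[OF N f(1)]]) simp_all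
  have "AE x in N. g x \<in> {-d'..d'}" using g(2) by eventually_elim auto
  then show "distr N borel g \<in> bounded_laws"
    by (intro prob_on_bounded_law[OF distr_prob_on[OF N g(1)]]) simp_all
  fix r
  have "measure N (g -` {..r - c} \<inter> space N) \<le> measure N (f -` {..r} \<inter> space N)"
  proof (rule finite_measure_mono_AE)
    show "AE x in N. x \<in> g -` {..r - c} \<inter> space N \<longrightarrow> x \<in> f -` {..r} \<inter> space N"
      using le by eventually_elim auto
  qed (use f(1) in measurable)
  then show "measure (distr N borel g) {..r - c} \<le> measure (distr N borel f) {..r}"
    by (simp add: measure_distr f(1) g(1))
qed

lemma risk_bound:
  assumes \<sigma>: "convex_risk_measure \<sigma>" and \<mu>: "\<mu> \<in> prob_on {-c..c}"
  shows "\<sigma> \<mu> \<le> \<sigma> (return borel 0) + ereal c" "\<sigma> (return borel 0) \<le> \<sigma> \<mu> + ereal c"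
proof -
  have \<mu>p: "\<mu> \<in> laws" using \<mu> by (rule prob_onD)
  interpret prob_space \<mu> using space_prob_borelD(1)[OF \<mu>p] .
  note sets [measurable_cong] = space_prob_borelD(2)[OF \<mu>p]
  have AE: "AE x in \<mu>. x \<in> {-c..c}" using \<mu> prob_on_iff_AE[OF \<mu>p] by simp
  then have AE': "AE x in \<mu>. \<bar>x\<bar> \<le> c" by eventually_elim auto
  have 1: "distr \<mu> borel (\<lambda>x. x) = \<mu>" by (rule distr_id2) (simp add: sets)
  have 2: "distr \<mu> borel (\<lambda>x. 0) = return borel 0" by (rule distr_const) simp
  have AE1: "AE x in \<mu>. x \<le> 0 + c" and AE2: "AE x in \<mu>. 0 \<le> x + c"
    using AE' by (eventually_elim, simp)+
  have id: "(\<lambda>x. x) \<in> borel_measurable \<mu>" by measurable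
  show "\<sigma> \<mu> \<le> \<sigma> (return borel 0) + ereal c"
    using risk_coupling[OF \<sigma> prob_space_axioms id AE' _ _ AE1, of 0] unfolding 1 2 by simp
  show "\<sigma> (return borel 0) \<le> \<sigma> \<mu> + ereal c"
    using risk_coupling[OF \<sigma> prob_space_axioms _ _ id AE' AE2, of 0] unfolding 1 2 by simp
qed

text \<open>
  One law of finite risk gives finite risk to the point mass at \<open>0\<close>, and thereby to every bounded law.
\<close>

lemma risk_finite:
  assumes \<sigma>: "convex_risk_measure \<sigma>" and \<mu>: "\<mu> \<in> bounded_laws"
  shows "\<bar>\<sigma> \<mu>\<bar> \<noteq> \<infinity>"
proof -
  obtain \<nu> where \<nu>: "\<nu> \<in> bounded_laws" "\<sigma> \<nu> \<noteq> \<infinity>"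
    using \<sigma> unfolding convex_risk_measure_def by blast
  obtain c where c: "\<nu> \<in> prob_on {-c..c}" using bounded_law_prob_on[OF \<nu>(1)] .
  obtain d where d: "\<mu> \<in> prob_on {-d..d}" using bounded_law_prob_on[OF \<mu>] .
  have "\<sigma> \<nu> + ereal c < \<infinity>" using \<nu>(2) by (cases "\<sigma> \<nu>") auto
  then have "\<sigma> (return borel 0) < \<infinity>" using risk_bound(2)[OF \<sigma> c] by (rule order.strict_trans1[rotated])
  then have "\<sigma> (return borel 0) + ereal d < \<infinity>" by (cases "\<sigma> (return borel 0)") auto
  then have "\<sigma> \<mu> < \<infinity>" using risk_bound(1)[OF \<sigma> d] by (rule order.strict_trans1[rotated])
  moreover have "\<sigma> \<mu> \<noteq> -\<infinity>" using \<sigma> \<mu> unfolding convex_risk_measure_def by blast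
  ultimately show ?thesis by auto
qed

section \<open>The joint law of a random point and a kernel\<close>

text \<open>
  The law of a pair whose first component has law \<open>\<nu>\<close> and whose second has conditional law
  \<open>\<kappa>\<close> given the first.
\<close>

definition kernel_joint :: "'s measure \<Rightarrow> 't measure \<Rightarrow> ('s \<Rightarrow> 't measure) \<Rightarrow> ('s \<times> 't) measure" where
  "kernel_joint \<nu> S \<kappa> = Giry_Monad.bind \<nu> (\<lambda>a. distr (\<kappa> a) (\<nu> \<Otimes>\<^sub>M S) (Pair a))"

lemma kernel_pair_measurable:
  assumes "\<kappa> \<in> \<nu> \<rightarrow>\<^sub>M prob_algebra S"
  shows "(\<lambda>a. distr (\<kappa> a) (\<nu> \<Otimes>\<^sub>M S) (Pair a)) \<in> \<nu> \<rightarrow>\<^sub>M prob_algebra (\<nu> \<Otimes>\<^sub>M S)"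
  using assms by (rule measurable_distr_prob_space2) simp

lemma kernel_joint_prob:
  assumes "prob_space \<nu>" "\<kappa> \<in> \<nu> \<rightarrow>\<^sub>M prob_algebra S"
  shows "prob_space (kernel_joint \<nu> S \<kappa>)" "sets (kernel_joint \<nu> S \<kappa>) = sets (\<nu> \<Otimes>\<^sub>M S)"
proof -
  interpret prob_space \<nu> by fact
  have "\<nu> \<in> space (prob_algebra \<nu>)" using assms(1) by (simp add: space_prob_algebra)
  then have "(\<lambda>_. \<nu>) \<in> count_space (UNIV :: unit set) \<rightarrow>\<^sub>M prob_algebra \<nu>" by simp
  from measurable_space[OF measurable_bind_prob_space[OF this kernel_pair_measurable[OF assms(2)]], of "()"]
  have "kernel_joint \<nu> S \<kappa> \<in> space (prob_algebra (\<nu> \<Otimes>\<^sub>M S))"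
    by (simp add: kernel_joint_def)
  then show "prob_space (kernel_joint \<nu> S \<kappa>)" "sets (kernel_joint \<nu> S \<kappa>) = sets (\<nu> \<Otimes>\<^sub>M S)"
    by (auto simp: space_prob_algebra)
qed

lemma kernelD:
  assumes "\<kappa> \<in> \<nu> \<rightarrow>\<^sub>M prob_algebra S" "a \<in> space \<nu>"
  shows "prob_space (\<kappa> a)" "sets (\<kappa> a) = sets S" "space (\<kappa> a) = space S"
  using measurable_space[OF assms] sets_eq_imp_space_eq[of "\<kappa> a" S] by (auto simp: space_prob_algebra)

lemma nn_integral_kernel_joint:
  assumes \<kappa>: "\<kappa> \<in> \<nu> \<rightarrow>\<^sub>M prob_algebra S" and f: "f \<in> borel_measurable (\<nu> \<Otimes>\<^sub>M S)"
  shows "(\<integral>\<^sup>+z. f z \<partial>kernel_joint \<nu> S \<kappa>) = (\<integral>\<^sup>+a. \<integral>\<^sup>+y. f (a, y) \<partial>\<kappa> a \<partial>\<nu>)"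
proof -
  have "(\<integral>\<^sup>+z. f z \<partial>kernel_joint \<nu> S \<kappa>) = (\<integral>\<^sup>+a. \<integral>\<^sup>+z. f z \<partial>distr (\<kappa> a) (\<nu> \<Otimes>\<^sub>M S) (Pair a) \<partial>\<nu>)"
    unfolding kernel_joint_def
    by (rule nn_integral_bind[OF f measurable_prob_algebraD[OF kernel_pair_measurable[OF \<kappa>]]])
  also have "\<dots> = (\<integral>\<^sup>+a. \<integral>\<^sup>+y. f (a, y) \<partial>\<kappa> a \<partial>\<nu>)"
  proof (rule nn_integral_cong)
    fix a assume a: "a \<in> space \<nu>"
    note [measurable_cong] = kernelD(2)[OF \<kappa> a]
    show "(\<integral>\<^sup>+z. f z \<partial>distr (\<kappa> a) (\<nu> \<Otimes>\<^sub>M S) (Pair a)) = (\<integral>\<^sup>+y. f (a, y) \<partial>\<kappa> a)"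
      using a f by (intro nn_integral_distr) simp_all
  qed
  finally show ?thesis .
qed

lemma integral_kernel_joint:
  fixes f :: "'s \<times> 't \<Rightarrow> real"
  assumes \<nu>: "prob_space \<nu>" and \<kappa>: "\<kappa> \<in> \<nu> \<rightarrow>\<^sub>M prob_algebra S"
    and f: "f \<in> borel_measurable (\<nu> \<Otimes>\<^sub>M S)" "\<And>z. \<bar>f z\<bar> \<le> c"
  shows "(\<integral>z. f z \<partial>kernel_joint \<nu> S \<kappa>) = (\<integral>a. \<integral>y. f (a, y) \<partial>\<kappa> a \<partial>\<nu>)"
proof -
  have "(\<integral>z. f z \<partial>kernel_joint \<nu> S \<kappa>) = (\<integral>a. \<integral>z. f z \<partial>distr (\<kappa> a) (\<nu> \<Otimes>\<^sub>M S) (Pair a) \<partial>\<nu>)"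
    unfolding kernel_joint_def
  proof (rule integral_bind[where K="\<nu> \<Otimes>\<^sub>M S" and B=c and B'=1])
    show "(\<lambda>a. distr (\<kappa> a) (\<nu> \<Otimes>\<^sub>M S) (Pair a)) \<in> \<nu> \<rightarrow>\<^sub>M subprob_algebra (\<nu> \<Otimes>\<^sub>M S)"
      by (rule measurable_prob_algebraD[OF kernel_pair_measurable[OF \<kappa>]])
    show "finite_measure \<nu>" using \<nu> by (rule prob_space.finite_measure)
    have "emeasure (distr (\<kappa> a) (\<nu> \<Otimes>\<^sub>M S) (Pair a)) (space (distr (\<kappa> a) (\<nu> \<Otimes>\<^sub>M S) (Pair a))) = 1"
      if "a \<in> space \<nu>" for a
      by (rule prob_space.emeasure_space_1)
         (use measurable_space[OF kernel_pair_measurable[OF \<kappa>] that] in \<open>simp add: space_prob_algebra\<close>)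
    then show "AE a in \<nu>. emeasure (distr (\<kappa> a) (\<nu> \<Otimes>\<^sub>M S) (Pair a))
        (space (distr (\<kappa> a) (\<nu> \<Otimes>\<^sub>M S) (Pair a))) \<le> ennreal 1" by auto
  qed (use f in auto)
  also have "\<dots> = (\<integral>a. \<integral>y. f (a, y) \<partial>\<kappa> a \<partial>\<nu>)"
  proof (rule Bochner_Integration.integral_cong[OF refl])
    fix a assume a: "a \<in> space \<nu>"
    note [measurable_cong] = kernelD(2)[OF \<kappa> a]
    show "(\<integral>z. f z \<partial>distr (\<kappa> a) (\<nu> \<Otimes>\<^sub>M S) (Pair a)) = (\<integral>y. f (a, y) \<partial>\<kappa> a)"
      using a f(1) by (intro integral_distr) simp_all
  qed
  finally show ?thesis .
qed

lemma distr_kernel_joint: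
  assumes "prob_space \<nu>" and \<kappa>: "\<kappa> \<in> \<nu> \<rightarrow>\<^sub>M prob_algebra S" and f: "f \<in> \<nu> \<Otimes>\<^sub>M S \<rightarrow>\<^sub>M R"
  shows "distr (kernel_joint \<nu> S \<kappa>) R f = Giry_Monad.bind \<nu> (\<lambda>a. distr (\<kappa> a) R (\<lambda>y. f (a, y)))"
proof -
  interpret prob_space \<nu> by fact
  have "distr (kernel_joint \<nu> S \<kappa>) R f = Giry_Monad.bind \<nu> (\<lambda>a. distr (distr (\<kappa> a) (\<nu> \<Otimes>\<^sub>M S) (Pair a)) R f)"
    unfolding kernel_joint_def
    by (rule distr_bind[OF measurable_prob_algebraD[OF kernel_pair_measurable[OF \<kappa>]] not_empty f])
  also have "\<dots> = Giry_Monad.bind \<nu> (\<lambda>a. distr (\<kappa> a) R (\<lambda>y. f (a, y)))"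
  proof (rule bind_cong[OF refl])
    fix a assume a: "a \<in> space \<nu>"
    note [measurable_cong] = kernelD(2)[OF \<kappa> a]
    have "Pair a \<in> \<kappa> a \<rightarrow>\<^sub>M \<nu> \<Otimes>\<^sub>M S" using a by measurable
    then show "distr (distr (\<kappa> a) (\<nu> \<Otimes>\<^sub>M S) (Pair a)) R f = distr (\<kappa> a) R (\<lambda>y. f (a, y))"
      using f by (simp add: distr_distr comp_def)
  qed
  finally show ?thesis .
qed

section \<open>Lower semicontinuous functions and their Lipschitz minorants\<close>

lemma lsc_nhds:
  assumes "lower_semicontinuous f" "c < f x"
  shows "eventually (\<lambda>z. c < f z) (nhds x)"
  using assms unfolding lower_semicontinuous_def by (auto simp: eventually_nhds_conv_at)

lemma lsc_iff_liminf:
  fixes f :: "'x::metric_space \<Rightarrow> real"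
  shows "lower_semicontinuous f \<longleftrightarrow>
    (\<forall>xs x. xs \<longlonglongrightarrow> x \<longrightarrow> ereal (f x) \<le> liminf (\<lambda>n. ereal (f (xs n))))" (is "?L \<longleftrightarrow> ?R")
proof
  assume L: ?L
  show ?R
  proof (intro allI impI)
    fix xs :: "nat \<Rightarrow> 'x" and x assume xs: "xs \<longlonglongrightarrow> x"
    show "ereal (f x) \<le> liminf (\<lambda>n. ereal (f (xs n)))"
      unfolding le_Liminf_iff
    proof (intro allI impI)
      fix y assume y: "y < ereal (f x)"
      show "eventually (\<lambda>n. y < ereal (f (xs n))) sequentially"
      proof (cases y)
        case (real r)
        then have "eventually (\<lambda>z. r < f z) (nhds x)" using lsc_nhds[OF L] y by simp
        then show ?thesis using xs real unfolding filterlim_iff by auto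
      qed (use y in auto)
    qed
  qed
next
  assume R: ?R
  show ?L unfolding lower_semicontinuous_def
  proof (intro allI impI, rule sequentially_imp_eventually_at, intro allI impI)
    fix x c and zs :: "nat \<Rightarrow> 'x" assume c: "c < f x" and zs: "(\<forall>n. zs n \<noteq> x) \<and> zs \<longlonglongrightarrow> x"
    have "ereal c < ereal (f x)" using c by simp
    also have "\<dots> \<le> liminf (\<lambda>n. ereal (f (zs n)))" using R zs by blast
    finally have "ereal c < liminf (\<lambda>n. ereal (f (zs n)))" .
    from less_LiminfD[OF this] show "eventually (\<lambda>n. c < f (zs n)) sequentially" by simp
  qed
qed

lemma lsc_measurable:
  fixes f :: "'x::metric_space \<Rightarrow> real"
  assumes "lower_semicontinuous f" shows "f \<in> borel_measurable borel"
proof -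
  have "(\<lambda>x. ereal (f x)) \<in> borel_measurable borel"
    by (rule seq_lsc_measurable) (use assms lsc_iff_liminf in blast)
  then show ?thesis by simp
qed

lemma lsc_uniform_limit:
  assumes lsc: "\<And>n. lower_semicontinuous (f n)"
    and lim: "\<And>e. e > 0 \<Longrightarrow> \<exists>n. \<forall>x. \<bar>f n x - g x\<bar> < e"
  shows "lower_semicontinuous g"
  unfolding lower_semicontinuous_def
proof (intro allI impI)
  fix x c assume "c < g x"
  then have "(g x - c) / 2 > 0" by simp
  from lim[OF this] obtain n where n: "\<And>z. \<bar>f n z - g z\<bar> < (g x - c) / 2" by blast
  have "c + (g x - c) / 2 < f n x" using n[of x] by (simp add: field_simps abs_if split: if_splits)
  then have "eventually (\<lambda>z. c + (g x - c) / 2 < f n z) (at x)"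
    using lsc unfolding lower_semicontinuous_def by blast
  then show "eventually (\<lambda>z. c < g z) (at x)"
  proof eventually_elim
    case (elim z) then show ?case using n[of z] by linarith
  qed
qed

text \<open>
  The Pasch-Hausdorff envelope, which is the largest \<open>k\<close>-Lipschitz minorant of \<open>h\<close>.
\<close>

definition lip_below :: "('m::metric_space \<Rightarrow> real) \<Rightarrow> nat \<Rightarrow> 'm \<Rightarrow> real" where
  "lip_below h k z = (INF w. h w + real k * dist z w)"

context
  fixes h :: "'m::metric_space \<Rightarrow> real" and c :: real
  assumes bnd: "\<And>z. \<bar>h z\<bar> \<le> c"
begin

lemma lip_below_bdd: "bdd_below (range (\<lambda>w. h w + real k * dist z w))"
proof (rule bdd_belowI2)
  fix w show "- c \<le> h w + real k * dist z w"
    using bnd[of w] by (smt (verit) mult_nonneg_nonneg of_nat_0_le_iff zero_le_dist)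
qed

lemma lip_below_le: "lip_below h k z \<le> h z"
  unfolding lip_below_def using cINF_lower[OF lip_below_bdd[of k z], of z] by simp

lemma lip_below_ge: "- c \<le> lip_below h k z"
  unfolding lip_below_def
proof (rule cINF_greatest)
  fix w show "- c \<le> h w + real k * dist z w"
    using bnd[of w] by (smt (verit) mult_nonneg_nonneg of_nat_0_le_iff zero_le_dist)
qed simp

lemma lip_below_bound: "\<bar>lip_below h k z\<bar> \<le> c"
  using lip_below_le[of k z] lip_below_ge[of k z] bnd[of z] by linarith

lemma lip_below_lipschitz: "lip_below h k z \<le> lip_below h k z' + real k * dist z z'"
proof -
  have "lip_below h k z - real k * dist z z' \<le> lip_below h k z'"
    unfolding lip_below_def[of h k z']
  proof (rule cINF_greatest)
    fix w
    have "lip_below h k z \<le> h w + real k * dist z w"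
      unfolding lip_below_def by (rule cINF_lower[OF lip_below_bdd]) simp
    also have "real k * dist z w \<le> real k * (dist z z' + dist z' w)"
      by (intro mult_left_mono dist_triangle) simp
    finally show "lip_below h k z - real k * dist z z' \<le> h w + real k * dist z' w"
      by (simp add: algebra_simps)
  qed simp
  then show ?thesis by simp
qed

lemma lip_below_uniformly_continuous: "uniformly_continuous_on UNIV (lip_below h k)"
  unfolding uniformly_continuous_on_def
proof (intro allI impI)
  fix e :: real assume e: "e > 0"
  show "\<exists>d>0. \<forall>x\<in>UNIV. \<forall>x'\<in>UNIV. dist x' x < d \<longrightarrow> dist (lip_below h k x') (lip_below h k x) < e"
  proof (intro exI[of _ "e / (real k + 1)"] conjI ballI impI)
    fix x x' :: 'm assume d: "dist x' x < e / (real k + 1)"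
    have "dist (lip_below h k x') (lip_below h k x) \<le> real k * dist x' x"
      using lip_below_lipschitz[of k x x'] lip_below_lipschitz[of k x' x]
      by (simp add: dist_real_def dist_commute abs_le_iff)
    also have "\<dots> \<le> (real k + 1) * dist x' x" by (simp add: distrib_right)
    also have "\<dots> < e" using d by (simp add: field_simps)
    finally show "dist (lip_below h k x') (lip_below h k x) < e" .
  qed (use e in simp)
qed

text \<open>
  Near \<open>z\<close> the function \<open>h\<close> is at least \<open>h z - e/2\<close>. Away from
  \<open>z\<close> the penalty \<open>k * dist z w\<close> outweighs, for large \<open>k\<close>, the oscillation of
  \<open>h\<close>, which is at most \<open>2 * c\<close>.
\<close>

lemma lip_below_tendsto:
  assumes lsc: "lower_semicontinuous h"
  shows "(\<lambda>k. lip_below h k z) \<longlonglongrightarrow> h z"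
proof (rule LIMSEQ_I)
  fix e :: real assume e: "0 < e"
  have "eventually (\<lambda>w. h z - e/2 < h w) (nhds z)" by (rule lsc_nhds[OF lsc]) (use e in simp)
  then obtain \<delta> where \<delta>: "\<delta> > 0" "\<And>w. dist w z < \<delta> \<Longrightarrow> h z - e/2 < h w"
    unfolding eventually_nhds_metric by blast
  obtain N :: nat where N: "2 * c / \<delta> < real N" using reals_Archimedean2 by blast
  have "norm (lip_below h k z - h z) < e" if "k \<ge> N" for k
  proof -
    have "h z - e/2 \<le> lip_below h k z" unfolding lip_below_def
    proof (rule cINF_greatest)
      fix w
      show "h z - e/2 \<le> h w + real k * dist z w"
      proof (cases "dist w z < \<delta>")
        case True
        then show ?thesis using \<delta>(2)[OF True] by (smt (verit) mult_nonneg_nonneg of_nat_0_le_iff zero_le_dist)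
      next
        case False
        have "2 * c < real N * \<delta>" using N \<delta>(1) by (simp add: field_simps)
        also have "\<dots> \<le> real k * dist z w"
          using that False \<delta>(1) by (intro mult_mono) (auto simp: dist_commute)
        finally show ?thesis using bnd[of z] bnd[of w] e by linarith
      qed
    qed simp
    then show ?thesis using lip_below_le[of k z] e by simp
  qed
  then show "\<exists>N. \<forall>k\<ge>N. norm (lip_below h k z - h z) < e" by blast
qed

end

section \<open>Lower semicontinuity of the one-stage risk\<close>

lemma sets_pair_borel:
  fixes \<nu> :: "'a::second_countable_topology measure"
  assumes "sets \<nu> = sets borel"
  shows "sets (\<nu> \<Otimes>\<^sub>M (borel :: 'b::second_countable_topology measure)) = sets borel"
  unfolding borel_prod[symmetric] by (rule sets_pair_measure_cong) (simp_all add: assms)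

locale lsc_mdp = risk_averse_mdp M F G \<sigma>0 \<sigma> \<A> P \<xi> C \<Psi> Xp Ap
  for M :: "'w measure"
    and F G :: "nat \<Rightarrow> 'w measure"
    and \<sigma>0 :: "real measure \<Rightarrow> ereal"
    and \<sigma> :: "nat \<Rightarrow> 'x::polish_space \<Rightarrow> real measure \<Rightarrow> ereal"
    and \<A> :: "nat \<Rightarrow> 'x \<Rightarrow> 'a::polish_space set"
    and P :: "nat \<Rightarrow> 'x \<Rightarrow> 'a \<Rightarrow> 'x measure"
    and \<xi> :: "'x measure"
    and C :: "nat \<Rightarrow> 'x \<Rightarrow> 'a \<Rightarrow> 'x \<Rightarrow> real"
    and \<Psi> :: "((nat \<Rightarrow> 'w \<Rightarrow> 'x) \<times> (nat \<Rightarrow> 'w \<Rightarrow> 'a)) set"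
    and Xp :: "(nat \<Rightarrow> 'x \<Rightarrow> 'a measure) \<Rightarrow> nat \<Rightarrow> 'w \<Rightarrow> 'x"
    and Ap :: "(nat \<Rightarrow> 'x \<Rightarrow> 'a measure) \<Rightarrow> nat \<Rightarrow> 'w \<Rightarrow> 'a" +
  fixes \<gamma> b :: real
  assumes gamma: "0 \<le> \<gamma>" "\<gamma> < 1"
    and normalized: "\<And>t x. t \<ge> 1 \<Longrightarrow> \<sigma> t x (return borel 0) = 0"
    and weakly_continuous:
      "\<And>t f xs x as a. t \<ge> 1 \<Longrightarrow> continuous_on UNIV f \<Longrightarrow> bounded (range f) \<Longrightarrow>
         xs \<longlonglongrightarrow> x \<Longrightarrow> as \<longlonglongrightarrow> a \<Longrightarrow>
         (\<lambda>n. \<integral>y. f y \<partial>(P t (xs n) (as n))) \<longlonglongrightarrow> ((\<integral>y. f y \<partial>(P t x a)) :: real)"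
    and actions_compact: "\<And>t. t \<ge> 1 \<Longrightarrow> compact (\<Union>x. \<A> t x)"
    and actions_uhc:
      "\<And>t x U. t \<ge> 1 \<Longrightarrow> open U \<Longrightarrow> \<A> t x \<subseteq> U \<Longrightarrow>
         \<exists>V. open V \<and> x \<in> V \<and> (\<forall>z\<in>V. \<A> t z \<subseteq> U)"
    and sigma_lsc:
      "\<And>t K \<mu>s \<mu> xs x. t \<ge> 1 \<Longrightarrow> compact K \<Longrightarrow> (\<And>n. \<mu>s n \<in> prob_on K) \<Longrightarrow> \<mu> \<in> prob_on K \<Longrightarrow>
         limitin weak_topology \<mu>s \<mu> sequentially \<Longrightarrow> xs \<longlonglongrightarrow> x \<Longrightarrow>
         liminf (\<lambda>n. \<sigma> t (xs n) (\<mu>s n)) \<ge> \<sigma> t x \<mu>"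
    and C_lsc: "\<And>t. t \<ge> 1 \<Longrightarrow> lower_semicontinuous (\<lambda>(x, a, y). C t x a y)"
    and b_pos: "b > 0"
    and C_bound: "\<And>t x a y. t \<ge> 1 \<Longrightarrow> \<bar>C t x a y\<bar> \<le> b"
begin

abbreviation "cost v t x \<nu> \<equiv> cost_law \<gamma> P C v t x \<nu>"
abbreviation "Gop t \<nu> v x \<equiv> G_op \<gamma> \<sigma> P C t \<nu> v x"

text \<open>
  The cost of one stage from state \<open>x\<close>, continued with \<open>v\<close>, as a function of the action
  and the next state. The law \<open>cost_law\<close> is its distribution under a joint law that does not depend on
  \<open>v\<close>, which makes the costs for different \<open>v\<close> available on one probability space.
\<close>

definition stage :: "('x \<Rightarrow> real) \<Rightarrow> nat \<Rightarrow> 'x \<Rightarrow> 'a \<times> 'x \<Rightarrow> real" where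
  "stage v t x z = C t x (fst z) (snd z) + \<gamma> * v (snd z)"

lemma P_section_kernel: "t \<ge> 1 \<Longrightarrow> P t x \<in> borel \<rightarrow>\<^sub>M prob_algebra borel"
  using measurable_compose[OF measurable_Pair1'[of x borel borel] P_kernel[of t, folded borel_prod]]
  by (simp add: comp_def)

lemma joint_law:
  assumes "t \<ge> 1" "\<nu> \<in> laws"
  shows "prob_space (kernel_joint \<nu> borel (P t x))"
    "sets (kernel_joint \<nu> borel (P t x)) = sets borel"
    "P t x \<in> \<nu> \<rightarrow>\<^sub>M prob_algebra borel"
proof -
  note \<nu> = space_prob_borelD[OF assms(2)]
  show P: "P t x \<in> \<nu> \<rightarrow>\<^sub>M prob_algebra borel"
    using P_section_kernel[OF assms(1)] by (simp cong: measurable_cong_sets add: \<nu>(2))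
  show "prob_space (kernel_joint \<nu> borel (P t x))" by (rule kernel_joint_prob[OF \<nu>(1) P])
  show "sets (kernel_joint \<nu> borel (P t x)) = sets borel"
    using kernel_joint_prob(2)[OF \<nu>(1) P] sets_pair_borel[OF \<nu>(2)] by (rule trans)
qed

lemma C_measurable': "t \<ge> 1 \<Longrightarrow> (\<lambda>z. C t (fst z) (fst (snd z)) (snd (snd z))) \<in> borel_measurable borel"
  using C_measurable[of t] by (simp add: case_prod_beta')

lemma stage_jointly_measurable:
  assumes t: "t \<ge> 1" and v: "v \<in> borel_measurable borel"
  shows "(\<lambda>w. stage v t (fst (fst w)) (snd (fst w), snd w)) \<in> borel_measurable ((borel \<Otimes>\<^sub>M borel) \<Otimes>\<^sub>M borel)"
proof -
  have [measurable]: "(\<lambda>z. C t (fst z) (fst (snd z)) (snd (snd z))) \<in> borel_measurable (borel \<Otimes>\<^sub>M (borel \<Otimes>\<^sub>M borel))"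
    using C_measurable'[OF t] by (simp add: borel_prod)
  have [measurable]: "v \<in> borel_measurable borel" by fact
  have "(\<lambda>w. (fst (fst w), (snd (fst w), snd w))) \<in> (borel \<Otimes>\<^sub>M borel) \<Otimes>\<^sub>M borel \<rightarrow>\<^sub>M borel \<Otimes>\<^sub>M (borel \<Otimes>\<^sub>M borel)"
    by measurable
  from measurable_compose[OF this, of "\<lambda>z. C t (fst z) (fst (snd z)) (snd (snd z))" borel]
  have [measurable]: "(\<lambda>w. C t (fst (fst w)) (snd (fst w)) (snd w)) \<in> borel_measurable ((borel \<Otimes>\<^sub>M borel) \<Otimes>\<^sub>M borel)"
    by simp
  show ?thesis unfolding stage_def fst_conv snd_conv by measurable
qed

lemma stage_measurable:
  assumes "t \<ge> 1" "v \<in> borel_measurable borel"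
  shows "stage v t x \<in> borel_measurable borel"
proof -
  have "(\<lambda>z. ((x, fst z), snd z)) \<in> borel \<Otimes>\<^sub>M borel \<rightarrow>\<^sub>M (borel \<Otimes>\<^sub>M borel) \<Otimes>\<^sub>M borel" by measurable
  from measurable_compose[OF this stage_jointly_measurable[OF assms]] show ?thesis by (simp add: borel_prod)
qed

lemma stage_bound:
  assumes "t \<ge> 1" "\<And>y. \<bar>v y\<bar> \<le> c"
  shows "\<bar>stage v t x z\<bar> \<le> b + \<gamma> * c"
proof -
  have "\<bar>\<gamma> * v (snd z)\<bar> \<le> \<gamma> * c" using assms(2) gamma by (simp add: abs_mult mult_left_mono)
  then show ?thesis unfolding stage_def using C_bound[OF assms(1), of x "fst z" "snd z"] by linarith
qed

lemma cost_law_eq: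
  assumes "t \<ge> 1" "\<nu> \<in> laws" "v \<in> borel_measurable borel"
  shows "cost v t x \<nu> = distr (kernel_joint \<nu> borel (P t x)) borel (stage v t x)"
proof -
  note \<nu> = space_prob_borelD[OF assms(2)]
  have "stage v t x \<in> borel_measurable (\<nu> \<Otimes>\<^sub>M borel)"
    using stage_measurable[OF assms(1,3)] measurable_cong_sets[OF sets_pair_borel[OF \<nu>(2)] refl]
    by blast
  then show ?thesis
    by (simp add: distr_kernel_joint[OF \<nu>(1) joint_law(3)[OF assms(1,2)]] cost_law_def stage_def)
qed

lemma cost_law_prob_on:
  assumes "t \<ge> 1" "\<nu> \<in> laws" "v \<in> borel_measurable borel" "\<And>y. \<bar>v y\<bar> \<le> c"
  shows "cost v t x \<nu> \<in> prob_on {-(b + \<gamma> * c)..b + \<gamma> * c}"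
  unfolding cost_law_eq[OF assms(1-3)]
proof (rule distr_prob_on[OF joint_law(1)[OF assms(1,2)]])
  show "stage v t x \<in> borel_measurable (kernel_joint \<nu> borel (P t x))"
    using stage_measurable[OF assms(1,3)] joint_law(2)[OF assms(1,2)] by (simp cong: measurable_cong_sets)
  show "AE z in kernel_joint \<nu> borel (P t x). stage v t x z \<in> {-(b + \<gamma> * c)..b + \<gamma> * c}"
  proof (rule AE_I2)
    fix z show "stage v t x z \<in> {-(b + \<gamma> * c)..b + \<gamma> * c}"
      using stage_bound[of t v c x z, OF assms(1,4)] unfolding atLeastAtMost_iff by linarith
  qed
qed simp

text \<open>
  The common joint law of action and next state couples the two cost laws.
\<close>

lemma Gop_mono:
  assumes t: "t \<ge> 1" and \<nu>: "\<nu> \<in> laws"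
    and v: "v \<in> borel_measurable borel" "\<And>y. \<bar>v y\<bar> \<le> c"
    and w: "w \<in> borel_measurable borel" "\<And>y. \<bar>w y\<bar> \<le> c'"
    and le: "\<And>y. v y \<le> w y + e"
  shows "Gop t \<nu> v x \<le> Gop t \<nu> w x + ereal (\<gamma> * e)"
  unfolding G_op_def cost_law_eq[OF t \<nu> v(1)] cost_law_eq[OF t \<nu> w(1)]
proof (rule risk_coupling[OF risk_\<sigma>[OF t] joint_law(1)[OF t \<nu>]])
  note [measurable_cong] = joint_law(2)[OF t \<nu>]
  show "stage v t x \<in> borel_measurable (kernel_joint \<nu> borel (P t x))"
    "stage w t x \<in> borel_measurable (kernel_joint \<nu> borel (P t x))"
    using stage_measurable[OF t v(1)] stage_measurable[OF t w(1)] by measurable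
  show "AE z in kernel_joint \<nu> borel (P t x). \<bar>stage v t x z\<bar> \<le> b + \<gamma> * c"
    "AE z in kernel_joint \<nu> borel (P t x). \<bar>stage w t x z\<bar> \<le> b + \<gamma> * c'"
    using stage_bound[OF t v(2)] stage_bound[OF t w(2)] by auto
  have "\<gamma> * v y \<le> \<gamma> * w y + \<gamma> * e" for y
    using mult_left_mono[OF le gamma(1), of y] by (simp add: distrib_left)
  then show "AE z in kernel_joint \<nu> borel (P t x). stage v t x z \<le> stage w t x z + \<gamma> * e"
    by (auto simp: stage_def add.assoc)
qed

lemma Gop_bound:
  assumes "t \<ge> 1" "\<nu> \<in> laws" "v \<in> borel_measurable borel" "\<And>y. \<bar>v y\<bar> \<le> c"
  shows "\<bar>Gop t \<nu> v x\<bar> \<le> ereal (b + \<gamma> * c)"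
proof -
  note r = risk_bound[OF risk_\<sigma>[OF assms(1)] cost_law_prob_on[OF assms], of x x, unfolded normalized[OF assms(1)]]
  show ?thesis unfolding G_op_def
    using r by (cases "\<sigma> t x (cost v t x \<nu>)") auto
qed

text \<open>
  Weak continuity of the kernel concerns a fixed integrand. Uniform continuity of \<open>u\<close> allows it to move
  with the parameters.
\<close>

lemma kernel_integral_continuous:
  fixes u :: "'x \<times> 'a \<times> 'x \<Rightarrow> real"
  assumes t: "t \<ge> 1" and u: "uniformly_continuous_on UNIV u" "\<And>z. \<bar>u z\<bar> \<le> c"
  shows "continuous_on UNIV (\<lambda>(x, a). \<integral>y. u (x, a, y) \<partial>P t x a)"
  unfolding continuous_on_sequentially
proof (intro ballI allI impI)
  fix zs :: "nat \<Rightarrow> 'x \<times> 'a" and z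
  assume zs: "(\<forall>n. zs n \<in> UNIV) \<and> zs \<longlonglongrightarrow> z"
  define x where "x = fst z" define a where "a = snd z"
  define xs where "xs n = fst (zs n)" for n define as where "as n = snd (zs n)" for n
  have xs: "xs \<longlonglongrightarrow> x" and as: "as \<longlonglongrightarrow> a"
    using zs unfolding x_def a_def xs_def as_def by (auto intro: tendsto_fst tendsto_snd)
  have cu: "continuous_on UNIV u" using u(1) by (rule uniformly_continuous_imp_continuous)
  have cy: "continuous_on UNIV (\<lambda>y. u (x', a', y))" for x' a'
    by (rule continuous_on_compose2[OF cu]) (auto intro!: continuous_intros)
  have Pp: "P t x' a' \<in> laws" for x' a'
    using measurable_space[OF P_section_kernel[OF t], of a' x'] by simp
  have my: "(\<lambda>y. u (x', a', y)) \<in> borel_measurable borel" for x' a'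
    by (rule borel_measurable_continuous_onI[OF cy])
  have int: "integrable (P t x' a') (\<lambda>y. u (x'', a'', y))" for x' a' x'' a''
    by (rule integrable_bounded_prob[OF Pp my]) (rule u(2))
  have 1: "(\<lambda>n. \<integral>y. u (x, a, y) \<partial>P t (xs n) (as n)) \<longlonglongrightarrow> (\<integral>y. u (x, a, y) \<partial>P t x a)"
    by (rule weakly_continuous[OF t cy _ xs as]) (use u(2) in \<open>auto simp: bounded_iff\<close>)
  have "(\<lambda>n. \<integral>y. u (xs n, as n, y) \<partial>P t (xs n) (as n)) \<longlonglongrightarrow> (\<integral>y. u (x, a, y) \<partial>P t x a)"
  proof (rule integral_tendsto_uniformly_close[OF Pp int int _ 1])
    fix e :: real assume e: "0 < e"
    then obtain d where d: "d > 0" "\<And>z z'. dist z' z < d \<Longrightarrow> dist (u z') (u z) < e"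
      using u(1) unfolding uniformly_continuous_on_def by (metis UNIV_I)
    show "eventually (\<lambda>n. AE y in P t (xs n) (as n). \<bar>u (xs n, as n, y) - u (x, a, y)\<bar> \<le> e) sequentially"
      using tendstoD[OF tendsto_Pair[OF xs as] d(1)]
    proof eventually_elim
      case (elim n)
      show ?case
      proof (rule AE_I2)
        fix y :: 'x
        have "dist (xs n, as n, y) (x, a, y) < d" using elim by (simp add: dist_Pair_Pair)
        then show "\<bar>u (xs n, as n, y) - u (x, a, y)\<bar> \<le> e"
          using d(2)[of "(xs n, as n, y)" "(x, a, y)"] by (simp add: dist_real_def)
      qed
    qed
  qed
  then show "((\<lambda>(x, a). \<integral>y. u (x, a, y) \<partial>P t x a) \<circ> zs) \<longlonglongrightarrow> (\<lambda>(x, a). \<integral>y. u (x, a, y) \<partial>P t x a) z"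
    by (simp add: comp_def case_prod_beta' xs_def as_def x_def a_def)
qed

text \<open>
  Integrating out the next state leaves a continuous function of state and action, and its sections over the compact
  set \<open>K\<close> converge uniformly as the state converges.
\<close>

lemma joint_integral_tendsto:
  fixes u :: "'x \<times> 'a \<times> 'x \<Rightarrow> real"
  assumes t: "t \<ge> 1" and u: "uniformly_continuous_on UNIV u" "\<And>z. \<bar>u z\<bar> \<le> c"
    and K: "compact K" and \<nu>s: "\<And>n. \<nu>s n \<in> prob_on K" and lim: "limitin weak_topology \<nu>s \<nu> sequentially"
    and xs: "xs \<longlonglongrightarrow> x"
  shows "(\<lambda>n. \<integral>z. u (xs n, z) \<partial>kernel_joint (\<nu>s n) borel (P t (xs n)))
      \<longlonglongrightarrow> (\<integral>z. u (x, z) \<partial>kernel_joint \<nu> borel (P t x))"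
proof -
  define F where "F x a = (\<integral>y. u (x, a, y) \<partial>P t x a)" for x a
  have c0: "0 \<le> c" using u(2)[of undefined] by linarith
  have \<nu>: "\<nu> \<in> laws" using limitin_topspace[OF lim] by simp
  have \<nu>s': "\<nu>s n \<in> laws" for n using \<nu>s by (rule prob_onD)
  have cF: "continuous_on UNIV (\<lambda>z. F (fst z) (snd z))"
    using kernel_integral_continuous[OF t u] by (simp add: F_def case_prod_beta')
  have cFx: "continuous_on UNIV (F x')" for x'
    using continuous_on_compose2[OF cF continuous_on_Pair[OF continuous_on_const continuous_on_id], of x' UNIV]
    by simp
  have cu: "continuous_on UNIV u" using u(1) by (rule uniformly_continuous_imp_continuous)
  have eq: "(\<integral>z. u (x', z) \<partial>kernel_joint \<mu> borel (P t x')) = (\<integral>a. F x' a \<partial>\<mu>)"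
    if "\<mu> \<in> laws" for \<mu> x'
  proof -
    have "(\<lambda>z. u (x', z)) \<in> borel_measurable borel"
      by (rule borel_measurable_continuous_onI, rule continuous_on_compose2[OF cu])
         (auto intro!: continuous_intros)
    then have m: "(\<lambda>z. u (x', z)) \<in> borel_measurable (\<mu> \<Otimes>\<^sub>M borel)"
      using measurable_cong_sets[OF sets_pair_borel[OF space_prob_borelD(2)[OF that]] refl] by blast
    show ?thesis unfolding F_def
      using integral_kernel_joint[OF space_prob_borelD(1)[OF that] joint_law(3)[OF t that] m u(2)] .
  qed
  have F_bound: "\<bar>F x' a\<bar> \<le> c" for x' a
  proof -
    have Pp: "P t x' a \<in> laws"
      using measurable_space[OF P_section_kernel[OF t], of a x'] by simp
    interpret prob_space "P t x' a" using space_prob_borelD(1)[OF Pp] .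
    have "\<bar>F x' a\<bar> \<le> (\<integral>y. \<bar>u (x', a, y)\<bar> \<partial>P t x' a)" unfolding F_def by (rule integral_abs_bound)
    also have "\<dots> \<le> c"
    proof (rule integral_le_const)
      have "(\<lambda>y. u (x', a, y)) \<in> borel_measurable borel"
        by (rule borel_measurable_continuous_onI, rule continuous_on_compose2[OF cu])
           (auto intro!: continuous_intros)
      then show "integrable (P t x' a) (\<lambda>y. \<bar>u (x', a, y)\<bar>)"
        by (intro integrable_abs integrable_bounded_prob[OF Pp _ u(2)])
    qed (use u(2) in auto)
    finally show ?thesis .
  qed
  have intF: "integrable \<mu> (F x')" if "\<mu> \<in> laws" for \<mu> x'
    by (rule integrable_bounded_prob[OF that borel_measurable_continuous_onI[OF cFx] F_bound])
  have 1: "(\<lambda>n. \<integral>a. F x a \<partial>\<nu>s n) \<longlonglongrightarrow> (\<integral>a. F x a \<partial>\<nu>)"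
    by (rule limitin_weak_topologyD[OF lim cFx]) (use F_bound in \<open>auto simp: bounded_iff\<close>)
  show ?thesis
    unfolding eq[OF \<nu>s'] eq[OF \<nu>]
  proof (rule integral_tendsto_uniformly_close[OF \<nu>s' intF[OF \<nu>s'] intF[OF \<nu>s'] _ 1])
    fix e :: real assume e: "0 < e"
    obtain X0 where X0: "x \<in> X0" "open X0"
      "\<forall>x'\<in>X0 \<inter> UNIV. \<forall>a\<in>K. dist (F (fst (x', a)) (snd (x', a))) (F (fst (x, a)) (snd (x, a))) \<le> e"
      by (rule continuous_on_prod_compactE[OF continuous_on_subset[OF cF subset_UNIV] K UNIV_I,
            where e=e and ?x0.0=x]) (use e in auto)
    show "eventually (\<lambda>n. AE a in \<nu>s n. \<bar>F (xs n) a - F x a\<bar> \<le> e) sequentially"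
      using topological_tendstoD[OF xs X0(2,1)]
    proof eventually_elim
      case (elim n)
      have "AE a in \<nu>s n. a \<in> K"
        using \<nu>s[of n] prob_on_iff_AE[OF \<nu>s' borel_closed[OF compact_imp_closed[OF K]]] by simp
      then show ?case by eventually_elim (use X0(3) elim in \<open>auto simp: dist_real_def\<close>)
    qed
  qed
qed

definition bdd_lsc :: "real \<Rightarrow> ('x \<Rightarrow> real) \<Rightarrow> bool" where
  "bdd_lsc c v \<longleftrightarrow> lower_semicontinuous v \<and> (\<forall>x. \<bar>v x\<bar> \<le> c)"

lemma stage_lsc:
  assumes t: "t \<ge> 1" and v: "lower_semicontinuous v"
  shows "lower_semicontinuous (\<lambda>z. stage v t (fst z) (snd z))"
  unfolding lower_semicontinuous_def
proof (intro allI impI)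
  fix z :: "'x \<times> 'a \<times> 'x" and c
  assume "c < stage v t (fst z) (snd z)"
  then obtain e where e: "e > 0" "c + 2 * e < stage v t (fst z) (snd z)"
    by (intro that[of "(stage v t (fst z) (snd z) - c) / 4"]) (auto simp: field_simps)
  define Cz where "Cz = (\<lambda>z. C t (fst z) (fst (snd z)) (snd (snd z)))"
  have Cl: "lower_semicontinuous Cz"
    using C_lsc[OF t] by (simp add: case_prod_beta' Cz_def)
  have 1: "eventually (\<lambda>z'. Cz z - e < Cz z') (nhds z)"
    by (rule lsc_nhds[OF Cl]) (use e in simp)
  have "eventually (\<lambda>y. v (snd (snd z)) - e < v y) (nhds (snd (snd z)))"
    by (rule lsc_nhds[OF v]) (use e in simp)
  moreover have "filterlim (\<lambda>z'. snd (snd z')) (nhds (snd (snd z))) (nhds z)"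
    by (intro tendsto_snd filterlim_ident)
  ultimately have 2: "eventually (\<lambda>z'. v (snd (snd z)) - e < v (snd (snd z'))) (nhds z)"
    unfolding filterlim_iff by blast
  have "eventually (\<lambda>z'. c < stage v t (fst z') (snd z')) (nhds z)"
    using 1 2
  proof eventually_elim
    case (elim z')
    have "\<gamma> * (v (snd (snd z)) - e) \<le> \<gamma> * v (snd (snd z'))"
      using elim gamma by (intro mult_left_mono) auto
    moreover have "\<gamma> * e \<le> 1 * e" using gamma e by (intro mult_right_mono) auto
    ultimately show ?case using elim e unfolding stage_def Cz_def right_diff_distrib by linarith
  qed
  then show "eventually (\<lambda>z'. c < stage v t (fst z') (snd z')) (at z)"
    by (simp add: eventually_nhds_conv_at)
qed

text \<open>
  Two applications of the lower semicontinuity of \<open>\<sigma>\<close>. For a Lipschitz minorant of the stage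
  cost the laws converge along the sequence, and monotonicity replaces the minorant by the cost itself on the side
  of the limit inferior. As the minorants increase, their laws at the limit point converge to the cost law there.
\<close>

lemma Gop_lsc:
  assumes t: "t \<ge> 1" and v: "bdd_lsc c v"
    and K: "compact K" and \<nu>s: "\<And>n. \<nu>s n \<in> prob_on K" and lim: "limitin weak_topology \<nu>s \<nu> sequentially"
    and xs: "xs \<longlonglongrightarrow> x"
  shows "Gop t \<nu> v x \<le> liminf (\<lambda>n. Gop t (\<nu>s n) v (xs n))"
proof -
  define h where "h = (\<lambda>z. stage v t (fst z) (snd z))"
  define c' where "c' = b + \<gamma> * c"
  have v': "lower_semicontinuous v" "\<And>y. \<bar>v y\<bar> \<le> c" using v by (auto simp: bdd_lsc_def)
  have vm: "v \<in> borel_measurable borel" using lsc_measurable[OF v'(1)] .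
  have hb: "\<bar>h z\<bar> \<le> c'" for z unfolding h_def c'_def by (rule stage_bound[OF t v'(2)])
  have hl: "lower_semicontinuous h" unfolding h_def by (rule stage_lsc[OF t v'(1)])
  have \<nu>: "\<nu> \<in> laws" using limitin_topspace[OF lim] by simp
  have \<nu>s': "\<nu>s n \<in> laws" for n using \<nu>s by (rule prob_onD)
  define Q where "Q \<mu> x = kernel_joint \<mu> borel (P t x)" for \<mu> x
  define hk where "hk k x z = lip_below h k (x, z)" for k x z
  have ucl: "uniformly_continuous_on UNIV (lip_below h k)" for k
    by (rule lip_below_uniformly_continuous[OF hb])
  have hk_cont: "continuous_on UNIV (hk k x')" for k x'
    unfolding hk_def
    by (rule continuous_on_compose2[OF uniformly_continuous_imp_continuous[OF ucl]])
       (auto intro!: continuous_intros)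
  have hkm: "hk k x' \<in> borel_measurable (Q \<mu> x'')" if "\<mu> \<in> laws" for k x' x'' \<mu>
    using borel_measurable_continuous_onI[OF hk_cont] joint_law(2)[OF t that]
    by (simp add: Q_def cong: measurable_cong_sets)
  have hkb: "\<bar>hk k x' z\<bar> \<le> c'" for k x' z unfolding hk_def by (rule lip_below_bound[OF hb])
  have hkle: "hk k x' z \<le> stage v t x' z" for k x' z
    using lip_below_le[where h=h and z="(x', z)" and k=k, OF hb] by (simp add: hk_def h_def)
  have Qp: "prob_space (Q \<mu> x')" if "\<mu> \<in> laws" for \<mu> x'
    unfolding Q_def by (rule joint_law(1)[OF t that])
  have stm: "stage v t x' \<in> borel_measurable (Q \<mu> x'')" if "\<mu> \<in> laws" for x' x'' \<mu>
    using stage_measurable[OF t vm] joint_law(2)[OF t that]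
    by (simp add: Q_def cong: measurable_cong_sets)
  have mem: "distr (Q \<mu> x') borel (hk k x') \<in> prob_on {-c'..c'}" if "\<mu> \<in> laws" for k x' \<mu>
    using hkb by (intro distr_prob_on[OF Qp[OF that] hkm[OF that]]) (auto simp: abs_le_iff minus_le_iff)
  define L where "L = liminf (\<lambda>n. Gop t (\<nu>s n) v (xs n))"
  \<comment> \<open>First limit: the stage and the law converge while the Lipschitz minorant is fixed.\<close>
  have approx: "\<sigma> t x (distr (Q \<nu> x) borel (hk k x)) \<le> L" for k
  proof -
    have "limitin weak_topology (\<lambda>n. distr (Q (\<nu>s n) (xs n)) borel (hk k (xs n)))
        (distr (Q \<nu> x) borel (hk k x)) sequentially"
    proof (rule limitin_weak_topologyI)
      fix f :: "real \<Rightarrow> real" assume f: "continuous_on UNIV f" "bounded (range f)"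
      then obtain d where d: "\<And>r. \<bar>f r\<bar> \<le> d" by (auto simp: bounded_iff)
      have fm: "f \<in> borel_measurable borel" using borel_measurable_continuous_onI[OF f(1)] .
      have "uniformly_continuous_on {-c'..c'} f"
        by (intro compact_uniformly_continuous continuous_on_subset[OF f(1)]) auto
      moreover have "range (lip_below h k) \<subseteq> {-c'..c'}"
        using lip_below_bound[where h=h, OF hb] by (auto simp: abs_le_iff minus_le_iff)
      ultimately have "uniformly_continuous_on (range (lip_below h k)) f"
        unfolding uniformly_continuous_on_def by (meson subset_iff)
      from uniformly_continuous_on_compose[OF ucl this]
      have "uniformly_continuous_on UNIV (\<lambda>z. f (lip_below h k z))" by (simp add: comp_def)
      from joint_integral_tendsto[OF t this d K \<nu>s lim xs]
      show "(\<lambda>n. \<integral>r. f r \<partial>distr (Q (\<nu>s n) (xs n)) borel (hk k (xs n)))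
          \<longlonglongrightarrow> (\<integral>r. f r \<partial>distr (Q \<nu> x) borel (hk k x))"
        unfolding integral_distr[OF hkm[OF \<nu>s'] fm] integral_distr[OF hkm[OF \<nu>] fm] unfolding Q_def hk_def .
    qed (use prob_onD(1)[OF mem] \<nu> \<nu>s' in auto)
    from sigma_lsc[OF t _ mem[OF \<nu>s'] mem[OF \<nu>] this xs]
    have "\<sigma> t x (distr (Q \<nu> x) borel (hk k x)) \<le> liminf (\<lambda>n. \<sigma> t (xs n) (distr (Q (\<nu>s n) (xs n)) borel (hk k (xs n))))"
      by simp
    also have "\<dots> \<le> L" unfolding L_def
    proof (intro Liminf_mono always_eventually allI)
      fix n
      have "\<sigma> t (xs n) (distr (Q (\<nu>s n) (xs n)) borel (hk k (xs n)))
          \<le> \<sigma> t (xs n) (distr (Q (\<nu>s n) (xs n)) borel (stage v t (xs n))) + ereal 0"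
        by (rule risk_coupling[OF risk_\<sigma>[OF t] Qp[OF \<nu>s'] hkm[OF \<nu>s'] _ stm[OF \<nu>s'],
                where d=c' and d'=c'])
           (use hkb stage_bound[where v=v, OF t v'(2)] hkle in \<open>auto simp: c'_def\<close>)
      then show "\<sigma> t (xs n) (distr (Q (\<nu>s n) (xs n)) borel (hk k (xs n))) \<le> Gop t (\<nu>s n) v (xs n)"
        by (simp add: G_op_def cost_law_eq[OF t \<nu>s' vm] Q_def)
    qed
    finally show ?thesis .
  qed
  \<comment> \<open>Second limit: the minorants increase to the stage cost at the limit point.\<close>
  have "limitin weak_topology (\<lambda>k. distr (Q \<nu> x) borel (hk k x)) (cost v t x \<nu>) sequentially"
  proof (rule limitin_weak_topologyI)
    fix f :: "real \<Rightarrow> real" assume f: "continuous_on UNIV f" "bounded (range f)"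
    then obtain d where d: "\<And>r. \<bar>f r\<bar> \<le> d" by (auto simp: bounded_iff)
    have fm: "f \<in> borel_measurable borel" using borel_measurable_continuous_onI[OF f(1)] .
    interpret Q: prob_space "Q \<nu> x" by (rule Qp[OF \<nu>])
    have "(\<lambda>k. \<integral>z. f (hk k x z) \<partial>Q \<nu> x) \<longlonglongrightarrow> (\<integral>z. f (stage v t x z) \<partial>Q \<nu> x)"
    proof (rule integral_dominated_convergence[where w="\<lambda>_. d"])
      have "(\<lambda>k. hk k x z) \<longlonglongrightarrow> stage v t x z" for z
        using lip_below_tendsto[where h=h and z="(x, z)", OF hb hl] by (simp add: hk_def h_def)
      then show "AE z in Q \<nu> x. (\<lambda>k. f (hk k x z)) \<longlonglongrightarrow> f (stage v t x z)"
        by (intro AE_I2 continuous_on_tendsto_compose[OF f(1)]) auto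
    qed (use d measurable_compose[OF hkm[OF \<nu>] fm] measurable_compose[OF stm[OF \<nu>] fm] in auto)
    then show "(\<lambda>k. \<integral>r. f r \<partial>distr (Q \<nu> x) borel (hk k x)) \<longlonglongrightarrow> (\<integral>r. f r \<partial>cost v t x \<nu>)"
      unfolding cost_law_eq[OF t \<nu> vm] Q_def[symmetric] integral_distr[OF hkm[OF \<nu>] fm] integral_distr[OF stm[OF \<nu>] fm] .
  qed (use prob_onD(1)[OF mem[OF \<nu>]] prob_onD(1)[OF cost_law_prob_on[OF t \<nu> vm v'(2)]] in auto)
  from sigma_lsc[OF t _ mem[OF \<nu>] _ this tendsto_const]
  have "\<sigma> t x (cost v t x \<nu>) \<le> liminf (\<lambda>k. \<sigma> t x (distr (Q \<nu> x) borel (hk k x)))"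
    using cost_law_prob_on[OF t \<nu> vm v'(2)] by (simp add: c'_def)
  also have "\<dots> \<le> L" using approx by (rule liminf_le_const)
  finally show ?thesis unfolding L_def G_op_def .
qed

end

section \<open>Discounted backward induction\<close>

text \<open>
  The contraction argument for both \<open>S\<close> and \<open>H\<^sup>p\<close>. The class \<open>V\<close> of
  functions is a parameter because \<open>S\<close> maps bounded lower semicontinuous functions to such functions,
  and \<open>H\<^sup>p\<close> bounded measurable ones.
\<close>

locale backward_induction =
  fixes \<gamma> B :: real and V :: "('x \<Rightarrow> real) set"
    and Op :: "nat \<Rightarrow> ('x \<Rightarrow> real) \<Rightarrow> 'x \<Rightarrow> real" and J :: "nat \<Rightarrow> nat \<Rightarrow> 'x \<Rightarrow> real"
  assumes discount: "0 \<le> \<gamma>" "\<gamma> < 1"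
    and J_zero: "\<And>t T. T < t \<Longrightarrow> J t T = (\<lambda>_. 0)"
    and J_step: "\<And>t T. t \<le> T \<Longrightarrow> J t T = Op t (J (Suc t) T)"
    and V_bound: "\<And>v x. v \<in> V \<Longrightarrow> \<bar>v x\<bar> \<le> B"
    and V_zero: "(\<lambda>_. 0) \<in> V"
    and V_Op: "\<And>t v. t \<ge> 1 \<Longrightarrow> v \<in> V \<Longrightarrow> Op t v \<in> V"
    and V_lim: "\<And>f g. (\<And>n. f n \<in> V) \<Longrightarrow> (\<And>e. e > 0 \<Longrightarrow> \<exists>n::nat. \<forall>x. \<bar>f n x - g x\<bar> < e) \<Longrightarrow> g \<in> V"
    and Op_contract: "\<And>t v w e x. t \<ge> 1 \<Longrightarrow> v \<in> V \<Longrightarrow> w \<in> V \<Longrightarrow> (\<And>y. v y \<le> w y + e) \<Longrightarrow>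
       Op t v x \<le> Op t w x + \<gamma> * e"
begin

definition J_lim :: "nat \<Rightarrow> 'x \<Rightarrow> real" where "J_lim t x = lim (\<lambda>T. J t T x)"

lemma Op_contract_abs:
  assumes "t \<ge> 1" "v \<in> V" "w \<in> V" "\<And>y. \<bar>v y - w y\<bar> \<le> e"
  shows "\<bar>Op t v x - Op t w x\<bar> \<le> \<gamma> * e"
proof -
  have "v y \<le> w y + e" "w y \<le> v y + e" for y using assms(4)[of y] by linarith+
  then show ?thesis using Op_contract[OF assms(1-3), of e x] Op_contract[OF assms(1,3,2), of e x]
    by (simp add: abs_le_iff)
qed

lemma J_in_V: "t \<ge> 1 \<Longrightarrow> J t T \<in> V"
proof (induction "Suc T - t" arbitrary: t)
  case 0 then show ?case by (simp add: J_zero V_zero)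
next
  case (Suc k)
  then show ?case by (simp add: J_step V_Op)
qed

lemma B_nonneg: "0 \<le> B" using V_bound[OF V_zero] by simp

text \<open>
  The two horizons agree on the operators at times \<open>t, \<dots>, T\<close>, that is on \<open>Suc T - t\<close>
  contractions; before these, one function is \<open>0\<close> and the other is bounded by \<open>B\<close>.
\<close>

lemma J_cauchy:
  "t \<ge> 1 \<Longrightarrow> t \<le> Suc T \<Longrightarrow> T \<le> T' \<Longrightarrow> \<bar>J t T x - J t T' x\<bar> \<le> B * \<gamma> ^ (Suc T - t)"
proof (induction "Suc T - t" arbitrary: t x)
  case 0
  then show ?case using V_bound[OF J_in_V[OF 0(2)], of T' x] by (simp add: J_zero)
next
  case (Suc k)
  then have t: "t \<le> T" "t \<le> T'" by simp_all
  have IH: "\<bar>J (Suc t) T y - J (Suc t) T' y\<bar> \<le> B * \<gamma> ^ (Suc T - Suc t)" for y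
    using Suc t by (intro Suc(1)) auto
  have "\<bar>J t T x - J t T' x\<bar> \<le> \<gamma> * (B * \<gamma> ^ (Suc T - Suc t))"
    unfolding J_step[OF t(1)] J_step[OF t(2)] using Suc(3)
    by (intro Op_contract_abs J_in_V IH) auto
  also have "\<dots> = B * \<gamma> ^ Suc (Suc T - Suc t)" by simp
  also have "Suc (Suc T - Suc t) = Suc T - t" using t by simp
  finally show ?case .
qed

lemma discount_power_tendsto: "(\<lambda>T. B * \<gamma> ^ (Suc T - t)) \<longlonglongrightarrow> 0"
proof -
  have "(\<lambda>n. B * \<gamma> ^ n) \<longlonglongrightarrow> 0"
    using tendsto_mult_right_zero[OF LIMSEQ_realpow_zero[OF discount]] by simp
  moreover have "filterlim (\<lambda>T. Suc T - t) sequentially sequentially"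
    unfolding filterlim_at_top
  proof
    fix Z show "eventually (\<lambda>T. Z \<le> Suc T - t) sequentially"
      using eventually_ge_at_top[of "Z + t"] by eventually_elim simp
  qed
  ultimately show ?thesis by (rule filterlim_compose)
qed

lemma J_convergent:
  assumes t: "t \<ge> 1"
  shows "convergent (\<lambda>T. J t T x)"
proof (rule Cauchy_convergent, rule metric_CauchyI)
  fix e :: real assume "e > 0"
  then obtain N where N: "B * \<gamma> ^ (Suc N - t) < e" "N \<ge> t"
    using order_tendstoD(2)[OF discount_power_tendsto, of e t] eventually_ge_at_top[of t]
    by (metis (mono_tags, lifting) eventually_conj eventually_happens' sequentially_bot)
  have *: "dist (J t m x) (J t n x) < e" if "m \<ge> N" "m \<le> n" for m n
  proof -
    have "\<bar>J t m x - J t n x\<bar> \<le> B * \<gamma> ^ (Suc m - t)"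
      using that N(2) t by (intro J_cauchy) auto
    also have "\<dots> \<le> B * \<gamma> ^ (Suc N - t)"
      using that discount B_nonneg by (intro mult_left_mono power_decreasing) auto
    finally show ?thesis using N(1) by (simp add: dist_real_def)
  qed
  show "\<exists>M. \<forall>m\<ge>M. \<forall>n\<ge>M. dist (J t m x) (J t n x) < e"
    using * by (metis dist_commute linear)
qed

lemma J_lim_tendsto: "t \<ge> 1 \<Longrightarrow> (\<lambda>T. J t T x) \<longlonglongrightarrow> J_lim t x"
  unfolding J_lim_def using J_convergent by (simp add: convergent_LIMSEQ_iff)

lemma J_lim_close:
  assumes "t \<ge> 1" "t \<le> Suc T"
  shows "\<bar>J t T x - J_lim t x\<bar> \<le> B * \<gamma> ^ (Suc T - t)"
proof (rule LIMSEQ_le_const2)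
  show "(\<lambda>T'. \<bar>J t T x - J t T' x\<bar>) \<longlonglongrightarrow> \<bar>J t T x - J_lim t x\<bar>"
    by (intro tendsto_intros J_lim_tendsto assms)
  show "\<exists>N. \<forall>n\<ge>N. \<bar>J t T x - J t n x\<bar> \<le> B * \<gamma> ^ (Suc T - t)"
    using J_cauchy[OF assms] by blast
qed

lemma J_lim_uniform:
  assumes "t \<ge> 1" "e > 0"
  shows "\<exists>T. \<forall>x. \<bar>J t T x - J_lim t x\<bar> < e"
proof -
  obtain T where T: "B * \<gamma> ^ (Suc T - t) < e" "T \<ge> t"
    using order_tendstoD(2)[OF discount_power_tendsto assms(2), of t] eventually_ge_at_top[of t]
    by (metis (mono_tags, lifting) eventually_conj eventually_happens' sequentially_bot)
  have "\<bar>J t T x - J_lim t x\<bar> < e" for x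
    using J_lim_close[OF assms(1), of T x] T by linarith
  then show ?thesis by blast
qed

lemma J_lim_in_V: "t \<ge> 1 \<Longrightarrow> J_lim t \<in> V"
  by (rule V_lim[of "\<lambda>T. J t T"]) (auto intro: J_in_V J_lim_uniform)

lemma J_lim_fixed_point:
  assumes t: "t \<ge> 1"
  shows "J_lim t = Op t (J_lim (Suc t))"
proof
  fix x
  have "(\<lambda>T. J t T x) \<longlonglongrightarrow> Op t (J_lim (Suc t)) x"
  proof (rule LIM_zero_cancel, rule tendsto_rabs_zero_cancel, rule tendsto_sandwich[of "\<lambda>_. 0"])
    show "eventually (\<lambda>T. \<bar>J t T x - Op t (J_lim (Suc t)) x\<bar> \<le> \<gamma> * (B * \<gamma> ^ (Suc T - Suc t))) sequentially"
      using eventually_ge_at_top[of t]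
    proof eventually_elim
      case (elim T)
      then show ?case unfolding J_step[OF elim]
        using J_lim_close[of "Suc t" T] by (intro Op_contract_abs t J_in_V J_lim_in_V) auto
    qed
    show "(\<lambda>T. \<gamma> * (B * \<gamma> ^ (Suc T - Suc t))) \<longlonglongrightarrow> 0"
      by (rule tendsto_mult_right_zero[OF discount_power_tendsto])
  qed auto
  then show "J_lim t x = Op t (J_lim (Suc t)) x"
    using LIMSEQ_unique J_lim_tendsto[OF t] by blast
qed

end

text \<open>
  Iterating \<open>step\<close> improves the a priori bound \<open>D\<close> by a factor \<open>\<gamma>\<close>
  each time. The one-sided form compares a solution with a supersolution and, used twice, gives uniqueness.
\<close>

lemma discounted_comparison:
  fixes u w :: "nat \<Rightarrow> 'x \<Rightarrow> real"
  assumes discount: "0 \<le> \<gamma>" "\<gamma> < 1"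
    and step: "\<And>t e x. t \<ge> 1 \<Longrightarrow> (\<And>y. u (Suc t) y \<le> w (Suc t) y + e) \<Longrightarrow> u t x \<le> w t x + \<gamma> * e"
    and bound: "\<And>t x. t \<ge> 1 \<Longrightarrow> u t x \<le> w t x + D"
    and t: "t \<ge> 1"
  shows "u t x \<le> w t x"
proof -
  have "u t x \<le> w t x + \<gamma> ^ n * D" if "t \<ge> 1" for n t x
    using that
  proof (induction n arbitrary: t x)
    case 0 then show ?case by (simp add: bound)
  next
    case (Suc n)
    have "u t x \<le> w t x + \<gamma> * (\<gamma> ^ n * D)" by (rule step[OF Suc(2)]) (rule Suc(1), simp)
    then show ?case by (simp add: mult.assoc)
  qed
  from this[OF t] have "u t x - w t x \<le> \<gamma> ^ n * D" for n by (simp add: diff_le_eq add.commute)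
  moreover have "(\<lambda>n. \<gamma> ^ n * D) \<longlonglongrightarrow> 0"
    by (rule tendsto_mult_left_zero[OF LIMSEQ_realpow_zero[OF discount]])
  ultimately have "u t x - w t x \<le> 0" by (intro LIMSEQ_le_const) auto
  then show ?thesis by simp
qed

section \<open>The optimality operator and its minimisers\<close>

context lsc_mdp begin

definition bdd_borel :: "real \<Rightarrow> ('x \<Rightarrow> real) \<Rightarrow> bool" where
  "bdd_borel c v \<longleftrightarrow> v \<in> borel_measurable borel \<and> (\<forall>x. \<bar>v x\<bar> \<le> c)"

lemma bdd_borelD:
  assumes "bdd_borel c v" shows "v \<in> borel_measurable borel" "\<And>x. \<bar>v x\<bar> \<le> c"
  using assms by (auto simp: bdd_borel_def)

lemma bdd_lsc_imp_borel: "bdd_lsc c v \<Longrightarrow> bdd_borel c v"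
  by (auto simp: bdd_lsc_def bdd_borel_def intro: lsc_measurable)

lemma adm_laws_subset:
  assumes t: "t \<ge> 1" and "\<nu> \<in> adm_laws \<A> t x"
  shows "\<nu> \<in> laws" "\<nu> \<in> prob_on (\<Union>x. \<A> t x)"
proof -
  have \<nu>: "\<nu> \<in> prob_on (\<A> t x)" using assms(2) by (simp add: adm_laws_def)
  then show p: "\<nu> \<in> laws" by (rule prob_onD)
  have "AE a in \<nu>. a \<in> \<A> t x"
    using \<nu> prob_on_iff_AE[OF p borel_closed[OF \<A>_closed[OF t]]] by simp
  then have "AE a in \<nu>. a \<in> (\<Union>x. \<A> t x)" by eventually_elim blast
  then show "\<nu> \<in> prob_on (\<Union>x. \<A> t x)"
    using prob_on_iff_AE[OF p borel_closed[OF compact_imp_closed[OF actions_compact[OF t]]]] by simp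
qed

lemma adm_laws_nonempty: "t \<ge> 1 \<Longrightarrow> adm_laws \<A> t x \<noteq> {}"
  using \<A>_nonempty[of t x] return_prob_on[OF _ borel_closed[OF \<A>_closed[of t x]]]
  unfolding adm_laws_def by blast

text \<open>
  By upper hemicontinuity the action sets at \<open>xs n\<close> eventually lie within distance \<open>e\<close> of
  the one at \<open>x\<close>, so the mean distance of an action to the latter is at most \<open>e\<close>; this
  passes to the weak limit.
\<close>

lemma adm_laws_limit:
  assumes t: "t \<ge> 1" and xs: "xs \<longlonglongrightarrow> x" and \<nu>s: "\<And>n. \<nu>s n \<in> adm_laws \<A> t (xs n)"
    and lim: "limitin weak_topology \<nu>s \<nu> sequentially"
  shows "\<nu> \<in> adm_laws \<A> t x"
proof -
  have \<nu>: "\<nu> \<in> laws" using limitin_topspace[OF lim] by simp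
  have \<nu>s': "\<nu>s n \<in> laws" for n using adm_laws_subset[OF t \<nu>s] by blast
  define f where "f a = min 1 (infdist a (\<A> t x))" for a
  have cf: "continuous_on UNIV f" unfolding f_def by (intro continuous_intros)
  have fb: "0 \<le> f a" "f a \<le> 1" for a by (auto simp: f_def infdist_nonneg)
  then have fb': "\<bar>f a\<bar> \<le> 1" for a by (simp add: abs_le_iff)
  have int: "integrable \<mu> f" if "\<mu> \<in> laws" for \<mu>
    by (rule integrable_bounded_prob[OF that borel_measurable_continuous_onI[OF cf] fb'])
  have conv: "(\<lambda>n. \<integral>a. f a \<partial>\<nu>s n) \<longlonglongrightarrow> (\<integral>a. f a \<partial>\<nu>)"
    by (rule limitin_weak_topologyD[OF lim cf]) (use fb' in \<open>auto simp: bounded_iff\<close>)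
  have le: "(\<integral>a. f a \<partial>\<nu>) \<le> e" if e: "e > 0" for e
  proof (rule tendsto_upperbound[OF conv])
    define U where "U = {a. infdist a (\<A> t x) < e}"
    have "open U" unfolding U_def by (intro open_Collect_less continuous_intros)
    moreover have "\<A> t x \<subseteq> U" using e by (auto simp: U_def)
    ultimately obtain V where V: "open V" "x \<in> V" "\<forall>z\<in>V. \<A> t z \<subseteq> U"
      using actions_uhc[OF t] by blast
    show "eventually (\<lambda>n. (\<integral>a. f a \<partial>\<nu>s n) \<le> e) sequentially"
      using topological_tendstoD[OF xs V(1,2)]
    proof eventually_elim
      case (elim n)
      interpret prob_space "\<nu>s n" using space_prob_borelD(1)[OF \<nu>s'] .
      have "AE a in \<nu>s n. a \<in> \<A> t (xs n)"
        using \<nu>s[of n] prob_on_iff_AE[OF \<nu>s' borel_closed[OF \<A>_closed[OF t]]] by (simp add: adm_laws_def)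
      then have "AE a in \<nu>s n. f a \<le> e"
      proof eventually_elim
        case (elim a)
        then have "a \<in> U" using V(3) \<open>xs n \<in> V\<close> by blast
        then show ?case by (simp add: U_def f_def min_le_iff_disj)
      qed
      then have "(\<integral>a. f a \<partial>\<nu>s n) \<le> (\<integral>a. e \<partial>\<nu>s n)"
        by (intro integral_mono_AE int \<nu>s') auto
      then show ?case by (simp add: prob_space)
    qed
  qed simp
  have "(\<integral>a. f a \<partial>\<nu>) \<le> 0" by (rule field_le_epsilon) (use le in simp)
  moreover have "0 \<le> (\<integral>a. f a \<partial>\<nu>)" by (rule integral_nonneg_AE) (simp add: fb)
  ultimately have "(\<integral>a. f a \<partial>\<nu>) = 0" by simp
  then show ?thesis
    using prob_on_closed_iff_infdist[OF \<nu> \<A>_closed[OF t] \<A>_nonempty[OF t]]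
    by (simp add: adm_laws_def f_def[abs_def])
qed

text \<open>
  The admissible laws and the one-stage risk, transported along the embedding \<open>moments\<close>.
\<close>

definition adm_graph :: "nat \<Rightarrow> ('x \<times> (nat \<Rightarrow> real)) set" where
  "adm_graph t = {(x, moments \<nu>) | x \<nu>. \<nu> \<in> adm_laws \<A> t x}"

definition G_moments :: "nat \<Rightarrow> ('x \<Rightarrow> real) \<Rightarrow> 'x \<Rightarrow> (nat \<Rightarrow> real) \<Rightarrow> ereal" where
  "G_moments t v x m = Gop t (law_of_moments m) v x"

lemma adm_graphE:
  assumes "t \<ge> 1" "(x, m) \<in> adm_graph t"
  obtains \<nu> where "\<nu> \<in> adm_laws \<A> t x" "m = moments \<nu>" "law_of_moments m = \<nu>"
  using assms adm_laws_subset(1)[OF assms(1)] by (auto simp: adm_graph_def)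

lemma adm_graph_subset: "t \<ge> 1 \<Longrightarrow> adm_graph t \<subseteq> UNIV \<times> moments ` prob_on (\<Union>x. \<A> t x)"
  using adm_laws_subset(2) by (auto simp: adm_graph_def)

lemma adm_graph_closed:
  assumes t: "t \<ge> 1"
  shows "closed (adm_graph t)"
  unfolding closed_sequential_limits
proof (intro allI impI)
  fix zs :: "nat \<Rightarrow> 'x \<times> (nat \<Rightarrow> real)" and z
  assume zs: "(\<forall>n. zs n \<in> adm_graph t) \<and> zs \<longlonglongrightarrow> z"
  have "\<exists>\<nu>. \<nu> \<in> adm_laws \<A> t (fst (zs n)) \<and> snd (zs n) = moments \<nu>" for n
  proof -
    have "zs n \<in> adm_graph t" using zs by blast
    then show ?thesis by (auto simp: adm_graph_def)
  qed
  then obtain \<nu>s where \<nu>s: "\<And>n. \<nu>s n \<in> adm_laws \<A> t (fst (zs n))" "\<And>n. snd (zs n) = moments (\<nu>s n)"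
    by metis
  obtain \<nu> r where r: "strict_mono r" "limitin weak_topology (\<nu>s \<circ> r) \<nu> sequentially"
    using prob_on_seq_compact[OF actions_compact[OF t], of \<nu>s] adm_laws_subset(2)[OF t \<nu>s(1)] by blast
  have zr: "(\<lambda>n. zs (r n)) \<longlonglongrightarrow> z"
    using LIMSEQ_subseq_LIMSEQ[OF conjunct2[OF zs] r(1)] by (simp add: comp_def)
  have "\<nu> \<in> adm_laws \<A> t (fst z)"
    by (rule adm_laws_limit[OF t tendsto_fst[OF zr] _ r(2)]) (simp add: \<nu>s(1))
  moreover have "snd z = moments \<nu>"
    using LIMSEQ_unique[OF tendsto_snd[OF zr]] limitin_weak_imp_moments[OF r(2)]
    by (simp add: \<nu>s(2) comp_def)
  ultimately show "z \<in> adm_graph t" unfolding adm_graph_def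
    by (auto intro!: exI[of _ "fst z"] exI[of _ \<nu>] simp: prod_eq_iff)
qed

lemma G_moments_lsc:
  assumes t: "t \<ge> 1" and v: "bdd_lsc c v"
  shows "seq_lsc_on (adm_graph t) (G_moments t v)"
  unfolding seq_lsc_on_def
proof (intro allI impI)
  fix xs :: "nat \<Rightarrow> 'x" and ms x m
  assume mem: "\<forall>n. (xs n, ms n) \<in> adm_graph t" "(x, m) \<in> adm_graph t" and lim: "xs \<longlonglongrightarrow> x" "ms \<longlonglongrightarrow> m"
  define \<nu>s where "\<nu>s n = (law_of_moments (ms n) :: 'a measure)" for n
  have \<nu>s: "\<nu>s n \<in> adm_laws \<A> t (xs n)" "ms n = moments (\<nu>s n)" "law_of_moments (ms n) = \<nu>s n" for n
    using adm_graphE[OF t mem(1)[rule_format, of n]] by (metis \<nu>s_def)+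
  obtain \<nu> where \<nu>: "\<nu> \<in> adm_laws \<A> t x" "m = moments \<nu>" "law_of_moments m = \<nu>"
    using adm_graphE[OF t mem(2)] .
  note mem' = adm_laws_subset(2)[OF t]
  have "limitin weak_topology \<nu>s \<nu> sequentially"
    by (rule limitin_weak_of_moments[OF actions_compact[OF t] mem'[OF \<nu>s(1)] mem'[OF \<nu>(1)]])
       (use lim(2) in \<open>simp add: \<nu>s(2)[symmetric] \<nu>(2)\<close>)
  from Gop_lsc[OF t v actions_compact[OF t] mem'[OF \<nu>s(1)] this lim(1)]
  show "G_moments t v x m \<le> liminf (\<lambda>n. G_moments t v (xs n) (ms n))"
    by (simp add: G_moments_def \<nu>s(3) \<nu>(3))
qed

lemma slice_min_adm_graph:
  assumes t: "t \<ge> 1"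
  shows "slice_min (adm_graph t) (G_moments t v) x = (INF \<nu>\<in>adm_laws \<A> t x. Gop t \<nu> v x)"
proof -
  have "{m. (x, m) \<in> adm_graph t} = moments ` adm_laws \<A> t x"
    by (auto simp: adm_graph_def)
  then have "slice_min (adm_graph t) (G_moments t v) x = (INF \<nu>\<in>adm_laws \<A> t x. G_moments t v x (moments \<nu>))"
    by (simp add: slice_min_def image_image)
  also have "\<dots> = (INF \<nu>\<in>adm_laws \<A> t x. Gop t \<nu> v x)"
    by (intro INF_cong refl) (simp add: G_moments_def adm_laws_subset(1)[OF t])
  finally show ?thesis .
qed

abbreviation "Sop t v x \<equiv> S_op \<gamma> \<sigma> \<A> P C t v x"

lemma Gop_le_bound:
  assumes "t \<ge> 1" "\<nu> \<in> laws" "bdd_borel c v"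
  shows "ereal (- (b + \<gamma> * c)) \<le> Gop t \<nu> v x" "Gop t \<nu> v x \<le> ereal (b + \<gamma> * c)" "\<bar>Gop t \<nu> v x\<bar> \<noteq> \<infinity>"
  using Gop_bound[OF assms(1,2) bdd_borelD[OF assms(3)], of x]
  by (cases "Gop t \<nu> v x"; simp)+

lemma Sop_INF:
  assumes t: "t \<ge> 1" and v: "bdd_borel c v"
  shows "ereal (Sop t v x) = (INF \<nu>\<in>adm_laws \<A> t x. Gop t \<nu> v x)" "\<bar>Sop t v x\<bar> \<le> b + \<gamma> * c"
proof -
  obtain \<nu>0 where \<nu>0: "\<nu>0 \<in> adm_laws \<A> t x" using adm_laws_nonempty[OF t] by blast
  let ?I = "INF \<nu>\<in>adm_laws \<A> t x. Gop t \<nu> v x"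
  have 1: "ereal (- (b + \<gamma> * c)) \<le> ?I"
    by (rule INF_greatest) (rule Gop_le_bound(1)[OF t adm_laws_subset(1)[OF t] v])
  have 2: "?I \<le> ereal (b + \<gamma> * c)"
    by (rule INF_lower2[OF \<nu>0]) (rule Gop_le_bound(2)[OF t adm_laws_subset(1)[OF t \<nu>0] v])
  from 1 2 show "ereal (Sop t v x) = ?I" "\<bar>Sop t v x\<bar> \<le> b + \<gamma> * c"
    unfolding S_op_def by (cases ?I; simp add: abs_le_iff)+
qed

lemma Sop_contract:
  assumes t: "t \<ge> 1" and v: "bdd_borel c v" and w: "bdd_borel c' w" and le: "\<And>y. v y \<le> w y + e"
  shows "Sop t v x \<le> Sop t w x + \<gamma> * e"
proof -
  have "ereal (Sop t v x - \<gamma> * e) \<le> (INF \<nu>\<in>adm_laws \<A> t x. Gop t \<nu> w x)"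
  proof (rule INF_greatest)
    fix \<nu> assume \<nu>: "\<nu> \<in> adm_laws \<A> t x"
    note p = adm_laws_subset(1)[OF t \<nu>]
    have "ereal (Sop t v x) \<le> Gop t \<nu> v x"
      unfolding Sop_INF(1)[OF t v] by (rule INF_lower[OF \<nu>])
    also have "\<dots> \<le> Gop t \<nu> w x + ereal (\<gamma> * e)"
      by (rule Gop_mono[OF t p bdd_borelD[OF v] bdd_borelD[OF w] le])
    finally show "ereal (Sop t v x - \<gamma> * e) \<le> Gop t \<nu> w x"
      by (cases "Gop t \<nu> w x") auto
  qed
  then show ?thesis unfolding Sop_INF(1)[OF t w, symmetric] by simp
qed

lemma Sop_bdd_lsc:
  assumes t: "t \<ge> 1" and v: "bdd_lsc c v"
  shows "bdd_lsc (b + \<gamma> * c) (Sop t v)"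
proof -
  note v' = bdd_lsc_imp_borel[OF v]
  define u where "u x = (INF \<nu>\<in>adm_laws \<A> t x. Gop t \<nu> v x)" for x
  have u: "ereal (Sop t v x) = u x" for x unfolding u_def by (rule Sop_INF(1)[OF t v'])
  have "u x \<le> liminf (\<lambda>n. u (xs n))" if "xs \<longlonglongrightarrow> x" for xs x
    unfolding u_def slice_min_adm_graph[OF t, symmetric]
    by (rule slice_min_lsc[OF adm_graph_closed[OF t] adm_graph_subset[OF t]
          compact_moments_prob_on[OF actions_compact[OF t]] G_moments_lsc[OF t v] that])
  then have "lower_semicontinuous (Sop t v)" unfolding lsc_iff_liminf u by blast
  then show ?thesis using Sop_INF(2)[OF t v'] by (simp add: bdd_lsc_def)
qed

abbreviation "argmin t v x \<equiv> argmin_set \<gamma> \<sigma> \<A> P C t v x"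

lemma argmin_iff:
  "\<nu> \<in> argmin t v x \<longleftrightarrow> \<nu> \<in> adm_laws \<A> t x \<and> Gop t \<nu> v x = (INF \<nu>\<in>adm_laws \<A> t x. Gop t \<nu> v x)"
proof -
  have "(\<not> (\<exists>y. y \<in> adm_laws \<A> t x \<and> Gop t y v x < Gop t \<nu> v x)) \<longleftrightarrow>
      Gop t \<nu> v x = (INF \<nu>\<in>adm_laws \<A> t x. Gop t \<nu> v x)" if \<nu>: "\<nu> \<in> adm_laws \<A> t x"
  proof -
    have "(\<not> (\<exists>y. y \<in> adm_laws \<A> t x \<and> Gop t y v x < Gop t \<nu> v x)) \<longleftrightarrow>
      Gop t \<nu> v x \<le> (INF \<nu>\<in>adm_laws \<A> t x. Gop t \<nu> v x)"
      unfolding le_INF_iff by (auto simp: not_less)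
    also have "\<dots> \<longleftrightarrow> Gop t \<nu> v x = (INF \<nu>\<in>adm_laws \<A> t x. Gop t \<nu> v x)"
      using INF_lower[OF \<nu>, of "\<lambda>\<nu>. Gop t \<nu> v x"] by (auto intro: antisym)
    finally show ?thesis .
  qed
  then show ?thesis unfolding argmin_set_def is_arg_min_def by blast
qed

text \<open>
  All three claims are read off the embedded problem. The set of minimisers is weakly closed because it is the
  preimage, under the continuous injection \<open>moments\<close>, of a compact set.
\<close>

lemma argmin_selection:
  assumes t: "t \<ge> 1" and v: "bdd_lsc c v"
  shows "argmin t v x \<noteq> {}" "closedin weak_topology (argmin t v x)"
    "\<exists>\<pi>. \<pi> \<in> borel \<rightarrow>\<^sub>M prob_algebra borel \<and> (\<forall>x. \<pi> x \<in> argmin t v x)"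
proof -
  note v' = bdd_lsc_imp_borel[OF v]
  note \<Gamma> = adm_graph_closed[OF t] adm_graph_subset[OF t]
          compact_moments_prob_on[OF actions_compact[OF t]] G_moments_lsc[OF t v]
  have fin: "G_moments t v x m < \<infinity>" if "(x, m) \<in> adm_graph t" for x m
  proof -
    obtain \<nu> where \<nu>: "\<nu> \<in> adm_laws \<A> t x" "law_of_moments m = \<nu>" using adm_graphE[OF t \<open>(x, m) \<in> adm_graph t\<close>] .
    have "Gop t \<nu> v x \<le> ereal (b + \<gamma> * c)"
      by (rule Gop_le_bound(2)[OF t adm_laws_subset(1)[OF t \<nu>(1)] v'])
    then have "Gop t \<nu> v x < \<infinity>" by (rule le_less_trans) simp
    then show ?thesis by (simp add: G_moments_def \<nu>(2))
  qed
  have ne: "\<exists>m. (x, m) \<in> adm_graph t" for x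
    using adm_laws_nonempty[OF t, of x] by (auto simp: adm_graph_def)
  note sel = slice_argmin_selection[OF \<Gamma> fin ne]
  have arg: "\<nu> \<in> argmin t v x \<longleftrightarrow>
      (x, moments \<nu>) \<in> adm_graph t \<and> G_moments t v x (moments \<nu>) = slice_min (adm_graph t) (G_moments t v) x"
    if \<nu>: "\<nu> \<in> laws" for \<nu> x
  proof -
    have "(x, moments \<nu>) \<in> adm_graph t \<longleftrightarrow> \<nu> \<in> adm_laws \<A> t x"
      using adm_graphE[OF t, of x "moments \<nu>"] law_of_moments[OF \<nu>]
      by (metis (mono_tags, lifting) adm_graph_def mem_Collect_eq)
    then show ?thesis unfolding argmin_iff slice_min_adm_graph[OF t] G_moments_def law_of_moments[OF \<nu>] by simp
  qed
  have argmin_prob: "\<nu> \<in> laws" if "\<nu> \<in> argmin t v x" for \<nu> x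
    using that adm_laws_subset(1)[OF t] by (auto simp: argmin_iff)
  obtain s where s: "s \<in> borel_measurable borel"
    "\<And>x. (x, s x) \<in> adm_graph t" "\<And>x. G_moments t v x (s x) = slice_min (adm_graph t) (G_moments t v) x"
    using sel(2) by blast
  define \<pi> where "\<pi> x = (law_of_moments (s x) :: 'a measure)" for x
  have \<pi>: "\<pi> x \<in> laws" "moments (\<pi> x) = s x" for x
    using adm_graphE[OF t s(2)[of x]] adm_laws_subset(1)[OF t] by (metis \<pi>_def)+
  have \<pi>_arg: "\<pi> x \<in> argmin t v x" for x using arg[OF \<pi>(1)] s \<pi>(2) by simp
  then show "argmin t v x \<noteq> {}" by blast
  have "\<pi> \<in> borel \<rightarrow>\<^sub>M prob_algebra borel"
    by (rule measurable_prob_algebra_moments) (use \<pi> s(1) in simp_all)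
  with \<pi>_arg show "\<exists>\<pi>. \<pi> \<in> borel \<rightarrow>\<^sub>M prob_algebra borel \<and> (\<forall>x. \<pi> x \<in> argmin t v x)" by blast
  have "argmin t v x = {\<nu> \<in> topspace weak_topology. moments \<nu> \<in>
      {m. (x, m) \<in> adm_graph t \<and> G_moments t v x m = slice_min (adm_graph t) (G_moments t v) x}}"
    using arg argmin_prob by auto
  also have "closedin weak_topology \<dots>"
    by (rule closedin_continuous_map_preimage[OF continuous_map_moments])
       (use compact_imp_closed[OF sel(1)] in simp)
  finally show "closedin weak_topology (argmin t v x)" .
qed

section \<open>Value functions\<close>

text \<open>
  Joint lower semicontinuity of \<open>\<sigma>\<close>, transported along \<open>moments\<close>, makes
  \<open>\<sigma>\<close> a Borel function on a Polish space, which can be composed with the measurable map \<open>x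
  \<mapsto> (x, moments (\<kappa> x))\<close>.
\<close>

lemma risk_measurable_kernel:
  fixes \<kappa> :: "'x \<Rightarrow> real measure"
  assumes t: "t \<ge> 1" and \<kappa>: "\<kappa> \<in> borel \<rightarrow>\<^sub>M prob_algebra borel" "\<And>x. \<kappa> x \<in> prob_on {-c..c}"
  shows "(\<lambda>x. \<sigma> t x (\<kappa> x)) \<in> borel_measurable borel"
proof -
  define \<Gamma> where "\<Gamma> = (UNIV :: 'x set) \<times> moments ` prob_on {-c..c::real}"
  define g where "g x m = \<sigma> t x (law_of_moments m)" for x and m :: "nat \<Rightarrow> real"
  have inv: "law_of_moments (moments \<mu>) = \<mu>" if "\<mu> \<in> prob_on {-c..c}" for \<mu>
    using prob_onD(1)[OF that] by simp
  have closed: "closed \<Gamma>" unfolding \<Gamma>_def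
    by (intro closed_Times closed_UNIV compact_imp_closed[OF compact_moments_prob_on]) simp_all
  have lsc: "seq_lsc_on \<Gamma> g" unfolding seq_lsc_on_def
  proof (intro allI impI)
    fix xs :: "nat \<Rightarrow> 'x" and ms x m
    assume mem: "\<forall>n. (xs n, ms n) \<in> \<Gamma>" "(x, m) \<in> \<Gamma>" and lim: "xs \<longlonglongrightarrow> x" "ms \<longlonglongrightarrow> m"
    define \<mu>s where "\<mu>s n = (law_of_moments (ms n) :: real measure)" for n
    define \<mu> where "\<mu> = (law_of_moments m :: real measure)"
    have "ms n \<in> moments ` prob_on {-c..c}" for n using mem(1) by (simp add: \<Gamma>_def)
    then have \<mu>s: "\<mu>s n \<in> prob_on {-c..c}" "ms n = moments (\<mu>s n)" for n
      unfolding \<mu>s_def using inv by (metis (no_types, lifting) imageE)+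
    have "m \<in> moments ` prob_on {-c..c}" using mem(2) by (simp add: \<Gamma>_def)
    then have \<mu>: "\<mu> \<in> prob_on {-c..c}" "m = moments \<mu>"
      unfolding \<mu>_def using inv by (metis (no_types, lifting) imageE)+
    have "limitin weak_topology \<mu>s \<mu> sequentially"
      by (rule limitin_weak_of_moments[of "{-c..c}", OF _ \<mu>s(1) \<mu>(1)])
         (use lim(2) in \<open>simp_all add: \<mu>s(2)[symmetric] \<mu>(2)[symmetric]\<close>)
    from sigma_lsc[OF t _ \<mu>s(1) \<mu>(1) this lim(1)]
    show "g x m \<le> liminf (\<lambda>n. g (xs n) (ms n))" by (simp add: g_def \<mu>s_def \<mu>_def)
  qed
  have "(\<lambda>x. moments (\<kappa> x)) \<in> borel_measurable borel"
    by (rule measurable_compose[OF \<kappa>(1) measurable_moments])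
  then have "(\<lambda>x. (x, moments (\<kappa> x))) \<in> borel \<rightarrow>\<^sub>M borel" by (intro borel_measurable_Pair) simp_all
  from measurable_compose[OF this seq_lsc_on_graph_measurable[OF closed lsc]]
  show ?thesis using \<kappa>(2) by (simp add: \<Gamma>_def g_def inv)
qed

lemma cost_kernel_measurable:
  assumes t: "t \<ge> 1" and v: "v \<in> borel_measurable borel" and p: "p \<in> borel \<rightarrow>\<^sub>M prob_algebra borel"
  shows "(\<lambda>x. cost v t x (p x)) \<in> borel \<rightarrow>\<^sub>M prob_algebra borel"
  unfolding cost_law_def
proof (rule measurable_bind_prob_space2[OF p])
  have 1: "(\<lambda>z. P t (fst z) (snd z)) \<in> (borel \<Otimes>\<^sub>M borel) \<rightarrow>\<^sub>M prob_algebra borel"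
    using P_kernel[OF t] by (simp add: case_prod_beta' borel_prod)
  have 2: "(\<lambda>(z, y). C t (fst z) (snd z) y + \<gamma> * v y) \<in> (borel \<Otimes>\<^sub>M borel) \<Otimes>\<^sub>M borel \<rightarrow>\<^sub>M borel"
    using stage_jointly_measurable[OF t v] by (simp add: case_prod_beta' stage_def)
  show "(\<lambda>(x, a). distr (P t x a) borel (\<lambda>y. C t x a y + \<gamma> * v y)) \<in> borel \<Otimes>\<^sub>M borel \<rightarrow>\<^sub>M prob_algebra borel"
    using measurable_distr_prob_space2[OF 1 2] by (simp add: case_prod_beta')
qed

abbreviation "Hop p t v x \<equiv> H_op \<gamma> \<sigma> P C p t v x"

lemma policiesD:
  assumes "p \<in> policies \<A>" "t \<ge> 1"
  shows "p t \<in> borel \<rightarrow>\<^sub>M prob_algebra borel" "p t x \<in> adm_laws \<A> t x" "p t x \<in> laws"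
proof -
  show "p t \<in> borel \<rightarrow>\<^sub>M prob_algebra borel" and adm: "p t x \<in> adm_laws \<A> t x"
    using assms by (auto simp: policies_def)
  show "p t x \<in> laws" by (rule adm_laws_subset(1)[OF assms(2) adm])
qed

lemma Hop_Gop:
  assumes "p \<in> policies \<A>" "t \<ge> 1" "bdd_borel c v"
  shows "ereal (Hop p t v x) = Gop t (p t x) v x"
  using Gop_le_bound(3)[OF assms(2) policiesD(3)[OF assms(1,2)] assms(3)]
  by (simp add: H_op_def ereal_real')

lemma Hop_bdd_borel:
  assumes p: "p \<in> policies \<A>" and t: "t \<ge> 1" and v: "bdd_borel c v"
  shows "bdd_borel (b + \<gamma> * c) (Hop p t v)"
  unfolding bdd_borel_def
proof (intro conjI allI)
  have "(\<lambda>x. \<sigma> t x (cost v t x (p t x))) \<in> borel_measurable borel"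
    by (rule risk_measurable_kernel[OF t cost_kernel_measurable[OF t bdd_borelD(1)[OF v] policiesD(1)[OF p t]]
          cost_law_prob_on[OF t policiesD(3)[OF p t] bdd_borelD[OF v]]])
  then show "Hop p t v \<in> borel_measurable borel"
    unfolding H_op_def G_op_def by measurable
  fix x
  show "\<bar>Hop p t v x\<bar> \<le> b + \<gamma> * c"
    using Gop_le_bound(1,2)[OF t policiesD(3)[OF p t, of x] v, of x]
    unfolding Hop_Gop[OF p t v, symmetric] by simp
qed

lemma Hop_contract:
  assumes p: "p \<in> policies \<A>" and t: "t \<ge> 1" and v: "bdd_borel c v" and w: "bdd_borel c' w"
    and le: "\<And>y. v y \<le> w y + e"
  shows "Hop p t v x \<le> Hop p t w x + \<gamma> * e"
  using Gop_mono[OF t policiesD(3)[OF p t, of x] bdd_borelD[OF v] bdd_borelD[OF w] le, where x=x]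
  unfolding Hop_Gop[OF p t v, symmetric] Hop_Gop[OF p t w, symmetric] by simp

lemma Sop_le_Hop:
  assumes p: "p \<in> policies \<A>" and t: "t \<ge> 1" and v: "bdd_borel c v"
  shows "Sop t v x \<le> Hop p t v x"
proof -
  have "ereal (Sop t v x) \<le> ereal (Hop p t v x)"
    unfolding Sop_INF(1)[OF t v] Hop_Gop[OF p t v] by (rule INF_lower[OF policiesD(2)[OF p t]])
  then show ?thesis by simp
qed

text \<open>
  The fixed point of \<open>c \<mapsto> b + \<gamma> * c\<close>, the bound that one stage turns a bound
  \<open>c\<close> into.
\<close>

definition value_bound :: real where "value_bound = b / (1 - \<gamma>)"

lemma value_bound: "b + \<gamma> * value_bound = value_bound" "0 \<le> value_bound"
  using gamma b_pos by (auto simp: value_bound_def field_simps)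

abbreviation "JoptT t T \<equiv> J_opt \<gamma> \<sigma> \<A> P C t T"
abbreviation "JpolT p t T \<equiv> J_pol \<gamma> \<sigma> P C p t T"
abbreviation "Jpol0T p T \<equiv> J_pol0 \<gamma> \<sigma>0 \<sigma> P \<xi> C p T"
abbreviation "risk0T p T \<equiv> dyn_risk0 M F G \<gamma> \<sigma>0 \<sigma> (Xp p) (cost_process C (Xp p) (Ap p)) T"
abbreviation "risk0 p \<equiv> dyn_risk0_inf M F G \<gamma> \<sigma>0 \<sigma> (Xp p) (cost_process C (Xp p) (Ap p))"
abbreviation "Jopt t \<equiv> J_opt_inf \<gamma> \<sigma> \<A> P C t"
abbreviation "Jpol p t \<equiv> J_pol_inf \<gamma> \<sigma> P C p t"

lemma bdd_borel_limit:
  assumes f: "\<And>n. bdd_borel c (f n)" and lim: "\<And>e. e > 0 \<Longrightarrow> \<exists>n::nat. \<forall>x. \<bar>f n x - g x\<bar> < e"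
  shows "bdd_borel c g"
proof -
  have "\<forall>k. \<exists>n. \<forall>x. \<bar>f n x - g x\<bar> < inverse (real (Suc k))" using lim by simp
  then obtain n where n: "\<And>k x. \<bar>f (n k) x - g x\<bar> < inverse (real (Suc k))" by metis
  have conv: "(\<lambda>k. f (n k) x) \<longlonglongrightarrow> g x" for x
    by (rule LIM_zero_cancel, rule tendsto_rabs_zero_cancel,
        rule tendsto_sandwich[OF _ _ tendsto_const LIMSEQ_inverse_real_of_nat])
       (use n in \<open>auto intro!: always_eventually less_imp_le\<close>)
  have "g \<in> borel_measurable borel"
    by (rule borel_measurable_LIMSEQ_real[where u="\<lambda>k. f (n k)"])
       (use conv bdd_borelD(1)[OF f] in auto)
  moreover have "\<bar>g x\<bar> \<le> c" for x
    by (rule LIMSEQ_le_const2[OF tendsto_rabs[OF conv]]) (use bdd_borelD(2)[OF f] in auto)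
  ultimately show ?thesis by (simp add: bdd_borel_def)
qed

lemma backward_induction_opt:
  "backward_induction \<gamma> value_bound {v. bdd_lsc value_bound v} (S_op \<gamma> \<sigma> \<A> P C) (J_opt \<gamma> \<sigma> \<A> P C)"
proof
  show "(\<lambda>_. 0) \<in> {v. bdd_lsc value_bound v}"
    using value_bound(2) by (simp add: bdd_lsc_def lower_semicontinuous_def)
  show "Sop t v \<in> {v. bdd_lsc value_bound v}" if "t \<ge> 1" "v \<in> {v. bdd_lsc value_bound v}" for t v
    using Sop_bdd_lsc[OF that(1), of value_bound v] that(2) by (simp add: value_bound(1))
  show "g \<in> {v. bdd_lsc value_bound v}" if f: "\<And>n::nat. f n \<in> {v. bdd_lsc value_bound v}"
    and lim: "\<And>e. e > 0 \<Longrightarrow> \<exists>n. \<forall>x. \<bar>f n x - g x\<bar> < e" for f g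
    using lsc_uniform_limit[of f g] bdd_borel_limit[of value_bound f g] f lim
    by (simp add: bdd_lsc_def bdd_borel_def lsc_measurable)
  show "Sop t v x \<le> Sop t w x + \<gamma> * e" if "t \<ge> 1" "v \<in> {v. bdd_lsc value_bound v}"
    "w \<in> {v. bdd_lsc value_bound v}" "\<And>y. v y \<le> w y + e" for t v w e x
    using Sop_contract[OF that(1) bdd_lsc_imp_borel bdd_lsc_imp_borel that(4)] that(2,3) by simp
qed (use gamma in \<open>auto simp: J_opt.simps bdd_lsc_def\<close>)

lemma backward_induction_pol:
  assumes p: "p \<in> policies \<A>"
  shows "backward_induction \<gamma> value_bound {v. bdd_borel value_bound v} (H_op \<gamma> \<sigma> P C p) (J_pol \<gamma> \<sigma> P C p)"
proof
  show "(\<lambda>_. 0) \<in> {v. bdd_borel value_bound v}"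
    using value_bound(2) by (simp add: bdd_borel_def)
  show "Hop p t v \<in> {v. bdd_borel value_bound v}" if "t \<ge> 1" "v \<in> {v. bdd_borel value_bound v}" for t v
    using Hop_bdd_borel[OF p that(1), of value_bound v] that(2) by (simp add: value_bound(1))
  show "g \<in> {v. bdd_borel value_bound v}" if f: "\<And>n::nat. f n \<in> {v. bdd_borel value_bound v}"
    and lim: "\<And>e. e > 0 \<Longrightarrow> \<exists>n. \<forall>x. \<bar>f n x - g x\<bar> < e" for f g
    using bdd_borel_limit[of value_bound f g] f lim by simp
  show "Hop p t v x \<le> Hop p t w x + \<gamma> * e" if "t \<ge> 1" "v \<in> {v. bdd_borel value_bound v}"
    "w \<in> {v. bdd_borel value_bound v}" "\<And>y. v y \<le> w y + e" for t v w e x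
    using Hop_contract[OF p that(1) _ _ that(4)] that(2,3) by simp
qed (use gamma in \<open>auto simp: J_pol.simps bdd_borel_def\<close>)

lemma Jopt_properties:
  assumes t: "t \<ge> 1"
  shows "convergent (\<lambda>T. JoptT t T x)" "bdd_lsc value_bound (Jopt t)"
    "Jopt t = Sop t (Jopt (Suc t))"
proof -
  interpret backward_induction \<gamma> value_bound "{v. bdd_lsc value_bound v}" "S_op \<gamma> \<sigma> \<A> P C" "J_opt \<gamma> \<sigma> \<A> P C"
    by (rule backward_induction_opt)
  have eq: "J_lim = J_opt_inf \<gamma> \<sigma> \<A> P C" by (intro ext) (simp add: J_lim_def J_opt_inf_def)
  show "convergent (\<lambda>T. JoptT t T x)" "bdd_lsc value_bound (Jopt t)"
    "Jopt t = Sop t (Jopt (Suc t))"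
    using J_convergent[OF t] J_lim_in_V[OF t] J_lim_fixed_point[OF t] unfolding eq by auto
qed

lemma Jpol_properties:
  assumes p: "p \<in> policies \<A>" and t: "t \<ge> 1"
  shows "convergent (\<lambda>T. JpolT p t T x)" "bdd_borel value_bound (Jpol p t)"
    "Jpol p t = Hop p t (Jpol p (Suc t))" "bdd_borel value_bound (JpolT p t T)"
    "e > 0 \<Longrightarrow> eventually (\<lambda>T. \<forall>x. \<bar>JpolT p t T x - Jpol p t x\<bar> \<le> e) sequentially"
proof -
  interpret backward_induction \<gamma> value_bound "{v. bdd_borel value_bound v}" "H_op \<gamma> \<sigma> P C p" "J_pol \<gamma> \<sigma> P C p"
    by (rule backward_induction_pol[OF p])
  have eq: "J_lim = J_pol_inf \<gamma> \<sigma> P C p" by (intro ext) (simp add: J_lim_def J_pol_inf_def)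
  show "convergent (\<lambda>T. JpolT p t T x)" "bdd_borel value_bound (Jpol p t)"
    "Jpol p t = Hop p t (Jpol p (Suc t))" "bdd_borel value_bound (JpolT p t T)"
    using J_convergent[OF t] J_lim_in_V[OF t] J_lim_fixed_point[OF t] J_in_V[OF t] unfolding eq by auto
  assume e: "e > 0"
  have "eventually (\<lambda>T. value_bound * \<gamma> ^ (Suc T - t) < e) sequentially"
    using order_tendstoD(2)[OF discount_power_tendsto e] .
  with eventually_ge_at_top[of t]
  show "eventually (\<lambda>T. \<forall>x. \<bar>JpolT p t T x - Jpol p t x\<bar> \<le> e) sequentially"
  proof eventually_elim
    case (elim T)
    show ?case
    proof
      fix x show "\<bar>JpolT p t T x - Jpol p t x\<bar> \<le> e"
        using J_lim_close[OF t, of T x] elim unfolding eq by linarith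
    qed
  qed
qed

lemma Jopt_borel: "t \<ge> 1 \<Longrightarrow> bdd_borel value_bound (Jopt t)"
  by (rule bdd_lsc_imp_borel[OF Jopt_properties(2)])

text \<open>
  The other solution is merely measurable, so the two are compared within the bounded measurable functions. The
  measurability of \<open>S v\<close>, unclear for such \<open>v\<close> in general, comes here from the fixed point
  equation.
\<close>

lemma Jopt_unique:
  assumes J': "J' \<in> seq_linf" "\<And>t. t \<ge> 1 \<Longrightarrow> J' t = Sop t (J' (Suc t))" and t: "t \<ge> 1"
  shows "J' t = Jopt t"
proof -
  obtain c where c: "\<And>t. t \<ge> 1 \<Longrightarrow> bdd_borel c (J' t)"
    using J'(1) by (auto simp: seq_linf_def bdd_borel_def)
  have bound: "J' t x \<le> Jopt t x + (c + value_bound)" "Jopt t x \<le> J' t x + (c + value_bound)"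
    if "1 \<le> t" for t x
    using bdd_borelD(2)[OF c[OF that], of x] bdd_borelD(2)[OF Jopt_borel[OF that], of x] by linarith+
  have le: "J' t x \<le> Jopt t x" for x
  proof (rule discounted_comparison[where u=J' and w=Jopt, OF gamma _ bound(1) t])
    fix s e x assume s: "1 \<le> s" and le: "\<And>y. J' (Suc s) y \<le> Jopt (Suc s) y + e"
    show "J' s x \<le> Jopt s x + \<gamma> * e"
      unfolding Jopt_properties(3)[OF s] by (subst J'(2)[OF s], rule Sop_contract[OF s c Jopt_borel le]) simp_all
  qed
  have ge: "Jopt t x \<le> J' t x" for x
  proof (rule discounted_comparison[where u=Jopt and w=J', OF gamma _ bound(2) t])
    fix s e x assume s: "1 \<le> s" and le: "\<And>y. Jopt (Suc s) y \<le> J' (Suc s) y + e"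
    show "Jopt s x \<le> J' s x + \<gamma> * e"
      unfolding Jopt_properties(3)[OF s] by (subst J'(2)[OF s], rule Sop_contract[OF s Jopt_borel c le]) simp_all
  qed
  from le ge show ?thesis by (intro ext antisym)
qed

lemma value_difference_bound:
  assumes "p \<in> policies \<A>" "t \<ge> 1"
  shows "Jopt t x \<le> Jpol p t x + 2 * value_bound" "Jpol p t x \<le> Jopt t x + 2 * value_bound"
  using bdd_borelD(2)[OF Jopt_borel[OF assms(2)], of x] bdd_borelD(2)[OF Jpol_properties(2)[OF assms], of x]
  by linarith+

lemma Jopt_le_Jpol:
  assumes p: "p \<in> policies \<A>" and t: "t \<ge> 1"
  shows "Jopt t x \<le> Jpol p t x"
proof (rule discounted_comparison[where u=Jopt and w="Jpol p", OF gamma _ value_difference_bound(1)[OF p] t])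
  fix s e x assume s: "1 \<le> s" and le: "\<And>y. Jopt (Suc s) y \<le> Jpol p (Suc s) y + e"
  have "Jopt s x = Sop s (Jopt (Suc s)) x" using Jopt_properties(3)[OF s] by simp
  also have "\<dots> \<le> Hop p s (Jopt (Suc s)) x" by (rule Sop_le_Hop[OF p s Jopt_borel]) simp
  also have "\<dots> \<le> Hop p s (Jpol p (Suc s)) x + \<gamma> * e"
    by (rule Hop_contract[OF p s Jopt_borel Jpol_properties(2)[OF p] le]) simp_all
  also have "Hop p s (Jpol p (Suc s)) x = Jpol p s x" using Jpol_properties(3)[OF p s] by simp
  finally show "Jopt s x \<le> Jpol p s x + \<gamma> * e" .
qed

lemma argmin_policy:
  assumes "\<And>t. t \<ge> 1 \<Longrightarrow> p t \<in> borel \<rightarrow>\<^sub>M prob_algebra borel \<and> (\<forall>x. p t x \<in> argmin t (Jopt (Suc t)) x)"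
  shows "p \<in> policies \<A>"
  using assms by (auto simp: policies_def argmin_iff)

text \<open>
  For a policy of minimisers \<open>J\<^sup>*\<close> also solves the equation of the policy.
\<close>

lemma Jpol_argmin_policy:
  assumes arg: "\<And>t. t \<ge> 1 \<Longrightarrow> p t \<in> borel \<rightarrow>\<^sub>M prob_algebra borel \<and> (\<forall>x. p t x \<in> argmin t (Jopt (Suc t)) x)"
    and t: "t \<ge> 1"
  shows "Jpol p t x = Jopt t x"
proof -
  have p: "p \<in> policies \<A>" by (rule argmin_policy) (rule arg)
  have Jo: "bdd_borel value_bound (Jopt (Suc t))" for t by (rule Jopt_borel) simp
  have fixed: "Hop p t (Jopt (Suc t)) x = Jopt t x" if t: "t \<ge> 1" for t x
  proof -
    have "ereal (Hop p t (Jopt (Suc t)) x) = Gop t (p t x) (Jopt (Suc t)) x" by (rule Hop_Gop[OF p t Jo])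
    also have "\<dots> = (INF \<nu>\<in>adm_laws \<A> t x. Gop t \<nu> (Jopt (Suc t)) x)"
      using arg[OF t] by (simp add: argmin_iff)
    also have "\<dots> = ereal (Sop t (Jopt (Suc t)) x)" by (rule Sop_INF(1)[OF t Jo, symmetric])
    finally show ?thesis using Jopt_properties(3)[OF t] by simp
  qed
  have "Jpol p t x \<le> Jopt t x"
  proof (rule discounted_comparison[where u="Jpol p" and w=Jopt, OF gamma _ value_difference_bound(2)[OF p] t])
    fix s e x assume s: "1 \<le> s" and le: "\<And>y. Jpol p (Suc s) y \<le> Jopt (Suc s) y + e"
    have "Jpol p s x = Hop p s (Jpol p (Suc s)) x" using Jpol_properties(3)[OF p s] by simp
    also have "\<dots> \<le> Hop p s (Jopt (Suc s)) x + \<gamma> * e"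
      by (rule Hop_contract[OF p s Jpol_properties(2)[OF p] Jo le]) simp
    finally show "Jpol p s x \<le> Jopt s x + \<gamma> * e" by (simp add: fixed[OF s])
  qed
  then show ?thesis using Jopt_le_Jpol[OF p t] by (rule antisym)
qed

abbreviation "H0 v \<equiv> H0_op \<gamma> \<sigma>0 \<xi> v"

lemma H0_mono:
  assumes v: "bdd_borel c v" and w: "bdd_borel c' w" and le: "\<And>y. v y \<le> w y + e"
  shows "H0 v \<le> H0 w + ereal (\<gamma> * e)"
  unfolding H0_op_def
proof (rule risk_coupling[OF risk_\<sigma>0 space_prob_borelD(1)[OF \<xi>_prob], where d="\<gamma> * c" and d'="\<gamma> * c'"])
  note [measurable_cong] = space_prob_borelD(2)[OF \<xi>_prob]
  have [measurable]: "v \<in> borel_measurable borel" "w \<in> borel_measurable borel"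
    using bdd_borelD(1)[OF v] bdd_borelD(1)[OF w] .
  show "(\<lambda>y. \<gamma> * v y) \<in> borel_measurable \<xi>" "(\<lambda>y. \<gamma> * w y) \<in> borel_measurable \<xi>" by measurable
  show "AE y in \<xi>. \<bar>\<gamma> * v y\<bar> \<le> \<gamma> * c" "AE y in \<xi>. \<bar>\<gamma> * w y\<bar> \<le> \<gamma> * c'"
    using bdd_borelD(2)[OF v] bdd_borelD(2)[OF w] gamma by (auto simp: abs_mult mult_left_mono)
  show "AE y in \<xi>. \<gamma> * v y \<le> \<gamma> * w y + \<gamma> * e"
    using mult_left_mono[OF le gamma(1)] by (simp add: distrib_left)
qed

lemma H0_finite:
  assumes v: "bdd_borel c v"
  shows "\<bar>H0 v\<bar> \<noteq> \<infinity>"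
  unfolding H0_op_def
proof (rule risk_finite[OF risk_\<sigma>0], rule prob_on_bounded_law, rule distr_prob_on[OF space_prob_borelD(1)[OF \<xi>_prob]])
  note [measurable_cong] = space_prob_borelD(2)[OF \<xi>_prob]
  have [measurable]: "v \<in> borel_measurable borel" using bdd_borelD(1)[OF v] .
  show "(\<lambda>y. \<gamma> * v y) \<in> borel_measurable \<xi>" by measurable
  have "\<bar>\<gamma> * v y\<bar> \<le> \<gamma> * c" for y using bdd_borelD(2)[OF v, of y] gamma by (simp add: abs_mult mult_left_mono)
  then show "AE y in \<xi>. \<gamma> * v y \<in> {- (\<gamma> * c)..\<gamma> * c}"
    unfolding atLeastAtMost_iff by (intro AE_I2) (metis abs_le_D1 abs_le_D2 minus_le_iff)
qed simp

lemma J_pol0_tendsto: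
  assumes p: "p \<in> policies \<A>"
  shows "(\<lambda>T. Jpol0T p T) \<longlonglongrightarrow> H0 (Jpol p 1)"
proof -
  note Jp = Jpol_properties(2)[OF p order_refl] and JT = Jpol_properties(4)[OF p order_refl]
  obtain h where h: "H0 (Jpol p 1) = ereal h" using H0_finite[OF Jp] by (cases "H0 (Jpol p 1)") auto
  define hT where "hT T = real_of_ereal (Jpol0T p T)" for T
  have hT: "Jpol0T p T = ereal (hT T)" for T
    unfolding hT_def J_pol0_def using H0_finite[OF JT] by (simp add: ereal_real')
  have "hT \<longlonglongrightarrow> h"
  proof (rule LIMSEQ_I)
    fix e :: real assume e: "e > 0"
    then have "e / 2 > 0" by simp
    from Jpol_properties(5)[OF p order_refl this] obtain N where
      N: "\<And>T x. T \<ge> N \<Longrightarrow> \<bar>JpolT p 1 T x - Jpol p 1 x\<bar> \<le> e / 2"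
      unfolding eventually_sequentially by blast
    have "norm (hT T - h) < e" if T: "T \<ge> N" for T
    proof -
      have "JpolT p 1 T y \<le> Jpol p 1 y + e/2" "Jpol p 1 y \<le> JpolT p 1 T y + e/2" for y
        using N[OF T, of y] by linarith+
      then have "H0 (JpolT p 1 T) \<le> H0 (Jpol p 1) + ereal (\<gamma> * (e/2))"
        "H0 (Jpol p 1) \<le> H0 (JpolT p 1 T) + ereal (\<gamma> * (e/2))"
        using H0_mono[OF JT Jp] H0_mono[OF Jp JT] by blast+
      then have "hT T \<le> h + \<gamma> * (e/2)" "h \<le> hT T + \<gamma> * (e/2)"
        unfolding h hT[unfolded J_pol0_def] by simp_all
      then have "\<bar>hT T - h\<bar> \<le> \<gamma> * (e/2)" by linarith
      also have "\<dots> \<le> 1 * (e/2)" using gamma e by (intro mult_right_mono) auto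
      finally show ?thesis using e by simp
    qed
    then show "\<exists>N. \<forall>T\<ge>N. norm (hT T - h) < e" by blast
  qed
  then show ?thesis unfolding hT h by simp
qed

end

section \<open>Conditional laws and the dynamic risk measure\<close>

lemma indicator_vimage_fun: "(indicator (Y -` B) :: 'w \<Rightarrow> real) = (\<lambda>\<omega>. indicator B (Y \<omega>))"
  by (auto simp: indicator_def fun_eq_iff)

text \<open>
  The defining property of conditional expectation for indicators, in the nonnegative form that combines with
  integrals against kernels.
\<close>

lemma conditional_probability_iff:
  assumes M: "prob_space M" and sub: "subalgebra M N" and Y: "Y \<in> M \<rightarrow>\<^sub>M S" and \<kappa>: "\<kappa> \<in> N \<rightarrow>\<^sub>M prob_algebra S"
    and B: "B \<in> sets S"
  shows "(AE \<omega> in M. real_cond_exp M N (indicator (Y -` B)) \<omega> = measure (\<kappa> \<omega>) B) \<longleftrightarrow>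
    (\<forall>D\<in>sets N. (\<integral>\<^sup>+\<omega>. indicator D \<omega> * indicator B (Y \<omega>) \<partial>M) = (\<integral>\<^sup>+\<omega>. indicator D \<omega> * emeasure (\<kappa> \<omega>) B \<partial>M))"
    (is "?L \<longleftrightarrow> (\<forall>D\<in>sets N. ?I D = ?K D)")
proof -
  interpret M: prob_space M by (rule M)
  interpret fms: finite_measure_subalgebra M N using sub by unfold_locales
  have kp: "prob_space (\<kappa> \<omega>)" if "\<omega> \<in> space M" for \<omega>
    using kernelD(1)[OF \<kappa>] that sub by (simp add: subalgebra_def)
  have mk: "(\<lambda>\<omega>. measure (\<kappa> \<omega>) B) \<in> borel_measurable N"
    by (rule measurable_compose[OF \<kappa> measurable_measure_prob_algebra[OF B]])
  have mkM: "(\<lambda>\<omega>. measure (\<kappa> \<omega>) B) \<in> borel_measurable M" by (rule measurable_from_subalg[OF sub mk])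
  have ik: "integrable M (\<lambda>\<omega>. measure (\<kappa> \<omega>) B)"
    by (rule M.integrable_const_bound[of _ 1]) (use mkM kp in \<open>auto intro: prob_space.prob_le_1\<close>)
  have iB: "integrable M (\<lambda>\<omega>. indicator B (Y \<omega>) :: real)"
    by (rule M.integrable_const_bound[of _ 1])
       (use measurable_compose[OF Y borel_measurable_indicator[OF B]] in \<open>auto simp: indicator_def\<close>)
  have iff: "?I D = ?K D \<longleftrightarrow>
      (\<integral>\<omega>. indicator D \<omega> * indicator B (Y \<omega>) \<partial>M) = (\<integral>\<omega>. indicator D \<omega> * measure (\<kappa> \<omega>) B \<partial>M)"
    if D: "D \<in> sets M" for D
  proof -
    have i1: "integrable M (\<lambda>\<omega>. indicator D \<omega> * indicator B (Y \<omega>) :: real)"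
      and i2: "integrable M (\<lambda>\<omega>. indicator D \<omega> * measure (\<kappa> \<omega>) B)"
      using integrable_mult_indicator[OF D iB] integrable_mult_indicator[OF D ik] by simp_all
    have "?I D = (\<integral>\<^sup>+\<omega>. ennreal (indicator D \<omega> * indicator B (Y \<omega>)) \<partial>M)"
      by (intro nn_integral_cong) (auto simp: indicator_def)
    also have "\<dots> = ennreal (\<integral>\<omega>. indicator D \<omega> * indicator B (Y \<omega>) \<partial>M)"
      by (rule nn_integral_eq_integral[OF i1]) (auto simp: indicator_def)
    finally have 1: "?I D = ennreal (\<integral>\<omega>. indicator D \<omega> * indicator B (Y \<omega>) \<partial>M)" .
    have "?K D = (\<integral>\<^sup>+\<omega>. ennreal (indicator D \<omega> * measure (\<kappa> \<omega>) B) \<partial>M)"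
      by (intro nn_integral_cong)
         (auto simp: indicator_def finite_measure.emeasure_eq_measure[OF prob_space.finite_measure[OF kp]])
    also have "\<dots> = ennreal (\<integral>\<omega>. indicator D \<omega> * measure (\<kappa> \<omega>) B \<partial>M)"
      by (rule nn_integral_eq_integral[OF i2]) (auto simp: indicator_def)
    finally show ?thesis unfolding 1
      by (simp add: ennreal_inj integral_nonneg_AE indicator_def)
  qed
  have DM: "D \<in> sets M" if "D \<in> sets N" for D using that sub by (auto simp: subalgebra_def)
  show ?thesis
  proof
    assume L: ?L
    show "\<forall>D\<in>sets N. ?I D = ?K D"
    proof
      fix D assume D: "D \<in> sets N"
      have "(\<integral>\<omega>. indicator D \<omega> * indicator B (Y \<omega>) \<partial>M)
          = (\<integral>\<omega>. indicator D \<omega> * real_cond_exp M N (indicator (Y -` B)) \<omega> \<partial>M)"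
        using fms.real_cond_exp_intA[OF iB D] unfolding indicator_vimage_fun set_lebesgue_integral_def by simp
      also have "\<dots> = (\<integral>\<omega>. indicator D \<omega> * measure (\<kappa> \<omega>) B \<partial>M)"
      proof (rule integral_cong_AE)
        show "AE \<omega> in M. indicator D \<omega> * real_cond_exp M N (indicator (Y -` B)) \<omega> = indicator D \<omega> * measure (\<kappa> \<omega>) B"
          using L by eventually_elim simp
      qed (use DM[OF D] mkM in measurable)
      finally show "?I D = ?K D" using iff[OF DM[OF D]] by blast
    qed
  next
    assume R: "\<forall>D\<in>sets N. ?I D = ?K D"
    show ?L unfolding indicator_vimage_fun
    proof (rule fms.real_cond_exp_charact[OF _ iB ik mk])
      fix D assume D: "D \<in> sets N"
      show "(\<integral>\<omega>\<in>D. indicator B (Y \<omega>) \<partial>M) = (\<integral>\<omega>\<in>D. measure (\<kappa> \<omega>) B \<partial>M)"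
        using R D iff[OF DM[OF D]] by (simp add: set_lebesgue_integral_def)
    qed
  qed
qed

text \<open>
  Both sides integrate \<open>g\<close> against a law on pairs. On a rectangle \<open>a \<times> B\<close> with
  \<open>a\<close> in \<open>N\<close> the two laws agree by the defining property of conditional expectation, and
  rectangles generate.
\<close>

lemma conditional_kernel_nn_integral:
  assumes M: "prob_space M" and sub: "subalgebra M N" and Y: "Y \<in> M \<rightarrow>\<^sub>M S" and \<kappa>: "\<kappa> \<in> N \<rightarrow>\<^sub>M prob_algebra S"
    and cond: "\<And>B. B \<in> sets S \<Longrightarrow> AE \<omega> in M. real_cond_exp M N (indicator (Y -` B)) \<omega> = measure (\<kappa> \<omega>) B"
    and g: "g \<in> borel_measurable (N \<Otimes>\<^sub>M S)"
  shows "(\<integral>\<^sup>+\<omega>. g (\<omega>, Y \<omega>) \<partial>M) = (\<integral>\<^sup>+\<omega>. \<integral>\<^sup>+y. g (\<omega>, y) \<partial>\<kappa> \<omega> \<partial>M)"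
proof -
  interpret M: prob_space M by (rule M)
  interpret fms: finite_measure_subalgebra M N
    using sub by unfold_locales
  define R where "R = restr_to_subalg M N"
  have sets_R: "sets R = sets N" unfolding R_def by (rule sets_restr_to_subalg[OF sub])
  have space_N: "space N = space M" using sub by (simp add: subalgebra_def)
  have R: "prob_space R" unfolding R_def by (rule prob_space_restr_to_subalg[OF sub M])
  have id: "(\<lambda>\<omega>. \<omega>) \<in> M \<rightarrow>\<^sub>M N" by (rule measurable_from_subalg[OF sub]) simp
  have pair: "(\<lambda>\<omega>. (\<omega>, Y \<omega>)) \<in> M \<rightarrow>\<^sub>M N \<Otimes>\<^sub>M S" using id Y by simp
  have \<kappa>R: "\<kappa> \<in> R \<rightarrow>\<^sub>M prob_algebra S" using \<kappa> measurable_cong_sets[OF sets_R refl] by blast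
  have sRS: "sets (R \<Otimes>\<^sub>M S) = sets (N \<Otimes>\<^sub>M S)" by (rule sets_pair_measure_cong[OF sets_R refl])
  have gRS: "f \<in> borel_measurable (R \<Otimes>\<^sub>M S)" if "f \<in> borel_measurable (N \<Otimes>\<^sub>M S)" for f :: "_ \<Rightarrow> ennreal"
    using that measurable_cong_sets[OF sRS refl] by blast
  have rhs: "(\<integral>\<^sup>+z. f z \<partial>kernel_joint R S \<kappa>) = (\<integral>\<^sup>+\<omega>. \<integral>\<^sup>+y. f (\<omega>, y) \<partial>\<kappa> \<omega> \<partial>M)"
    if f: "f \<in> borel_measurable (N \<Otimes>\<^sub>M S)" for f :: "_ \<Rightarrow> ennreal"
  proof -
    have "(\<lambda>\<omega>. \<integral>\<^sup>+y. f (\<omega>, y) \<partial>\<kappa> \<omega>) \<in> borel_measurable N"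
      by (rule nn_integral_measurable_subprob_algebra2[OF _ measurable_prob_algebraD[OF \<kappa>]]) (use f in simp)
    then show ?thesis unfolding nn_integral_kernel_joint[OF \<kappa>R gRS[OF f]]
      unfolding R_def by (rule nn_integral_subalgebra2[OF sub])
  qed
  have "distr M (N \<Otimes>\<^sub>M S) (\<lambda>\<omega>. (\<omega>, Y \<omega>)) = kernel_joint R S \<kappa>"
  proof (rule measure_eqI_generator_eq[where \<Omega>="space N \<times> space S"
        and E="{a \<times> b | a b. a \<in> sets N \<and> b \<in> sets S}" and A="\<lambda>_. space N \<times> space S"])
    show "Int_stable {a \<times> b | a b. a \<in> sets N \<and> b \<in> sets S}" by (rule Int_stable_pair_measure_generator)
    show "{a \<times> b | a b. a \<in> sets N \<and> b \<in> sets S} \<subseteq> Pow (space N \<times> space S)"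
      using sets.space_closed[of N] sets.space_closed[of S] by blast
    show "sets (distr M (N \<Otimes>\<^sub>M S) (\<lambda>\<omega>. (\<omega>, Y \<omega>))) = sigma_sets (space N \<times> space S) {a \<times> b | a b. a \<in> sets N \<and> b \<in> sets S}"
      by (simp add: sets_pair_measure)
    show "sets (kernel_joint R S \<kappa>) = sigma_sets (space N \<times> space S) {a \<times> b | a b. a \<in> sets N \<and> b \<in> sets S}"
      using kernel_joint_prob(2)[OF R \<kappa>R] sRS by (simp add: sets_pair_measure)
    show "range (\<lambda>_. space N \<times> space S) \<subseteq> {a \<times> b | a b. a \<in> sets N \<and> b \<in> sets S}" by blast
    show "emeasure (distr M (N \<Otimes>\<^sub>M S) (\<lambda>\<omega>. (\<omega>, Y \<omega>))) (space N \<times> space S) \<noteq> \<infinity>"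
      using M.prob_space_distr[OF pair] by (simp add: prob_space_def finite_measure.emeasure_finite)
    fix X assume "X \<in> {a \<times> b | a b. a \<in> sets N \<and> b \<in> sets S}"
    then obtain a B where X: "X = a \<times> B" and a: "a \<in> sets N" and B: "B \<in> sets S" by blast
    have XNS: "X \<in> sets (N \<Otimes>\<^sub>M S)" unfolding X using a B by simp
    have "emeasure (distr M (N \<Otimes>\<^sub>M S) (\<lambda>\<omega>. (\<omega>, Y \<omega>))) X = (\<integral>\<^sup>+\<omega>. indicator X (\<omega>, Y \<omega>) \<partial>M)"
      using XNS pair by (simp add: nn_integral_indicator[symmetric] nn_integral_distr del: nn_integral_indicator)
    also have "\<dots> = (\<integral>\<^sup>+\<omega>. indicator a \<omega> * indicator B (Y \<omega>) \<partial>M)"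
      by (intro nn_integral_cong) (auto simp: X indicator_def)
    also have "\<dots> = (\<integral>\<^sup>+\<omega>. indicator a \<omega> * emeasure (\<kappa> \<omega>) B \<partial>M)"
      using conditional_probability_iff[OF M sub Y \<kappa> B] cond[OF B] a by blast
    also have "\<dots> = (\<integral>\<^sup>+\<omega>. \<integral>\<^sup>+y. indicator X (\<omega>, y) \<partial>\<kappa> \<omega> \<partial>M)"
    proof (rule nn_integral_cong)
      fix \<omega> assume "\<omega> \<in> space M"
      then have \<omega>: "\<omega> \<in> space N" by (simp add: space_N)
      have "(\<integral>\<^sup>+y. indicator X (\<omega>, y) \<partial>\<kappa> \<omega>) = (\<integral>\<^sup>+y. indicator a \<omega> * indicator B y \<partial>\<kappa> \<omega>)"
        by (intro nn_integral_cong) (auto simp: X indicator_def)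
      also have "\<dots> = indicator a \<omega> * emeasure (\<kappa> \<omega>) B"
        using B kernelD(2)[OF \<kappa> \<omega>] by (simp add: nn_integral_cmult)
      finally show "indicator a \<omega> * emeasure (\<kappa> \<omega>) B = (\<integral>\<^sup>+y. indicator X (\<omega>, y) \<partial>\<kappa> \<omega>)" ..
    qed
    also have "\<dots> = (\<integral>\<^sup>+z. indicator X z \<partial>kernel_joint R S \<kappa>)"
      by (rule rhs[symmetric]) (use XNS in simp)
    also have "\<dots> = emeasure (kernel_joint R S \<kappa>) X"
      by (rule nn_integral_indicator) (use XNS kernel_joint_prob(2)[OF R \<kappa>R] sRS in simp)
    finally show "emeasure (distr M (N \<Otimes>\<^sub>M S) (\<lambda>\<omega>. (\<omega>, Y \<omega>))) X = emeasure (kernel_joint R S \<kappa>) X" .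
  qed auto
  then have "(\<integral>\<^sup>+z. g z \<partial>distr M (N \<Otimes>\<^sub>M S) (\<lambda>\<omega>. (\<omega>, Y \<omega>))) = (\<integral>\<^sup>+z. g z \<partial>kernel_joint R S \<kappa>)" by simp
  then show ?thesis using nn_integral_distr[OF pair, of g] rhs[OF g] g by simp
qed

lemma (in complete_measure) measurable_AE_eq:
  fixes f g :: "'a \<Rightarrow> real"
  assumes g: "g \<in> borel_measurable M" and eq: "AE x in M. f x = g x"
  shows "f \<in> borel_measurable M"
proof (rule measurableI)
  fix B :: "real set" assume B: "B \<in> sets borel"
  have A: "g -` B \<inter> space M \<in> sets M" using g B by (rule measurable_sets)
  have ae: "AE x in M. x \<in> g -` B \<inter> space M \<longleftrightarrow> x \<in> f -` B \<inter> space M"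
    using eq by eventually_elim auto
  show "f -` B \<inter> space M \<in> sets M" by (rule in_sets_AE[OF ae A]) simp
qed simp

lemma ess_norm_bound:
  assumes M: "prob_space M" and W: "W \<in> borel_measurable M" "AE \<omega> in M. \<bar>W \<omega>\<bar> \<le> c"
  shows "AE \<omega> in M. \<bar>W \<omega>\<bar> \<le> ess_norm M W" "0 \<le> ess_norm M W"
proof -
  interpret prob_space M by (rule M)
  define s where "s = esssup M (\<lambda>\<omega>. ereal \<bar>W \<omega>\<bar>)"
  have le: "AE \<omega> in M. ereal \<bar>W \<omega>\<bar> \<le> s" unfolding s_def by (rule esssup_AE)
  have "s \<le> ereal c" unfolding s_def by (rule esssup_I) (use W in auto)
  moreover have "AE \<omega> in M. 0 \<le> s" using le by eventually_elim (auto intro: order_trans[rotated])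
  then have "0 \<le> s" by simp
  ultimately have s: "s = ereal (ess_norm M W)" unfolding ess_norm_def s_def[symmetric] by (cases s) auto
  then show "0 \<le> ess_norm M W" using \<open>0 \<le> s\<close> by simp
  show "AE \<omega> in M. \<bar>W \<omega>\<bar> \<le> ess_norm M W" using le unfolding s by simp
qed

text \<open>
  The choice operator needs a version whose mass lies in the prescribed interval for every \<open>\<omega>\<close>;
  it is obtained from \<open>\<kappa>\<close> by putting the point mass at \<open>0\<close> on the null set where
  \<open>\<kappa>\<close> fails. Two versions agree on each of countably many basis sets outside a null set, hence
  as measures outside one null set.
\<close>

lemma cond_distr_AE_eq:
  assumes M: "prob_space M" and sub: "subalgebra M N" and W: "W \<in> borel_measurable M" "AE \<omega> in M. \<bar>W \<omega>\<bar> \<le> c"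
    and \<kappa>: "\<kappa> \<in> N \<rightarrow>\<^sub>M prob_algebra borel"
    and cond: "\<And>B. B \<in> sets borel \<Longrightarrow> AE \<omega> in M. real_cond_exp M N (indicator (W -` B)) \<omega> = measure (\<kappa> \<omega>) B"
  shows "AE \<omega> in M. cond_distr M N W \<omega> = \<kappa> \<omega>"
proof -
  interpret M: prob_space M by (rule M)
  interpret fms: finite_measure_subalgebra M N using sub by unfold_locales
  have space_N: "space N = space M" using sub by (simp add: subalgebra_def)
  define I where "I = {- ess_norm M W .. ess_norm M W}"
  define \<kappa>' where "\<kappa>' \<omega> = (if measure (\<kappa> \<omega>) I = 1 then \<kappa> \<omega> else return borel 0)" for \<omega>
  have I: "I \<in> sets borel" "0 \<in> I" using ess_norm_bound(2)[OF M W] by (auto simp: I_def)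
  have "AE \<omega> in M. real_cond_exp M N (indicator (W -` I)) \<omega> = real_cond_exp M N (\<lambda>_. 1) \<omega>"
    unfolding indicator_vimage_fun
  proof (rule fms.real_cond_exp_cong)
    show "AE \<omega> in M. indicator I (W \<omega>) = (1 :: real)"
      using ess_norm_bound(1)[OF M W] by eventually_elim (auto simp: I_def indicator_def abs_le_iff)
    show "(\<lambda>\<omega>. indicator I (W \<omega>) :: real) \<in> borel_measurable M"
      using measurable_compose[OF W(1) borel_measurable_indicator[OF I(1)]] .
  qed simp
  moreover have "AE \<omega> in M. real_cond_exp M N (\<lambda>_. 1) \<omega> = 1"
    by (rule fms.real_cond_exp_F_meas) simp_all
  ultimately have "AE \<omega> in M. measure (\<kappa> \<omega>) I = 1"
    using cond[OF I(1)] by eventually_elim simp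
  then have \<kappa>\<kappa>': "AE \<omega> in M. \<kappa>' \<omega> = \<kappa> \<omega>" by eventually_elim (simp add: \<kappa>'_def)
  have "is_cond_distr M N W \<kappa>'" unfolding is_cond_distr_def
  proof (intro conjI ballI)
    have "{\<omega> \<in> space N. measure (\<kappa> \<omega>) I = 1} \<in> sets N"
      using measurable_compose[OF \<kappa> measurable_measure_prob_algebra[OF I(1)]] by measurable
    then show "\<kappa>' \<in> N \<rightarrow>\<^sub>M prob_algebra borel" unfolding \<kappa>'_def
      by (intro measurable_If \<kappa> measurable_const)
         (auto simp: space_prob_algebra prob_space_return)
    show "AE \<omega> in M. real_cond_exp M N (indicator (W -` B)) \<omega> = measure (\<kappa>' \<omega>) B" if "B \<in> sets borel" for B
      using cond[OF that] \<kappa>\<kappa>' by eventually_elim simp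
    show "measure (\<kappa>' \<omega>) {- ess_norm M W..ess_norm M W} = 1" if "\<omega> \<in> space M" for \<omega>
      using I unfolding I_def[symmetric] \<kappa>'_def by (simp add: measure_return)
  qed
  then have cd: "is_cond_distr M N W (cond_distr M N W)"
    unfolding cond_distr_def by (rule someI[of "is_cond_distr M N W"])
  have "AE \<omega> in M. measure (cond_distr M N W \<omega>) (basis_set i) = measure (\<kappa> \<omega>) (basis_set i)" for i
  proof -
    have "AE \<omega> in M. real_cond_exp M N (indicator (W -` basis_set i)) \<omega> = measure (cond_distr M N W \<omega>) (basis_set i)"
      using cd basis_set_measurable unfolding is_cond_distr_def by blast
    then show ?thesis using cond[OF basis_set_measurable, of i] by eventually_elim simp
  qed
  then have "AE \<omega> in M. \<forall>i. measure (cond_distr M N W \<omega>) (basis_set i) = measure (\<kappa> \<omega>) (basis_set i)"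
    by (simp add: AE_all_countable)
  moreover have "AE \<omega> in M. \<omega> \<in> space M" by simp
  ultimately show ?thesis
  proof eventually_elim
    case (elim \<omega>)
    have "cond_distr M N W \<in> N \<rightarrow>\<^sub>M prob_algebra borel" using cd by (simp add: is_cond_distr_def)
    then have "cond_distr M N W \<omega> \<in> laws" "\<kappa> \<omega> \<in> laws"
      using measurable_space \<kappa> elim space_N by metis+
    then show ?case using elim(1) by (intro prob_eq_on_basis) auto
  qed
qed

context lsc_mdp begin

lemma U_alg_facts:
  assumes t: "t \<ge> 1"
  shows "subalgebra M (G t)" "subalgebra M (U_alg M F G t)" "sets (U_alg M F G t) \<subseteq> sets (G t)"
    "sets (F t) \<subseteq> sets (U_alg M F G t)" "space (U_alg M F G t) = space M" "space (G t) = space M" "space (F t) = space M"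
proof -
  have sG: "space (G s) = space M" and sF: "space (F s) = space M" for s
    using filtration.space_F[OF filtration_G] filtration.space_F[OF filtration_F] by auto
  have Gm: "sets (G (t - 1)) \<subseteq> sets (G t)" using filtration.sets_F_mono[OF filtration_G, of "t - 1" t] by simp
  have gen: "sets (G (t - 1)) \<union> sets (F t) \<subseteq> sets (G t)" using Gm F_le_G[of t] by blast
  have pow: "sets (G (t - 1)) \<union> sets (F t) \<subseteq> Pow (space M)"
    using gen sets.space_closed[of "G t"] sG by auto
  have sU: "sets (U_alg M F G t) = sigma_sets (space M) (sets (G (t - 1)) \<union> sets (F t))"
    unfolding U_alg_def using pow by simp
  show spU: "space (U_alg M F G t) = space M" unfolding U_alg_def using pow by simp
  show UG: "sets (U_alg M F G t) \<subseteq> sets (G t)"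
    unfolding sU using sets.sigma_sets_subset[OF gen] by (simp add: sG)
  show "sets (F t) \<subseteq> sets (U_alg M F G t)" unfolding sU by (auto intro: sigma_sets.Basic)
  show "space (G t) = space M" "space (F t) = space M" by (simp_all add: sG sF)
  show "subalgebra M (G t)" using G_le_M sG by (simp add: subalgebra_def)
  show "subalgebra M (U_alg M F G t)" using UG G_le_M[of t] spU by (auto simp: subalgebra_def)
qed

lemma cost_law_emeasure:
  assumes t: "t \<ge> 1" and \<nu>: "\<nu> \<in> laws" and v: "v \<in> borel_measurable borel" and B: "B \<in> sets borel"
  shows "emeasure (cost v t x \<nu>) B = (\<integral>\<^sup>+a. \<integral>\<^sup>+y. indicator B (stage v t x (a, y)) \<partial>P t x a \<partial>\<nu>)"
proof -
  note [measurable_cong] = joint_law(2)[OF t \<nu>]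
  have st: "stage v t x \<in> borel_measurable (kernel_joint \<nu> borel (P t x))"
    using stage_measurable[OF t v] by measurable
  have st': "stage v t x \<in> borel_measurable (\<nu> \<Otimes>\<^sub>M borel)"
    using stage_measurable[OF t v] measurable_cong_sets[OF sets_pair_borel[OF space_prob_borelD(2)[OF \<nu>]] refl]
    by blast
  have "emeasure (cost v t x \<nu>) B = (\<integral>\<^sup>+z. indicator B z \<partial>distr (kernel_joint \<nu> borel (P t x)) borel (stage v t x))"
    using B by (simp add: cost_law_eq[OF t \<nu> v])
  also have "\<dots> = (\<integral>\<^sup>+z. indicator B (stage v t x z) \<partial>kernel_joint \<nu> borel (P t x))"
    by (rule nn_integral_distr[OF st]) (use B in simp)
  also have "\<dots> = (\<integral>\<^sup>+a. \<integral>\<^sup>+y. indicator B (stage v t x (a, y)) \<partial>P t x a \<partial>\<nu>)"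
    by (rule nn_integral_kernel_joint[OF joint_law(3)[OF t \<nu>]])
       (rule measurable_compose[OF st'], use B in simp)
  finally show ?thesis .
qed

text \<open>
  Given \<open>G\<^sub>t\<close> the next state has law \<open>P\<close> at the current state and action, and given
  the smaller \<open>U\<^sub>t\<close> the action has law \<open>p t\<close> at the current state. Integrating out
  in this order leaves the cost law. The cost \<open>W\<close> is prescribed only almost surely because in the
  recursion it contains conditional risks; completeness makes it measurable.
\<close>

lemma conditional_cost_law:
  assumes pair: "controlled_pair M F G \<A> P \<xi> X A" and fol: "follows_policy M F G p X A"
    and p: "p \<in> policies \<A>" and t: "t \<ge> 1" and v: "bdd_borel c v"
    and W: "AE \<omega> in M. W \<omega> = stage v t (X t \<omega>) (A t \<omega>, X (Suc t) \<omega>)"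
  shows "AE \<omega> in M. cond_distr M (U_alg M F G t) W \<omega> = cost v t (X t \<omega>) (p t (X t \<omega>))"
proof -
  interpret cM: complete_measure M by (rule complete_M)
  let ?U = "U_alg M F G t"
  let ?W = "\<lambda>\<omega>. stage v t (X t \<omega>) (A t \<omega>, X (Suc t) \<omega>)"
  note U = U_alg_facts[OF t]
  have XF: "X s \<in> F s \<rightarrow>\<^sub>M borel" and AG: "A s \<in> G s \<rightarrow>\<^sub>M borel" if "s \<ge> 1" for s
    using pair that by (auto simp: controlled_pair_def)
  have XU: "X t \<in> ?U \<rightarrow>\<^sub>M borel"
    using XF[OF t] U(4,5,7) by (auto simp: measurable_def)
  have XG: "X t \<in> G t \<rightarrow>\<^sub>M borel" and AG': "A t \<in> G t \<rightarrow>\<^sub>M borel"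
    using XU U(3,5,6) AG[OF t] by (auto simp: measurable_def)
  have XM: "X (Suc t) \<in> M \<rightarrow>\<^sub>M borel"
    using XF[of "Suc t"] F_le_G[of "Suc t"] G_le_M[of "Suc t"] U_alg_facts(7)[of "Suc t"]
    by (auto simp: measurable_def)
  have XMt: "X t \<in> M \<rightarrow>\<^sub>M borel" and AM: "A t \<in> M \<rightarrow>\<^sub>M borel"
    using measurable_from_subalg[OF U(1)] XG AG' by blast+
  have vm: "v \<in> borel_measurable borel" using bdd_borelD(1)[OF v] .
  note stm = stage_jointly_measurable[OF t vm]
  have "(\<lambda>\<omega>. ((X t \<omega>, A t \<omega>), X (Suc t) \<omega>)) \<in> M \<rightarrow>\<^sub>M (borel \<Otimes>\<^sub>M borel) \<Otimes>\<^sub>M borel"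
    using XMt AM XM by measurable
  from measurable_compose[OF this stm] have W'm: "?W \<in> borel_measurable M" by simp
  have Wm: "W \<in> borel_measurable M" by (rule cM.measurable_AE_eq[OF W'm W])
  have Wb: "AE \<omega> in M. \<bar>W \<omega>\<bar> \<le> b + \<gamma> * c"
    using W by eventually_elim (simp add: stage_bound[OF t bdd_borelD(2)[OF v]])
  have \<kappa>: "(\<lambda>\<omega>. cost v t (X t \<omega>) (p t (X t \<omega>))) \<in> ?U \<rightarrow>\<^sub>M prob_algebra borel"
    using measurable_compose[OF XU cost_kernel_measurable[OF t vm policiesD(1)[OF p t]]] .
  show ?thesis
  proof (rule cond_distr_AE_eq[OF prob_space_M U(2) Wm Wb \<kappa>])
    fix B :: "real set" assume B: "B \<in> sets borel"
    show "AE \<omega> in M. real_cond_exp M ?U (indicator (W -` B)) \<omega> = measure (cost v t (X t \<omega>) (p t (X t \<omega>))) B"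
      unfolding conditional_probability_iff[OF prob_space_M U(2) Wm \<kappa> B]
    proof
      fix D assume D: "D \<in> sets ?U"
      define q where "q x a = (\<integral>\<^sup>+y. indicator B (stage v t x (a, y)) \<partial>P t x a)" for x a
      have indm: "(\<lambda>w. indicator B (stage v t (fst (fst w)) (snd (fst w), snd w)) :: ennreal)
          \<in> borel_measurable ((borel \<Otimes>\<^sub>M borel) \<Otimes>\<^sub>M borel)"
        by (rule measurable_compose[OF stm]) (use B in simp)
      have qm: "(\<lambda>z. q (fst z) (snd z)) \<in> borel_measurable (borel \<Otimes>\<^sub>M borel)"
        unfolding q_def
      proof (rule nn_integral_measurable_subprob_algebra2)
        show "(\<lambda>(z, y). indicator B (stage v t (fst z) (snd z, y)) :: ennreal) \<in> borel_measurable ((borel \<Otimes>\<^sub>M borel) \<Otimes>\<^sub>M borel)"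
          using indm by (simp add: case_prod_beta')
        show "(\<lambda>z. P t (fst z) (snd z)) \<in> borel \<Otimes>\<^sub>M borel \<rightarrow>\<^sub>M subprob_algebra borel"
          using P_kernel[OF t] by (intro measurable_prob_algebraD) (simp add: case_prod_beta' borel_prod)
      qed
      have [measurable]: "D \<in> sets ?U" "D \<in> sets (G t)" using D U(3) by auto
      have "(\<lambda>\<omega>. (X t \<omega>, A t \<omega>)) \<in> G t \<rightarrow>\<^sub>M borel" using XG AG' by (rule borel_measurable_Pair)
      from measurable_compose[OF this P_kernel[OF t]]
      have PG: "(\<lambda>\<omega>. P t (X t \<omega>) (A t \<omega>)) \<in> G t \<rightarrow>\<^sub>M prob_algebra borel" by simp
      have "(\<lambda>z. ((X t (fst z), A t (fst z)), snd z)) \<in> G t \<Otimes>\<^sub>M borel \<rightarrow>\<^sub>M (borel \<Otimes>\<^sub>M borel) \<Otimes>\<^sub>M borel"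
        using XG AG' by measurable
      from measurable_compose[OF this indm]
      have [measurable]: "(\<lambda>z. indicator B (stage v t (X t (fst z)) (A t (fst z), snd z)) :: ennreal)
          \<in> borel_measurable (G t \<Otimes>\<^sub>M borel)" by simp
      have g1: "(\<lambda>z. indicator D (fst z) * indicator B (stage v t (X t (fst z)) (A t (fst z), snd z)) :: ennreal)
          \<in> borel_measurable (G t \<Otimes>\<^sub>M borel)" by measurable
      have pU: "(\<lambda>\<omega>. p t (X t \<omega>)) \<in> ?U \<rightarrow>\<^sub>M prob_algebra borel"
        by (rule measurable_compose[OF XU policiesD(1)[OF p t]])
      have "(\<lambda>z. (X t (fst z), snd z)) \<in> ?U \<Otimes>\<^sub>M borel \<rightarrow>\<^sub>M borel \<Otimes>\<^sub>M borel" using XU by measurable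
      from measurable_compose[OF this qm]
      have [measurable]: "(\<lambda>z. q (X t (fst z)) (snd z)) \<in> borel_measurable (?U \<Otimes>\<^sub>M borel)" by simp
      have g2: "(\<lambda>z. indicator D (fst z) * q (X t (fst z)) (snd z)) \<in> borel_measurable (?U \<Otimes>\<^sub>M borel)"
        by measurable
      have "(\<integral>\<^sup>+\<omega>. indicator D \<omega> * indicator B (W \<omega>) \<partial>M) = (\<integral>\<^sup>+\<omega>. indicator D \<omega> * indicator B (?W \<omega>) \<partial>M)"
        by (rule nn_integral_cong_AE) (use W in eventually_elim, simp)
      also have "\<dots> = (\<integral>\<^sup>+\<omega>. \<integral>\<^sup>+y. indicator D \<omega> * indicator B (stage v t (X t \<omega>) (A t \<omega>, y)) \<partial>P t (X t \<omega>) (A t \<omega>) \<partial>M)"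
        using conditional_kernel_nn_integral[OF prob_space_M U(1) XM PG _ g1] pair t
        by (simp add: controlled_pair_def)
      also have "\<dots> = (\<integral>\<^sup>+\<omega>. indicator D \<omega> * q (X t \<omega>) (A t \<omega>) \<partial>M)"
        by (intro nn_integral_cong) (auto simp: q_def indicator_def)
      also have "\<dots> = (\<integral>\<^sup>+\<omega>. \<integral>\<^sup>+a. indicator D \<omega> * q (X t \<omega>) a \<partial>p t (X t \<omega>) \<partial>M)"
        using conditional_kernel_nn_integral[OF prob_space_M U(2) AM pU _ g2] fol t
        by (simp add: follows_policy_def)
      also have "\<dots> = (\<integral>\<^sup>+\<omega>. indicator D \<omega> * emeasure (cost v t (X t \<omega>) (p t (X t \<omega>))) B \<partial>M)"
        by (intro nn_integral_cong)
           (auto simp: cost_law_emeasure[OF t policiesD(3)[OF p t] vm B] q_def indicator_def)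
      finally show "(\<integral>\<^sup>+\<omega>. indicator D \<omega> * indicator B (W \<omega>) \<partial>M)
          = (\<integral>\<^sup>+\<omega>. indicator D \<omega> * emeasure (cost v t (X t \<omega>) (p t (X t \<omega>))) B \<partial>M)" .
    qed
  qed
qed

text \<open>
  Inserting the state at time \<open>t\<close> for the parameter \<open>x\<close> matches the state at which the
  cost law of the value recursion is formed. At \<open>t = T\<close> the continuation is the zero function, as in
  the value recursion.
\<close>

lemma dyn_risk_eq_J_pol:
  assumes p: "p \<in> policies \<A>"
  defines "Z \<equiv> cost_process C (Xp p) (Ap p)"
  shows "1 \<le> t \<Longrightarrow> t \<le> T \<Longrightarrow>
    AE \<omega> in M. dyn_risk M F G \<gamma> \<sigma> (Xp p) Z T t (Xp p t \<omega>) \<omega> = ereal (JpolT p t T (Xp p t \<omega>))"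
proof (induction "T - t" arbitrary: t rule: less_induct)
  case less
  note t = \<open>1 \<le> t\<close> and tT = \<open>t \<le> T\<close>
  have pair: "controlled_pair M F G \<A> P \<xi> (Xp p) (Ap p)" and fol: "follows_policy M F G p (Xp p) (Ap p)"
    using policy_pair[OF p] \<Psi>_controlled by blast+
  define v where "v = JpolT p (Suc t) T"
  have v: "bdd_borel value_bound v" unfolding v_def by (rule Jpol_properties(4)[OF p]) simp
  define W where "W \<omega> = Z t \<omega> + (if t < T then \<gamma> * real_of_ereal
      (dyn_risk M F G \<gamma> \<sigma> (Xp p) Z T (Suc t) (Xp p (Suc t) \<omega>) \<omega>) else 0)" for \<omega>
  have "AE \<omega> in M. W \<omega> = stage v t (Xp p t \<omega>) (Ap p t \<omega>, Xp p (Suc t) \<omega>)"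
  proof (cases "t < T")
    case True
    have "AE \<omega> in M. dyn_risk M F G \<gamma> \<sigma> (Xp p) Z T (Suc t) (Xp p (Suc t) \<omega>) \<omega> = ereal (v (Xp p (Suc t) \<omega>))"
      unfolding v_def by (rule less.hyps) (use True in auto)
    then show ?thesis
      by eventually_elim (use True t in \<open>simp add: W_def Z_def cost_process_def stage_def\<close>)
  next
    case False
    then have "v = (\<lambda>_. 0)" using tT by (simp add: v_def J_pol.simps)
    then show ?thesis using False t by (simp add: W_def Z_def cost_process_def stage_def)
  qed
  from conditional_cost_law[OF pair fol p t v this]
  show ?case
  proof eventually_elim
    case (elim \<omega>)
    have WZ: "W = (\<lambda>\<omega>'. Z t \<omega>' + \<gamma> * real_of_ereal (dyn_risk M F G \<gamma> \<sigma> (Xp p) Z T (Suc t) (Xp p (Suc t) \<omega>') \<omega>'))"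
      if "t < T" using that by (simp add: W_def fun_eq_iff)
    have WT: "W = Z T" if "\<not> t < T" using that tT by (simp add: W_def fun_eq_iff)
    have "dyn_risk M F G \<gamma> \<sigma> (Xp p) Z T t (Xp p t \<omega>) \<omega> = \<sigma> t (Xp p t \<omega>) (cond_distr M (U_alg M F G t) W \<omega>)"
    proof (cases "t < T")
      case True
      then show ?thesis by (subst dyn_risk.simps) (simp add: WZ[OF True])
    next
      case False
      then have "t = T" using tT by simp
      then show ?thesis by (subst dyn_risk.simps) (simp add: WT[OF False])
    qed
    also have "\<dots> = Gop t (p t (Xp p t \<omega>)) v (Xp p t \<omega>)" by (simp add: elim G_op_def)
    also have "\<dots> = ereal (Hop p t v (Xp p t \<omega>))" by (rule Hop_Gop[OF p t v, symmetric])
    also have "Hop p t v = JpolT p t T" using tT by (simp add: v_def J_pol.simps[of _ _ _ _ _ t])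
    finally show ?case .
  qed
qed

lemma dyn_risk0_eq_J_pol0:
  assumes p: "p \<in> policies \<A>" and T: "1 \<le> T"
  shows "risk0T p T = Jpol0T p T"
proof -
  interpret cM: complete_measure M by (rule complete_M)
  have pair: "controlled_pair M F G \<A> P \<xi> (Xp p) (Ap p)" using policy_pair[OF p] \<Psi>_controlled by blast
  define J where "J = JpolT p 1 T"
  have Jm: "J \<in> borel_measurable borel"
    unfolding J_def by (rule bdd_borelD(1)[OF Jpol_properties(4)[OF p order_refl]])
  have "subalgebra M (F 1)"
    using subset_trans[OF F_le_G[of 1] G_le_M[of 1]] U_alg_facts(7)[OF order_refl] by (simp add: subalgebra_def)
  moreover have "Xp p 1 \<in> F 1 \<rightarrow>\<^sub>M borel" using pair unfolding controlled_pair_def by blast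
  ultimately have X1: "Xp p 1 \<in> M \<rightarrow>\<^sub>M borel" by (rule measurable_from_subalg)
  have \<xi>: "distr M borel (Xp p 1) = \<xi>" using pair by (simp add: controlled_pair_def)
  have gJ: "(\<lambda>\<omega>. \<gamma> * J (Xp p 1 \<omega>)) \<in> borel_measurable M"
    using measurable_compose[OF X1 Jm] by measurable
  let ?D = "\<lambda>\<omega>. cost_process C (Xp p) (Ap p) 0 \<omega> + \<gamma> * real_of_ereal
      (dyn_risk M F G \<gamma> \<sigma> (Xp p) (cost_process C (Xp p) (Ap p)) T 1 (Xp p 1 \<omega>) \<omega>)"
  have AE: "AE \<omega> in M. ?D \<omega> = \<gamma> * J (Xp p 1 \<omega>)"
    using dyn_risk_eq_J_pol[OF p order_refl T] by eventually_elim (simp add: cost_process_def J_def)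
  have "distr M borel ?D = distr M borel (\<lambda>\<omega>. \<gamma> * J (Xp p 1 \<omega>))"
    by (rule distr_cong_AE[OF refl refl AE cM.measurable_AE_eq[OF gJ AE] gJ])
  also have "\<dots> = distr (distr M borel (Xp p 1)) borel (\<lambda>y. \<gamma> * J y)"
    using Jm X1 by (simp add: distr_distr comp_def)
  finally show ?thesis
    unfolding dyn_risk0_def J_pol0_def H0_op_def \<xi> J_def by (rule arg_cong[of _ _ \<sigma>0])
qed


lemma dyn_risk0_tendsto:
  assumes p: "p \<in> policies \<A>"
  shows "(\<lambda>T. risk0T p T) \<longlonglongrightarrow> H0 (Jpol p 1)"
proof (rule Lim_transform_eventually[OF J_pol0_tendsto[OF p]])
  show "eventually (\<lambda>T. Jpol0T p T =
      risk0T p T) sequentially"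
    using eventually_ge_at_top[of 1] by eventually_elim (simp add: dyn_risk0_eq_J_pol0[OF p])
qed

lemma dyn_risk0_inf_eq:
  assumes p: "p \<in> policies \<A>"
  shows "risk0 p = H0 (Jpol p 1)"
  unfolding dyn_risk0_inf_def by (rule limI[OF dyn_risk0_tendsto[OF p]])

lemma J_pol0_inf_eq:
  assumes p: "p \<in> policies \<A>"
  shows "J_pol0_inf \<gamma> \<sigma>0 \<sigma> P \<xi> C p = H0 (Jpol p 1)"
  unfolding J_pol0_inf_def by (rule limI[OF J_pol0_tendsto[OF p]])

lemma Jopt_seq_linf: "J_opt_inf \<gamma> \<sigma> \<A> P C \<in> seq_linf"
  using Jopt_borel unfolding seq_linf_def bdd_borel_def by blast

section \<open>Optimality\<close>

text \<open>
  The time-0 risk is monotone in the value at time 1, so that its infimum over policies is attained where that value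
  is smallest at every state.
\<close>

theorem argmin_policy_optimal:
  assumes arg: "\<And>t. t \<ge> 1 \<Longrightarrow> p t \<in> borel \<rightarrow>\<^sub>M prob_algebra borel \<and> (\<forall>x. p t x \<in> argmin t (Jopt (Suc t)) x)"
  shows "t \<ge> 1 \<Longrightarrow> Jpol p t x = Jopt t x"
    and "t \<ge> 1 \<Longrightarrow> ereal (Jopt t x) = (INF q\<in>policies \<A>. ereal (Jpol q t x))"
    and "J_pol0_inf \<gamma> \<sigma>0 \<sigma> P \<xi> C p = H0 (Jopt 1)"
    and "H0 (Jopt 1) = (INF q\<in>policies \<A>. risk0 q)"
proof -
  have p: "p \<in> policies \<A>" by (rule argmin_policy) (rule arg)
  have eq: "Jpol p t = Jopt t" if "t \<ge> 1" for t by (intro ext Jpol_argmin_policy[OF arg that])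
  then show "t \<ge> 1 \<Longrightarrow> Jpol p t x = Jopt t x" by simp
  show "ereal (Jopt t x) = (INF q\<in>policies \<A>. ereal (Jpol q t x))" if t: "t \<ge> 1"
  proof (rule antisym)
    show "ereal (Jopt t x) \<le> (INF q\<in>policies \<A>. ereal (Jpol q t x))"
      by (rule INF_greatest) (simp add: Jopt_le_Jpol[OF _ t])
    have "(INF q\<in>policies \<A>. ereal (Jpol q t x)) \<le> ereal (Jpol p t x)" by (rule INF_lower[OF p])
    then show "(INF q\<in>policies \<A>. ereal (Jpol q t x)) \<le> ereal (Jopt t x)" unfolding eq[OF t] .
  qed
  show "J_pol0_inf \<gamma> \<sigma>0 \<sigma> P \<xi> C p = H0 (Jopt 1)"
    unfolding J_pol0_inf_eq[OF p] eq[OF order_refl] ..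
  show "H0 (Jopt 1) = (INF q\<in>policies \<A>. risk0 q)"
  proof (rule antisym)
    show "H0 (Jopt 1) \<le> (INF q\<in>policies \<A>. risk0 q)"
    proof (rule INF_greatest)
      fix q assume q: "q \<in> policies \<A>"
      have "H0 (Jopt 1) \<le> H0 (Jpol q 1) + ereal (\<gamma> * 0)"
        by (rule H0_mono[OF Jopt_borel[OF order_refl] Jpol_properties(2)[OF q order_refl]])
           (simp add: Jopt_le_Jpol[OF q])
      then show "H0 (Jopt 1) \<le> risk0 q"
        unfolding dyn_risk0_inf_eq[OF q] by (simp add: zero_ereal_def[symmetric])
    qed
    have "(INF q\<in>policies \<A>. risk0 q)
        \<le> risk0 p"
      by (rule INF_lower[OF p])
    then show "(INF q\<in>policies \<A>. risk0 q) \<le> H0 (Jopt 1)"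
      unfolding dyn_risk0_inf_eq[OF p] eq[OF order_refl] .
  qed
qed

end

theorem theorem5p5:
  fixes M :: "'w measure"
    and F G :: "nat \<Rightarrow> 'w measure"
    and \<sigma>0 :: "real measure \<Rightarrow> ereal"
    and \<sigma> :: "nat \<Rightarrow> 'x::polish_space \<Rightarrow> real measure \<Rightarrow> ereal"
    and \<A> :: "nat \<Rightarrow> 'x \<Rightarrow> 'a::polish_space set"
    and P :: "nat \<Rightarrow> 'x \<Rightarrow> 'a \<Rightarrow> 'x measure"
    and \<xi> :: "'x measure"
    and C :: "nat \<Rightarrow> 'x \<Rightarrow> 'a \<Rightarrow> 'x \<Rightarrow> real"
    and \<Psi> :: "((nat \<Rightarrow> 'w \<Rightarrow> 'x) \<times> (nat \<Rightarrow> 'w \<Rightarrow> 'a)) set"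
    and Xp :: "(nat \<Rightarrow> 'x \<Rightarrow> 'a measure) \<Rightarrow> nat \<Rightarrow> 'w \<Rightarrow> 'x"
    and Ap :: "(nat \<Rightarrow> 'x \<Rightarrow> 'a measure) \<Rightarrow> nat \<Rightarrow> 'w \<Rightarrow> 'a"
    and \<gamma> b :: real
  assumes mdp: "risk_averse_mdp M F G \<sigma>0 \<sigma> \<A> P \<xi> C \<Psi> Xp Ap"
    and gamma: "0 \<le> \<gamma>" "\<gamma> < 1"
    and normalized: "\<And>t x. t \<ge> 1 \<Longrightarrow> \<sigma> t x (return borel 0) = 0"
    and weakly_continuous:
      "\<And>t f xs x as a. t \<ge> 1 \<Longrightarrow> continuous_on UNIV f \<Longrightarrow> bounded (range f) \<Longrightarrow>
         xs \<longlonglongrightarrow> x \<Longrightarrow> as \<longlonglongrightarrow> a \<Longrightarrow>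
         (\<lambda>n. \<integral>y. f y \<partial>(P t (xs n) (as n))) \<longlonglongrightarrow> ((\<integral>y. f y \<partial>(P t x a)) :: real)"
    and actions_compact: "\<And>t. t \<ge> 1 \<Longrightarrow> compact (\<Union>x. \<A> t x)"
    and actions_uhc:
      "\<And>t x U. t \<ge> 1 \<Longrightarrow> open U \<Longrightarrow> \<A> t x \<subseteq> U \<Longrightarrow>
         \<exists>V. open V \<and> x \<in> V \<and> (\<forall>z\<in>V. \<A> t z \<subseteq> U)"
    and sigma_lsc:
      "\<And>t K \<mu>s \<mu> xs x. t \<ge> 1 \<Longrightarrow> compact K \<Longrightarrow> (\<And>n. \<mu>s n \<in> prob_on K) \<Longrightarrow> \<mu> \<in> prob_on K \<Longrightarrow>
         limitin weak_topology \<mu>s \<mu> sequentially \<Longrightarrow> xs \<longlonglongrightarrow> x \<Longrightarrow>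
         liminf (\<lambda>n. \<sigma> t (xs n) (\<mu>s n)) \<ge> \<sigma> t x \<mu>"
    and C_lsc: "\<And>t. t \<ge> 1 \<Longrightarrow> lower_semicontinuous (\<lambda>(x, a, y). C t x a y)"
    and b_pos: "b > 0"
    and C_bound: "\<And>t x a y. t \<ge> 1 \<Longrightarrow> \<bar>C t x a y\<bar> \<le> b"
  shows
    "((\<forall>t\<ge>1. \<forall>x. convergent (\<lambda>T. J_opt \<gamma> \<sigma> \<A> P C t T x)) \<and>
      J_opt_inf \<gamma> \<sigma> \<A> P C \<in> seq_linf \<and>
      (\<forall>p\<in>policies \<A>.
         (\<forall>t\<ge>1. \<forall>x. convergent (\<lambda>T. J_pol \<gamma> \<sigma> P C p t T x)) \<and>
         convergent (\<lambda>T. J_pol0 \<gamma> \<sigma>0 \<sigma> P \<xi> C p T) \<and>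
         convergent (\<lambda>T. dyn_risk0 M F G \<gamma> \<sigma>0 \<sigma> (Xp p) (cost_process C (Xp p) (Ap p)) T)))
     \<and>
     ((\<forall>t\<ge>1. J_opt_inf \<gamma> \<sigma> \<A> P C t = S_op \<gamma> \<sigma> \<A> P C t (J_opt_inf \<gamma> \<sigma> \<A> P C (Suc t))) \<and>
      (\<forall>J'\<in>seq_linf. (\<forall>t\<ge>1. J' t = S_op \<gamma> \<sigma> \<A> P C t (J' (Suc t))) \<longrightarrow>
         (\<forall>t\<ge>1. J' t = J_opt_inf \<gamma> \<sigma> \<A> P C t)))
     \<and>
     (\<forall>t\<ge>1.
        (\<forall>x. argmin_set \<gamma> \<sigma> \<A> P C t (J_opt_inf \<gamma> \<sigma> \<A> P C (Suc t)) x \<noteq> {} \<and>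
             closedin weak_topology
               (argmin_set \<gamma> \<sigma> \<A> P C t (J_opt_inf \<gamma> \<sigma> \<A> P C (Suc t)) x)) \<and>
        (\<exists>\<pi>. \<pi> \<in> borel \<rightarrow>\<^sub>M prob_algebra borel \<and>
             (\<forall>x. \<pi> x \<in> argmin_set \<gamma> \<sigma> \<A> P C t (J_opt_inf \<gamma> \<sigma> \<A> P C (Suc t)) x)))
     \<and>
     (\<forall>p.
        (\<forall>t\<ge>1. p t \<in> borel \<rightarrow>\<^sub>M prob_algebra borel \<and>
             (\<forall>x. p t x \<in> argmin_set \<gamma> \<sigma> \<A> P C t (J_opt_inf \<gamma> \<sigma> \<A> P C (Suc t)) x)) \<longrightarrow>
        (\<forall>t\<ge>1. \<forall>x.
             J_pol_inf \<gamma> \<sigma> P C p t x = J_opt_inf \<gamma> \<sigma> \<A> P C t x \<and>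
             ereal (J_opt_inf \<gamma> \<sigma> \<A> P C t x)
               = (INF q\<in>policies \<A>. ereal (J_pol_inf \<gamma> \<sigma> P C q t x))) \<and>
        J_pol0_inf \<gamma> \<sigma>0 \<sigma> P \<xi> C p = H0_op \<gamma> \<sigma>0 \<xi> (J_opt_inf \<gamma> \<sigma> \<A> P C 1) \<and>
        H0_op \<gamma> \<sigma>0 \<xi> (J_opt_inf \<gamma> \<sigma> \<A> P C 1)
          = (INF q\<in>policies \<A>.
               dyn_risk0_inf M F G \<gamma> \<sigma>0 \<sigma> (Xp q) (cost_process C (Xp q) (Ap q))))"
proof -
  interpret lsc_mdp M F G \<sigma>0 \<sigma> \<A> P \<xi> C \<Psi> Xp Ap \<gamma> b
    by (rule lsc_mdp.intro[OF mdp lsc_mdp_axioms.intro]) (fact assms)+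
  have pol: "convergent (\<lambda>T. JpolT p t T x)" if "p \<in> policies \<A>" "t \<ge> 1" for p t x
    using Jpol_properties(1)[OF that] .
  have pol0: "convergent (\<lambda>T. Jpol0T p T)"
    and risk: "convergent (\<lambda>T. risk0T p T)"
    if "p \<in> policies \<A>" for p
    using J_pol0_tendsto[OF that] dyn_risk0_tendsto[OF that] unfolding convergent_def by blast+
  show ?thesis
  proof (intro conjI allI ballI impI)
    fix t :: nat and x assume t: "1 \<le> t"
    show "argmin t (Jopt (Suc t)) x \<noteq> {}" "closedin weak_topology (argmin t (Jopt (Suc t)) x)"
      using argmin_selection(1,2)[OF t Jopt_properties(2)[of "Suc t"]] by simp_all
  next
    fix t :: nat assume t: "1 \<le> t"
    show "\<exists>\<pi>. \<pi> \<in> borel \<rightarrow>\<^sub>M prob_algebra borel \<and> (\<forall>x. \<pi> x \<in> argmin t (Jopt (Suc t)) x)"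
      using argmin_selection(3)[OF t Jopt_properties(2)[of "Suc t"]] by simp
  next
    fix J' and t :: nat assume "J' \<in> seq_linf" "\<forall>t\<ge>1. J' t = Sop t (J' (Suc t))" "1 \<le> t"
    then show "J' t = Jopt t" using Jopt_unique[of J' t] by blast
  next
    fix p and t :: nat and x
    assume "\<forall>t\<ge>1. p t \<in> borel \<rightarrow>\<^sub>M prob_algebra borel \<and> (\<forall>x. p t x \<in> argmin t (Jopt (Suc t)) x)" "1 \<le> t"
    then show "Jpol p t x = Jopt t x" "ereal (Jopt t x) = (INF q\<in>policies \<A>. ereal (Jpol q t x))"
      using argmin_policy_optimal(1,2)[of p t x] by blast+
  next
    fix p assume "\<forall>t\<ge>1. p t \<in> borel \<rightarrow>\<^sub>M prob_algebra borel \<and> (\<forall>x. p t x \<in> argmin t (Jopt (Suc t)) x)"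
    then show "J_pol0_inf \<gamma> \<sigma>0 \<sigma> P \<xi> C p = H0 (Jopt 1)"
      "H0 (Jopt 1) = (INF q\<in>policies \<A>. risk0 q)"
      using argmin_policy_optimal(3,4)[of p] by blast+
  qed (simp_all add: Jopt_properties(1) Jopt_properties(3)[symmetric] Jopt_seq_linf pol pol0 risk)
qed

end
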